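(* Let $T$ be an arbitrary complete first-order theory, let $S$ be a product of sorts of the language of $T$ (possibly with an unbounded number of factors, repetitions allowed), and let $X$ be a $\emptyset$-type-definable subset of $S$. For a monster model $\mathfrak C$ of $T$, let $u\mathcal M$ be the Ellis group of the $\mathrm{Aut}(\mathfrak C)$-flow $S_X(\mathfrak C)$. Then $u\mathcal M$ is of bounded size (i.e. of cardinality smaller than the degree of saturation of $\mathfrak C$), and it does not depend on the choice of the monster model: for any two monster models $\mathfrak C_1,\mathfrak C_2$ of $T$, the Ellis groups of the flows $S_X(\mathfrak C_1)$ and $S_X(\mathfrak C_2)$ are isomorphic as groups equipped with their $\tau$-topologies (i.e. via a group isomorphism which is a homeomorphism for the $\tau$-topologies).
   Context: A monster model $\mathfrak C$ of $T$ is a $\kappa$-saturated, strongly $\kappa$-homogeneous model for a large strong limit cardinal $\kappa$; a cardinal is bounded if it is $<\kappa$. If $S=\prod_{i\in I}S_i$ is a product of sorts with corresponding variables $\bar x=(x_i)_{i\in I}$, a $\emptyset$-type-definable subset $X$ of $S$ is a partial type over $\emptyset$ in $\bar x$, and $S_X(\mathfrak C)$ is the space (with the usual Stone topology) of complete types over $\mathfrak C$ in $\bar x$ containing $X$. $\mathrm{Aut}(\mathfrak C)$ acts on $S_X(\mathfrak C)$ by $\sigma(p)=\{\varphi(\bar x,\sigma(\bar a)):\varphi(\bar x,\bar a)\in p\}$, making it an $\mathrm{Aut}(\mathfrak C)$-flow. The Ellis semigroup $EL=EL(S_X(\mathfrak C))$ is the closure, in $S_X(\mathfrak C)^{S_X(\mathfrak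 C)}$ with the product topology, of the set of maps $p\mapsto \sigma(p)$ for $\sigma\in\mathrm{Aut}(\mathfrak C)$; it is a compact semigroup under composition. If $\mathcal M$ is a minimal left ideal of $EL$ and $u\in\mathcal M$ is an idempotent, then $u\mathcal M$ is a group, called the Ellis group of the flow (its isomorphism type does not depend on the choice of $\mathcal M,u$). The $\tau$-topology: for $\eta\in EL$ and $A\subseteq EL$ let $\eta\circ A$ be the set of all limits of convergent nets $(\sigma_i(a_i))_i$ where $(\sigma_i)_i$ is a net in $\mathrm{Aut}(\mathfrak C)$ (viewed inside $EL$) converging to $\eta$ and $a_i\in A$; for $A\subseteq u\mathcal M$ put $\mathrm{cl}_\tau(A)=(u\circ A)\cap u\mathcal M$. This is a closure operator on $u\mathcal M$ and defines the $\tau$-topology. *)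

theory Defs
  imports "HOL-Analysis.Analysis" "HOL-Algebra.Group"
begin

unbundle cardinal_syntax

text \<open>
  The sorts of a language are the elements of the type \<open>'s\<close>; its function and relation symbols are
  those \<open>f :: 'f\<close> and \<open>r :: 'r\<close> on which the partial maps below are defined, so that there may be
  none. Constants are function symbols of arity \<open>[]\<close>.
\<close>

record ('s, 'f, 'r) lang =
  fun_sort :: "'f \<rightharpoonup> 's list \<times> 's"
  rel_sort :: "'r \<rightharpoonup> 's list"

text \<open>Bound variables are de Bruijn indices, free variables are named by elements of \<open>'v\<close>.\<close>

datatype (dead 'f, 'v) tm =
    Bd nat
  | Fr 'v
  | Fn 'f "('f, 'v) tm list"

datatype (dead 's, dead 'f, dead 'r, 'v) fm =
    Eq "('f, 'v) tm" "('f, 'v) tm"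
  | Rel 'r "('f, 'v) tm list"
  | Neg "('s, 'f, 'r, 'v) fm"
  | Conj "('s, 'f, 'r, 'v) fm" "('s, 'f, 'r, 'v) fm"
  | Ex 's "('s, 'f, 'r, 'v) fm"

text \<open>
  A partial map \<open>v :: 'v \<rightharpoonup> 's\<close> declares the free variables \<open>dom v\<close> together with their sorts; the
  list \<open>c\<close> holds the sorts of the bound variables, innermost first.
\<close>

inductive has_sort ::
  "('s, 'f, 'r) lang \<Rightarrow> ('v \<rightharpoonup> 's) \<Rightarrow> 's list \<Rightarrow> ('f, 'v) tm \<Rightarrow> 's \<Rightarrow> bool"
  for L v c where
  "n < length c \<Longrightarrow> has_sort L v c (Bd n) (c ! n)"
| "v x = Some s \<Longrightarrow> has_sort L v c (Fr x) s"
| "fun_sort L f = Some (ss, s) \<Longrightarrow> list_all2 (has_sort L v c) ts ss \<Longrightarrow> has_sort L v c (Fn f ts) s"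

primrec wf_fm ::
  "('s, 'f, 'r) lang \<Rightarrow> ('v \<rightharpoonup> 's) \<Rightarrow> 's list \<Rightarrow> ('s, 'f, 'r, 'v) fm \<Rightarrow> bool" where
  "wf_fm L v c (Eq t u) \<longleftrightarrow> (\<exists>s. has_sort L v c t s \<and> has_sort L v c u s)"
| "wf_fm L v c (Rel r ts) \<longleftrightarrow> (\<exists>ss. rel_sort L r = Some ss \<and> list_all2 (has_sort L v c) ts ss)"
| "wf_fm L v c (Neg \<phi>) \<longleftrightarrow> wf_fm L v c \<phi>"
| "wf_fm L v c (Conj \<phi> \<psi>) \<longleftrightarrow> wf_fm L v c \<phi> \<and> wf_fm L v c \<psi>"
| "wf_fm L v c (Ex s \<phi>) \<longleftrightarrow> wf_fm L v (s # c) \<phi>"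

definition formulas :: "('s, 'f, 'r) lang \<Rightarrow> ('v \<rightharpoonup> 's) \<Rightarrow> ('s, 'f, 'r, 'v) fm set" where
  "formulas L v = {\<phi>. wf_fm L v [] \<phi>}"

abbreviation sentences :: "('s, 'f, 'r) lang \<Rightarrow> ('s, 'f, 'r, unit) fm set" where
  "sentences L \<equiv> formulas L Map.empty"

text \<open>The sorts of a structure are an indexed family; they need not be disjoint as sets.\<close>

record ('s, 'f, 'r, 'm) struct =
  Dom :: "'s \<Rightarrow> 'm set"
  FunI :: "'f \<Rightarrow> 'm list \<Rightarrow> 'm"
  RelI :: "'r \<Rightarrow> 'm list set"

definition in_sorts :: "('s, 'f, 'r, 'm) struct \<Rightarrow> 'm list \<Rightarrow> 's list \<Rightarrow> bool" where
  "in_sorts M as ss \<longleftrightarrow> list_all2 (\<lambda>a s. a \<in> Dom M s) as ss"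

definition is_struct :: "('s, 'f, 'r) lang \<Rightarrow> ('s, 'f, 'r, 'm) struct \<Rightarrow> bool" where
  "is_struct L M \<longleftrightarrow>
     (\<forall>s. Dom M s \<noteq> {}) \<and>
     (\<forall>f ss s as. fun_sort L f = Some (ss, s) \<longrightarrow> in_sorts M as ss \<longrightarrow> FunI M f as \<in> Dom M s)"

primrec tm_val :: "('s, 'f, 'r, 'm) struct \<Rightarrow> ('v \<Rightarrow> 'm) \<Rightarrow> 'm list \<Rightarrow> ('f, 'v) tm \<Rightarrow> 'm" where
  "tm_val M e b (Bd n) = b ! n"
| "tm_val M e b (Fr x) = e x"
| "tm_val M e b (Fn f ts) = FunI M f (map (tm_val M e b) ts)"

primrec sat ::
  "('s, 'f, 'r, 'm) struct \<Rightarrow> ('v \<Rightarrow> 'm) \<Rightarrow> 'm list \<Rightarrow> ('s, 'f, 'r, 'v) fm \<Rightarrow> bool" where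
  "sat M e b (Eq t u) \<longleftrightarrow> tm_val M e b t = tm_val M e b u"
| "sat M e b (Rel r ts) \<longleftrightarrow> map (tm_val M e b) ts \<in> RelI M r"
| "sat M e b (Neg \<phi>) \<longleftrightarrow> \<not> sat M e b \<phi>"
| "sat M e b (Conj \<phi> \<psi>) \<longleftrightarrow> sat M e b \<phi> \<and> sat M e b \<psi>"
| "sat M e b (Ex s \<phi>) \<longleftrightarrow> (\<exists>a\<in>Dom M s. sat M e (a # b) \<phi>)"

definition model_of ::
  "('s, 'f, 'r) lang \<Rightarrow> ('s, 'f, 'r, unit) fm set \<Rightarrow> ('s, 'f, 'r, 'm) struct \<Rightarrow> bool" where
  "model_of L T M \<longleftrightarrow> is_struct L M \<and> (\<forall>\<phi>\<in>T. \<forall>e. sat M e [] \<phi>)"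

text \<open>
  Theories are deductively closed. Consistency of \<open>T\<close> is not repeated here: below, \<open>T\<close> always
  comes with a model.
\<close>

definition complete_theory ::
  "('s, 'f, 'r) lang \<Rightarrow> ('s, 'f, 'r, unit) fm set \<Rightarrow> bool" where
  "complete_theory L T \<longleftrightarrow>
     T \<subseteq> sentences L \<and> (\<forall>\<phi>\<in>sentences L. (\<phi> \<in> T) \<noteq> (Neg \<phi> \<in> T))"

text \<open>An element \<open>a\<close> of sort \<open>s\<close> is the pair \<open>(s, a)\<close>.\<close>

definition elems :: "('s, 'f, 'r, 'm) struct \<Rightarrow> ('s \<times> 'm) set" where
  "elems M = (SIGMA s:UNIV. Dom M s)"

definition param_sort :: "('s \<times> 'm) set \<Rightarrow> ('s \<times> 'm \<rightharpoonup> 's)" where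
  "param_sort A = (\<lambda>x. if x \<in> A then Some (fst x) else None)"

text \<open>
  Formulas over \<open>A\<close> in the variables \<open>dom v\<close>: parameters from \<open>A\<close> are additional free variables,
  evaluated at themselves.
\<close>

definition formulas_over ::
  "('s, 'f, 'r) lang \<Rightarrow> ('i \<rightharpoonup> 's) \<Rightarrow> ('s \<times> 'm) set \<Rightarrow> ('s, 'f, 'r, 'i + 's \<times> 'm) fm set" where
  "formulas_over L v A = formulas L (case_sum v (param_sort A))"

definition sat_over ::
  "('s, 'f, 'r, 'm) struct \<Rightarrow> ('i \<Rightarrow> 'm) \<Rightarrow> ('s, 'f, 'r, 'i + 's \<times> 'm) fm \<Rightarrow> bool" where
  "sat_over M e \<phi> \<longleftrightarrow> sat M (case_sum e snd) [] \<phi>"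

definition tuples :: "('s, 'f, 'r, 'm) struct \<Rightarrow> ('i \<rightharpoonup> 's) \<Rightarrow> ('i \<Rightarrow> 'm) set" where
  "tuples M v = {e. \<forall>i s. v i = Some s \<longrightarrow> e i \<in> Dom M s}"

definition fin_satisfiable ::
  "('s, 'f, 'r, 'm) struct \<Rightarrow> ('i \<rightharpoonup> 's) \<Rightarrow> ('s, 'f, 'r, 'i + 's \<times> 'm) fm set \<Rightarrow> bool" where
  "fin_satisfiable M v p \<longleftrightarrow>
     (\<forall>F. F \<subseteq> p \<longrightarrow> finite F \<longrightarrow> (\<exists>e\<in>tuples M v. \<forall>\<phi>\<in>F. sat_over M e \<phi>))"

definition saturated ::
  "('s, 'f, 'r) lang \<Rightarrow> 'k rel \<Rightarrow> ('s, 'f, 'r, 'm) struct \<Rightarrow> bool" where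
  "saturated L \<kappa> M \<longleftrightarrow>
     (\<forall>A s (p :: ('s, 'f, 'r, unit + 's \<times> 'm) fm set).
        A \<subseteq> elems M \<longrightarrow> |A| <o \<kappa> \<longrightarrow>
        p \<subseteq> formulas_over L [() \<mapsto> s] A \<longrightarrow> fin_satisfiable M [() \<mapsto> s] p \<longrightarrow>
        (\<exists>e\<in>tuples M [() \<mapsto> s]. \<forall>\<phi>\<in>p. sat_over M e \<phi>))"

definition automorphisms ::
  "('s, 'f, 'r) lang \<Rightarrow> ('s, 'f, 'r, 'm) struct \<Rightarrow> ('s \<Rightarrow> 'm \<Rightarrow> 'm) set" where
  "automorphisms L M = {\<sigma>.
     (\<forall>s. bij_betw (\<sigma> s) (Dom M s) (Dom M s)) \<and>
     (\<forall>f ss s as. fun_sort L f = Some (ss, s) \<longrightarrow> in_sorts M as ss \<longrightarrow>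
        \<sigma> s (FunI M f as) = FunI M f (map2 \<sigma> ss as)) \<and>
     (\<forall>r ss as. rel_sort L r = Some ss \<longrightarrow> in_sorts M as ss \<longrightarrow>
        (map2 \<sigma> ss as \<in> RelI M r \<longleftrightarrow> as \<in> RelI M r))}"

definition elementary_map ::
  "('s, 'f, 'r) lang \<Rightarrow> ('s, 'f, 'r, 'm) struct \<Rightarrow> ('s \<times> 'm) set \<Rightarrow> ('s \<Rightarrow> 'm \<Rightarrow> 'm) \<Rightarrow> bool" where
  "elementary_map L M A f \<longleftrightarrow>
     (\<forall>(s, a)\<in>A. f s a \<in> Dom M s) \<and>
     (\<forall>\<phi>\<in>formulas L (param_sort A). sat M snd [] \<phi> \<longleftrightarrow> sat M (case_prod f) [] \<phi>)"

definition strongly_homogeneous ::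
  "('s, 'f, 'r) lang \<Rightarrow> 'k rel \<Rightarrow> ('s, 'f, 'r, 'm) struct \<Rightarrow> bool" where
  "strongly_homogeneous L \<kappa> M \<longleftrightarrow>
     (\<forall>A f. A \<subseteq> elems M \<longrightarrow> |A| <o \<kappa> \<longrightarrow> elementary_map L M A f \<longrightarrow>
        (\<exists>\<sigma>\<in>automorphisms L M. \<forall>(s, a)\<in>A. \<sigma> s a = f s a))"

definition strong_limit :: "'k rel \<Rightarrow> bool" where
  "strong_limit \<kappa> \<longleftrightarrow>
     Card_order \<kappa> \<and> infinite (Field \<kappa>) \<and> (\<forall>A. A \<subseteq> Field \<kappa> \<longrightarrow> |A| <o \<kappa> \<longrightarrow> |Pow A| <o \<kappa>)"

text \<open>
  ``Large'' is read as \<open>|T| < \<kappa>\<close>. As \<open>T\<close> is complete, \<open>|T|\<close> is the number of sentences, which is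
  also the number of formulas (in countably many variables of each sort): the maximum of \<open>\<aleph>\<^sub>0\<close> and
  the numbers of sorts, function symbols and relation symbols.
\<close>

definition monster_model ::
  "('s, 'f, 'r) lang \<Rightarrow> ('s, 'f, 'r, unit) fm set \<Rightarrow> 'k rel \<Rightarrow> ('s, 'f, 'r, 'm) struct \<Rightarrow> bool" where
  "monster_model L T \<kappa> M \<longleftrightarrow>
     strong_limit \<kappa> \<and> |sentences L| <o \<kappa> \<and>
     model_of L T M \<and> saturated L \<kappa> M \<and> strongly_homogeneous L \<kappa> M"

definition type_set ::
  "('s, 'f, 'r) lang \<Rightarrow> ('s, 'f, 'r, 'm) struct \<Rightarrow> ('i \<rightharpoonup> 's) \<Rightarrow> ('s, 'f, 'r, 'i) fm set \<Rightarrow>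
   ('s, 'f, 'r, 'i + 's \<times> 'm) fm set set" where
  "type_set L M v X = {p.
     p \<subseteq> formulas_over L v (elems M) \<and> fin_satisfiable M v p \<and>
     (\<forall>\<phi>\<in>formulas_over L v (elems M). \<phi> \<in> p \<or> Neg \<phi> \<in> p) \<and>
     map_fm Inl ` X \<subseteq> p}"

definition type_space ::
  "('s, 'f, 'r) lang \<Rightarrow> ('s, 'f, 'r, 'm) struct \<Rightarrow> ('i \<rightharpoonup> 's) \<Rightarrow> ('s, 'f, 'r, 'i) fm set \<Rightarrow>
   ('s, 'f, 'r, 'i + 's \<times> 'm) fm set topology" where
  "type_space L M v X =
     topology_generated_by ((\<lambda>\<phi>. {p \<in> type_set L M v X. \<phi> \<in> p}) ` formulas_over L v (elems M))"

definition aut_act ::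
  "('s \<Rightarrow> 'm \<Rightarrow> 'm) \<Rightarrow> ('s, 'f, 'r, 'i + 's \<times> 'm) fm set \<Rightarrow> ('s, 'f, 'r, 'i + 's \<times> 'm) fm set" where
  "aut_act \<sigma> p = map_fm (map_sum id (\<lambda>(s, a). (s, \<sigma> s a))) ` p"

definition aut_maps ::
  "('s, 'f, 'r) lang \<Rightarrow> ('s, 'f, 'r, 'm) struct \<Rightarrow> ('i \<rightharpoonup> 's) \<Rightarrow> ('s, 'f, 'r, 'i) fm set \<Rightarrow>
   (('s, 'f, 'r, 'i + 's \<times> 'm) fm set \<Rightarrow> ('s, 'f, 'r, 'i + 's \<times> 'm) fm set) set" where
  "aut_maps L M v X = (\<lambda>\<sigma>. restrict (aut_act \<sigma>) (type_set L M v X)) ` automorphisms L M"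

text \<open>
  A flow enters only through its compact space \<open>S\<close> and the set \<open>\<Gamma>\<close> of maps by which the group acts,
  restricted to \<open>topspace S\<close>.
\<close>

definition Ellis_space :: "'x topology \<Rightarrow> ('x \<Rightarrow> 'x) set \<Rightarrow> ('x \<Rightarrow> 'x) topology" where
  "Ellis_space S \<Gamma> =
     (let P = product_topology (\<lambda>_. S) (topspace S) in subtopology P (P closure_of \<Gamma>))"

definition Ellis_semigroup :: "'x topology \<Rightarrow> ('x \<Rightarrow> 'x) set \<Rightarrow> ('x \<Rightarrow> 'x) set" where
  "Ellis_semigroup S \<Gamma> = topspace (Ellis_space S \<Gamma>)"

definition left_ideal :: "'x topology \<Rightarrow> ('x \<Rightarrow> 'x) set \<Rightarrow> ('x \<Rightarrow> 'x) set \<Rightarrow> bool" where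
  "left_ideal S \<Gamma> I \<longleftrightarrow>
     I \<noteq> {} \<and> I \<subseteq> Ellis_semigroup S \<Gamma> \<and>
     (\<forall>\<eta>\<in>Ellis_semigroup S \<Gamma>. \<forall>\<mu>\<in>I. compose (topspace S) \<eta> \<mu> \<in> I)"

definition minimal_left_ideal :: "'x topology \<Rightarrow> ('x \<Rightarrow> 'x) set \<Rightarrow> ('x \<Rightarrow> 'x) set \<Rightarrow> bool" where
  "minimal_left_ideal S \<Gamma> I \<longleftrightarrow>
     left_ideal S \<Gamma> I \<and> (\<forall>J. left_ideal S \<Gamma> J \<longrightarrow> J \<subseteq> I \<longrightarrow> J = I)"

definition ideal_idempotent ::
  "'x topology \<Rightarrow> ('x \<Rightarrow> 'x) set \<Rightarrow> ('x \<Rightarrow> 'x) set \<Rightarrow> ('x \<Rightarrow> 'x) \<Rightarrow> bool" where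
  "ideal_idempotent S \<Gamma> I u \<longleftrightarrow>
     minimal_left_ideal S \<Gamma> I \<and> u \<in> I \<and> compose (topspace S) u u = u"

definition Ellis_group :: "'x topology \<Rightarrow> ('x \<Rightarrow> 'x) set \<Rightarrow> ('x \<Rightarrow> 'x) \<Rightarrow> ('x \<Rightarrow> 'x) monoid" where
  "Ellis_group S I u =
     \<lparr>carrier = compose (topspace S) u ` I, mult = compose (topspace S), one = u\<rparr>"

text \<open>
  A net of pairs \<open>(\<sigma>\<^sub>i, a\<^sub>i)\<close> is represented by the filter \<open>F\<close> of those sets of pairs in which it
  eventually lies. Conversely, every proper filter arises in this way from a net.
\<close>

definition circ_op ::
  "'x topology \<Rightarrow> ('x \<Rightarrow> 'x) set \<Rightarrow> ('x \<Rightarrow> 'x) \<Rightarrow> ('x \<Rightarrow> 'x) set \<Rightarrow> ('x \<Rightarrow> 'x) set" where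
  "circ_op S \<Gamma> \<eta> A = {\<zeta>. \<exists>F :: (('x \<Rightarrow> 'x) \<times> ('x \<Rightarrow> 'x)) filter.
     F \<noteq> bot \<and> (\<forall>\<^sub>F (\<sigma>, a) in F. \<sigma> \<in> \<Gamma> \<and> a \<in> A) \<and>
     limitin (Ellis_space S \<Gamma>) (\<lambda>(\<sigma>, a). \<sigma>) \<eta> F \<and>
     limitin (Ellis_space S \<Gamma>) (\<lambda>(\<sigma>, a). compose (topspace S) \<sigma> a) \<zeta> F}"

definition tau_closure ::
  "'x topology \<Rightarrow> ('x \<Rightarrow> 'x) set \<Rightarrow> ('x \<Rightarrow> 'x) set \<Rightarrow> ('x \<Rightarrow> 'x) \<Rightarrow> ('x \<Rightarrow> 'x) set \<Rightarrow> ('x \<Rightarrow> 'x) set" where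
  "tau_closure S \<Gamma> I u A = circ_op S \<Gamma> u A \<inter> carrier (Ellis_group S I u)"

definition tau_topology ::
  "'x topology \<Rightarrow> ('x \<Rightarrow> 'x) set \<Rightarrow> ('x \<Rightarrow> 'x) set \<Rightarrow> ('x \<Rightarrow> 'x) \<Rightarrow> ('x \<Rightarrow> 'x) topology" where
  "tau_topology S \<Gamma> I u = topology (\<lambda>U.
     let G = carrier (Ellis_group S I u)
     in U \<subseteq> G \<and> tau_closure S \<Gamma> I u (G - U) = G - U)"

end

theory Submission
  imports Defs
begin

text \<open>
  The Ellis semigroup of the flow consists of the pointwise limits of finite partial elementary
  maps from the monster model to itself: by homogeneity these are the restrictions of automorphisms.
  Such limits make sense between two monster models \<open>C\<^sub>1\<close> and \<open>C\<^sub>2\<close> as well, they compose, and they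
  exist by saturation and compactness. Hence for minimal idempotents \<open>u\<^sub>1\<close>, \<open>u\<^sub>2\<close> minimality yields
  limits \<open>a\<close> from \<open>C\<^sub>1\<close> to \<open>C\<^sub>2\<close> and \<open>b\<close> back with \<open>b a = u\<^sub>1\<close> and \<open>a b = u\<^sub>2\<close>, and \<open>g \<mapsto> a g b\<close> is the
  isomorphism. It respects the \<open>\<tau>\<close>-closure, because a limit \<open>\<sigma> \<alpha> \<rightarrow> \<zeta>\<close> with \<open>\<sigma> \<rightarrow> u\<^sub>1\<close> can be surrounded
  by finite approximations of \<open>a\<close> and \<open>b\<close>.

  For boundedness, take a small set \<open>B\<close> that realizes all types of finite tuples over the empty set.
  If two types in the image of \<open>u\<close> agreed on all formulas over \<open>B\<close>, then a limit of maps into \<open>B\<close>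
  would identify them, which is impossible by minimality. Variants of this argument show that an
  element of the Ellis group is determined by data of size bounded in terms of \<open>B\<close>, no matter how
  many variables there are.
\<close>

section \<open>Renaming and binding of variables\<close>

text \<open>The number of variables may exceed \<open>\<kappa>\<close>, so counting types gives no
  bound. But a formula has finitely many variables and parameters, so every condition on a limit map
  is tested on finitely many types and formulas, and finite elementary maps suffice. This also lets
  monster models with unrelated \<open>\<kappa>\<close> be compared without a common extension:
  completeness makes the empty map elementary, and saturation extends it point by point. The bound
  has to avoid the variables too. An element \<open>g\<close> of the Ellis group is recorded as
  follows: for each type \<open>p\<close> fixed by \<open>u\<close> and each formula in
  \<open>g p\<close> with parameters in a finite \<open>c \<subseteq> B\<close>, keep
  \<open>c\<close> and the set of elementary maps from \<open>c\<close> into \<open>B\<close> that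
  put the formula into \<open>p\<close>; type and formula are forgotten. Formulas and types with
  equal records cannot be told apart by any placement of the parameters, hence by no limit of
  placements, and \<open>g\<close> is such a limit. So \<open>g\<close> becomes a subset of
  \<open>Pow B \<times> Pow (Pow (B \<times> B))\<close>, and a strong limit exceeds the number of
  those.\<close>

lemma has_sort_simps [simp]:
  "has_sort L v c (Bd n) s \<longleftrightarrow> n < length c \<and> s = c ! n"
  "has_sort L v c (Fr x) s \<longleftrightarrow> v x = Some s"
  "has_sort L v c (Fn f ts) s \<longleftrightarrow>
     (\<exists>ss. fun_sort L f = Some (ss, s) \<and> list_all2 (has_sort L v c) ts ss)"
  by (auto elim: has_sort.cases intro: has_sort.intros)

lemma tm_val_map [simp]: "tm_val M e b (map_tm g t) = tm_val M (e \<circ> g) b t"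
  by (induction t) (auto simp: comp_def cong: map_cong)

lemma sat_map [simp]: "sat M e b (map_fm g \<phi>) = sat M (e \<circ> g) b \<phi>"
  by (induction \<phi> arbitrary: b) (auto simp: comp_def)

lemma tm_val_cong: "(\<And>x. x \<in> set_tm t \<Longrightarrow> e x = e' x) \<Longrightarrow> tm_val M e b t = tm_val M e' b t"
proof (induction t)
  case (Fn f ts)
  then have "map (tm_val M e b) ts = map (tm_val M e' b) ts" by auto
  then show ?case by (simp only: tm_val.simps)
qed auto

lemma sat_cong: "(\<And>x. x \<in> set_fm \<phi> \<Longrightarrow> e x = e' x) \<Longrightarrow> sat M e b \<phi> = sat M e' b \<phi>"
proof (induction \<phi> arbitrary: b)
  case (Eq t u)
  then show ?case using tm_val_cong[of t e e' M b] tm_val_cong[of u e e' M b] by simp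
next
  case (Rel r ts)
  then have "map (tm_val M e b) ts = map (tm_val M e' b) ts"
    by (auto intro: tm_val_cong)
  then show ?case by (simp only: sat.simps)
next
  case (Conj \<phi> \<psi>)
  have "sat M e b \<phi> = sat M e' b \<phi>" "sat M e b \<psi> = sat M e' b \<psi>"
    by (rule Conj.IH; use Conj.prems in simp)+
  then show ?case by simp
next
  case (Neg \<phi>)
  have "sat M e b \<phi> = sat M e' b \<phi>" by (rule Neg.IH; use Neg.prems in simp)
  then show ?case by simp
next
  case (Ex s \<phi>)
  have "sat M e (a # b) \<phi> = sat M e' (a # b) \<phi>" for a
    by (rule Ex.IH; use Ex.prems in simp)
  then show ?case by simp
qed

lemma has_sort_map:
  "(\<And>x. x \<in> set_tm t \<Longrightarrow> v' (g x) = v x) \<Longrightarrow>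
     has_sort L v' c (map_tm g t) s \<longleftrightarrow> has_sort L v c t s"
proof (induction t arbitrary: s)
  case (Fn f ts)
  have "list_all2 (has_sort L v' c) (map (map_tm g) ts) ss \<longleftrightarrow> list_all2 (has_sort L v c) ts ss" for ss
    unfolding list_all2_map1
    by (rule list.rel_cong_simp) (use Fn in \<open>auto simp: simp_implies_def\<close>)
  then show ?case by simp
qed auto

lemma wf_fm_map:
  "(\<And>x. x \<in> set_fm \<phi> \<Longrightarrow> v' (g x) = v x) \<Longrightarrow> wf_fm L v' c (map_fm g \<phi>) \<longleftrightarrow> wf_fm L v c \<phi>"
proof (induction \<phi> arbitrary: c)
  case (Eq t u)
  then show ?case using has_sort_map[of t v' g v L c] has_sort_map[of u v' g v L c] by simp
next
  case (Rel r ts)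
  have "list_all2 (has_sort L v' c) (map (map_tm g) ts) ss \<longleftrightarrow> list_all2 (has_sort L v c) ts ss" for ss
    unfolding list_all2_map1
    by (rule list.rel_cong_simp)
       (use Rel in \<open>auto simp: simp_implies_def intro: has_sort_map[THEN iffD1] has_sort_map[THEN iffD2]\<close>)
  then show ?case by simp
next
  case (Conj \<phi> \<psi>)
  then show ?case by simp
qed simp_all

lemma list_all2_set1: "list_all2 P xs ys \<Longrightarrow> x \<in> set xs \<Longrightarrow> \<exists>y. P x y"
  by (auto simp: list_all2_conv_all_nth in_set_conv_nth)

lemma has_sort_vars: "has_sort L v c t s \<Longrightarrow> set_tm t \<subseteq> dom v"
proof (induction t arbitrary: s)
  case (Fn f ts)
  then obtain ss where "list_all2 (has_sort L v c) ts ss" by auto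
  then have "set_tm t \<subseteq> dom v" if "t \<in> set ts" for t
    using Fn.IH[OF that] list_all2_set1[OF _ that] by metis
  then show ?case by auto
qed auto

lemma wf_fm_vars: "wf_fm L v c \<phi> \<Longrightarrow> set_fm \<phi> \<subseteq> dom v"
proof (induction \<phi> arbitrary: c)
  case (Rel r ts)
  then obtain ss where "list_all2 (has_sort L v c) ts ss" by auto
  then have "set_tm t \<subseteq> dom v" if "t \<in> set ts" for t
    using has_sort_vars list_all2_set1[OF _ that] by metis
  then show ?case by auto
next
  case (Eq t u)
  then obtain s where "has_sort L v c t s" "has_sort L v c u s" by auto
  then show ?case using has_sort_vars[of L v c] by simp
next
  case (Conj \<phi> \<psi>)
  then show ?case by (metis Un_least fm.set(4) wf_fm.simps(4))
qed auto

lemma finite_set_tm [simp]: "finite (set_tm t)"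
  by (induction t) auto

lemma finite_set_fm [simp]: "finite (set_fm \<phi>)"
  by (induction \<phi>) auto

text \<open>\<open>Inl n\<close> sends a variable to entry \<open>n\<close> of an outer context,
  \<open>Inr w\<close> renames it. The depth \<open>d\<close> counts the quantifiers passed so far;
  as index 0 is innermost, each of them shifts the outer indices by one.\<close>

primrec close_tm :: "('v \<Rightarrow> nat + 'w) \<Rightarrow> nat \<Rightarrow> ('f, 'v) tm \<Rightarrow> ('f, 'w) tm" where
  "close_tm h d (Bd n) = Bd n"
| "close_tm h d (Fr x) = (case h x of Inl n \<Rightarrow> Bd (d + n) | Inr w \<Rightarrow> Fr w)"
| "close_tm h d (Fn f ts) = Fn f (map (close_tm h d) ts)"

primrec close_fm :: "('v \<Rightarrow> nat + 'w) \<Rightarrow> nat \<Rightarrow> ('s, 'f, 'r, 'v) fm \<Rightarrow> ('s, 'f, 'r, 'w) fm" where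
  "close_fm h d (Eq t u) = Eq (close_tm h d t) (close_tm h d u)"
| "close_fm h d (Rel r ts) = Rel r (map (close_tm h d) ts)"
| "close_fm h d (Neg \<phi>) = Neg (close_fm h d \<phi>)"
| "close_fm h d (Conj \<phi> \<psi>) = Conj (close_fm h d \<phi>) (close_fm h d \<psi>)"
| "close_fm h d (Ex s \<phi>) = Ex s (close_fm h (Suc d) \<phi>)"

definition close_sorts :: "('v \<Rightarrow> nat + 'w) \<Rightarrow> ('v \<rightharpoonup> 's) \<Rightarrow> ('w \<rightharpoonup> 's) \<Rightarrow> 's list \<Rightarrow> bool" where
  "close_sorts h v w ss \<longleftrightarrow> (\<forall>x s. v x = Some s \<longrightarrow>
     (case h x of Inl n \<Rightarrow> n < length ss \<and> ss ! n = s | Inr y \<Rightarrow> w y = Some s))"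

lemma has_sort_close:
  assumes "close_sorts h v w ss"
  shows "has_sort L v c t s \<Longrightarrow> has_sort L w (c @ ss) (close_tm h (length c) t) s"
proof (induction t arbitrary: s)
  case (Fn f ts)
  then obtain zs where "fun_sort L f = Some (zs, s)" "list_all2 (has_sort L v c) ts zs" by auto
  then show ?case using Fn.IH by (auto simp: list_all2_conv_all_nth)
next
  case (Fr x)
  then show ?case using assms by (auto simp: close_sorts_def nth_append split: sum.splits)
qed (auto simp: nth_append)

lemma wf_fm_close:
  assumes "close_sorts h v w ss"
  shows "wf_fm L v c \<phi> \<Longrightarrow> wf_fm L w (c @ ss) (close_fm h (length c) \<phi>)"
proof (induction \<phi> arbitrary: c)
  case (Rel r ts)
  then obtain zs where zs: "rel_sort L r = Some zs" "list_all2 (has_sort L v c) ts zs" by auto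
  have "list_all2 (has_sort L w (c @ ss)) (map (close_tm h (length c)) ts) zs"
    unfolding list_all2_map1 by (rule list_all2_mono[OF zs(2)]) (rule has_sort_close[OF assms])
  then show ?case using zs(1) by simp
next
  case (Ex s \<phi>)
  then show ?case using Ex.IH[of "s # c"] by simp
next
  case (Eq t u)
  then show ?case using has_sort_close[OF assms] unfolding wf_fm.simps close_fm.simps by blast
qed auto

text \<open>Sorting keeps the bound indices below \<open>length b\<close>; a dangling one would read
  from \<open>as\<close> on the left but run past the end of \<open>b\<close> on the right.\<close>

lemma tm_val_close:
  "has_sort L v c t s \<Longrightarrow> length b = length c \<Longrightarrow>
     tm_val M e (b @ as) (close_tm h (length c) t) =
     tm_val M (\<lambda>x. case h x of Inl n \<Rightarrow> as ! n | Inr y \<Rightarrow> e y) b t"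
proof (induction t arbitrary: s)
  case (Fn f ts)
  then obtain zs where "list_all2 (has_sort L v c) ts zs" by auto
  then have "\<And>t. t \<in> set ts \<Longrightarrow> \<exists>s. has_sort L v c t s"
    using list_all2_set1 by fast
  then have "map (tm_val M e (b @ as)) (map (close_tm h (length c)) ts) =
      map (tm_val M (\<lambda>x. case h x of Inl n \<Rightarrow> as ! n | Inr y \<Rightarrow> e y) b) ts"
    unfolding map_map comp_def using Fn.IH Fn.prems(2) by (intro map_cong refl) blast
  then show ?case by (simp only: tm_val.simps close_tm.simps)
next
  case (Fr x)
  then show ?case by (auto simp: nth_append split: sum.splits)
qed (auto simp: nth_append)

lemma sat_close:
  "wf_fm L v c \<phi> \<Longrightarrow> length b = length c \<Longrightarrow>
     sat M e (b @ as) (close_fm h (length c) \<phi>) \<longleftrightarrow>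
     sat M (\<lambda>x. case h x of Inl n \<Rightarrow> as ! n | Inr y \<Rightarrow> e y) b \<phi>"
proof (induction \<phi> arbitrary: b c)
  case (Eq t u)
  then show ?case by (auto simp: tm_val_close)
next
  case (Rel r ts)
  then obtain zs where "list_all2 (has_sort L v c) ts zs" by auto
  then have "\<And>t. t \<in> set ts \<Longrightarrow> \<exists>s. has_sort L v c t s"
    using list_all2_set1 by fast
  then have "map (tm_val M e (b @ as)) (map (close_tm h (length c)) ts) =
      map (tm_val M (\<lambda>x. case h x of Inl n \<Rightarrow> as ! n | Inr y \<Rightarrow> e y) b) ts"
    unfolding map_map comp_def using Rel.prems(2)
    by (intro map_cong refl) (blast intro: tm_val_close)
  then show ?case by (simp only: sat.simps close_fm.simps)
next
  case (Ex s \<phi>)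
  have "sat M e ((a # b) @ as) (close_fm h (length (s # c)) \<phi>) \<longleftrightarrow>
     sat M (\<lambda>x. case h x of Inl n \<Rightarrow> as ! n | Inr y \<Rightarrow> e y) (a # b) \<phi>" for a
    by (rule Ex.IH) (use Ex.prems in auto)
  then show ?case by simp
qed auto

section \<open>Partial elementary maps\<close>

text \<open>\<open>elementary_map\<close> for two models, acting on pairs of a sort and an element
  so that composition and inverse are those of plain functions. The elements of \<open>A\<close>
  serve as free variables, which \<open>snd\<close> evaluates at themselves.\<close>

definition pelem ::
  "('s, 'f, 'r) lang \<Rightarrow> ('s, 'f, 'r, 'm) struct \<Rightarrow> ('s, 'f, 'r, 'n) struct \<Rightarrow>
   ('s \<times> 'm) set \<Rightarrow> ('s \<times> 'm \<Rightarrow> 's \<times> 'n) \<Rightarrow> bool" where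
  "pelem L M N A k \<longleftrightarrow>
     A \<subseteq> elems M \<and> (\<forall>x\<in>A. k x \<in> elems N \<and> fst (k x) = fst x) \<and>
     (\<forall>\<phi>\<in>formulas L (param_sort A). sat M snd [] \<phi> \<longleftrightarrow> sat N (snd \<circ> k) [] \<phi>)"

lemma param_sort_simps [simp]: "x \<in> A \<Longrightarrow> param_sort A x = Some (fst x)"
  "dom (param_sort A) = A" "param_sort A x = Some s \<longleftrightarrow> x \<in> A \<and> s = fst x"
  by (auto simp: param_sort_def split: if_splits)

lemma formulas_vars: "\<phi> \<in> formulas L v \<Longrightarrow> set_fm \<phi> \<subseteq> dom v"
  unfolding formulas_def using wf_fm_vars by blast

lemma formulas_map:
  assumes "\<phi> \<in> formulas L v" "\<And>x. x \<in> set_fm \<phi> \<Longrightarrow> v' (g x) = v x"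
  shows "map_fm g \<phi> \<in> formulas L v'"
  using assms wf_fm_map[of \<phi> v' g v L "[]"] by (simp add: formulas_def)

lemma formulas_cong:
  assumes "\<phi> \<in> formulas L v" "\<And>x. x \<in> set_fm \<phi> \<Longrightarrow> v' x = v x"
  shows "\<phi> \<in> formulas L v'"
  using formulas_map[OF assms(1), of v' id] assms(2) by (simp add: fm.map_id)

lemma formulas_Neg [simp]: "Neg \<phi> \<in> formulas L v \<longleftrightarrow> \<phi> \<in> formulas L v"
  by (simp add: formulas_def)

lemma formulas_over_Neg [simp]: "Neg \<phi> \<in> formulas_over L v A \<longleftrightarrow> \<phi> \<in> formulas_over L v A"
  by (simp add: formulas_over_def)

lemma formulas_over_vars:
  assumes "\<phi> \<in> formulas_over L v A"
  shows "Inl i \<in> set_fm \<phi> \<Longrightarrow> i \<in> dom v" "Inr x \<in> set_fm \<phi> \<Longrightarrow> x \<in> A"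
  using formulas_vars[OF assms[unfolded formulas_over_def]] by (auto simp: dom_def)

lemma formulas_over_restrict:
  assumes "\<phi> \<in> formulas_over L v A" "Inr -` set_fm \<phi> \<subseteq> B"
  shows "\<phi> \<in> formulas_over L v B"
proof -
  have "case_sum v (param_sort B) x = case_sum v (param_sort A) x" if "x \<in> set_fm \<phi>" for x
    by (cases x) (use that assms formulas_over_vars[OF assms(1)] in auto)
  then show ?thesis
    using assms(1) formulas_cong unfolding formulas_over_def by blast
qed

lemma formulas_over_mono: "A \<subseteq> B \<Longrightarrow> formulas_over L v A \<subseteq> formulas_over L v B"
  by (rule subsetI, rule formulas_over_restrict) (auto dest: formulas_over_vars(2))

lemma formulas_over_finite_params:
  assumes "\<phi> \<in> formulas_over L v A"
  obtains B where "finite B" "B \<subseteq> A" "\<phi> \<in> formulas_over L v B"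
proof
  show "finite (Inr -` set_fm \<phi>)" by (rule finite_vimageI) auto
  show "Inr -` set_fm \<phi> \<subseteq> A" using formulas_over_vars[OF assms] by auto
  show "\<phi> \<in> formulas_over L v (Inr -` set_fm \<phi>)" by (rule formulas_over_restrict[OF assms]) simp
qed

lemma formulas_over_finite_set_params:
  assumes "finite F" "F \<subseteq> formulas_over L v A"
  obtains B where "finite B" "B \<subseteq> A" "F \<subseteq> formulas_over L v B"
proof
  let ?B = "\<Union>\<phi>\<in>F. Inr -` set_fm \<phi>"
  show "finite ?B" using assms(1) by (auto intro!: finite_vimageI)
  show "?B \<subseteq> A" using formulas_over_vars(2) assms(2) by blast
  show "F \<subseteq> formulas_over L v ?B"
  proof
    fix \<phi> assume "\<phi> \<in> F"
    then show "\<phi> \<in> formulas_over L v ?B"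
      by (intro formulas_over_restrict[OF subsetD[OF assms(2)]]) auto
  qed
qed

section \<open>Moving the parameters of formulas\<close>

abbreviation par_act :: "('a \<Rightarrow> 'b) \<Rightarrow> ('s, 'f, 'r, 'i + 'a) fm \<Rightarrow> ('s, 'f, 'r, 'i + 'b) fm" where
  "par_act k \<equiv> map_fm (map_sum id k)"

lemma par_act_comp: "par_act k (par_act l \<phi>) = par_act (k \<circ> l) \<phi>"
  by (simp add: fm.map_comp map_sum.comp)

lemma par_act_cong:
  assumes "\<phi> \<in> formulas_over L v A" "\<And>x. x \<in> A \<Longrightarrow> k x = l x"
  shows "par_act k \<phi> = par_act l \<phi>"
proof (rule fm.map_cong0)
  fix z assume "z \<in> set_fm \<phi>"
  then show "map_sum id k z = map_sum id l z"
    using assms(2) formulas_over_vars(2)[OF assms(1)] by - (cases z, auto)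
qed

lemma par_act_id: "\<phi> \<in> formulas_over L v A \<Longrightarrow> (\<And>x. x \<in> A \<Longrightarrow> k x = x) \<Longrightarrow> par_act k \<phi> = \<phi>"
  using par_act_cong[of \<phi> L v A k id] by (simp add: sum.map_id0 fm.map_id)

lemma par_act_Inl [simp]: "par_act k (map_fm Inl \<phi>) = map_fm Inl \<phi>"
  by (simp add: fm.map_comp comp_def)

lemma par_act_in:
  assumes "\<phi> \<in> formulas_over L v A" "\<And>x. x \<in> A \<Longrightarrow> fst (k x) = fst x"
  shows "par_act k \<phi> \<in> formulas_over L v (k ` A)"
  unfolding formulas_over_def
proof (rule formulas_map[OF assms(1)[unfolded formulas_over_def]])
  fix z assume "z \<in> set_fm \<phi>"
  then show "case_sum v (param_sort (k ` A)) (map_sum id k z) = case_sum v (param_sort A) z"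
    using assms(2) formulas_over_vars(2)[OF assms(1)] by - (cases z, auto simp: param_sort_def)
qed

lemma pelem_fst: "pelem L M N A k \<Longrightarrow> x \<in> A \<Longrightarrow> fst (k x) = fst x"
  by (simp add: pelem_def)

lemma pelem_ran: "pelem L M N A k \<Longrightarrow> k ` A \<subseteq> elems N"
  by (auto simp: pelem_def)

lemma pelem_act: "pelem L M N A k \<Longrightarrow> \<phi> \<in> formulas_over L v A \<Longrightarrow> par_act k \<phi> \<in> formulas_over L v (k ` A)"
  using par_act_in pelem_fst by metis

lemma pelem_act_elems:
  "pelem L M N A k \<Longrightarrow> \<phi> \<in> formulas_over L v A \<Longrightarrow> par_act k \<phi> \<in> formulas_over L v (elems N)"
  by (rule subsetD[OF formulas_over_mono[OF pelem_ran] pelem_act])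

lemma pelem_mono:
  assumes "pelem L M N A k" "B \<subseteq> A"
  shows "pelem L M N B k"
proof -
  have "\<phi> \<in> formulas L (param_sort A)" if "\<phi> \<in> formulas L (param_sort B)" for \<phi>
  proof (rule formulas_cong[OF that])
    fix x assume "x \<in> set_fm \<phi>"
    then have "x \<in> B" using formulas_vars[OF that] by auto
    then show "param_sort A x = param_sort B x" using assms(2) by (simp add: subsetD)
  qed
  then show ?thesis using assms by (auto simp: pelem_def)
qed

lemma pelem_comp:
  assumes "pelem L M N A k" "pelem L N R (k ` A) l"
  shows "pelem L M R A (l \<circ> k)"
proof -
  have "sat M snd [] \<phi> \<longleftrightarrow> sat R (snd \<circ> (l \<circ> k)) [] \<phi>" if "\<phi> \<in> formulas L (param_sort A)" for \<phi>
  proof -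
    have "map_fm k \<phi> \<in> formulas L (param_sort (k ` A))"
    proof (rule formulas_map[OF that])
      fix x assume "x \<in> set_fm \<phi>"
      then have "x \<in> A" using formulas_vars[OF that] by auto
      then show "param_sort (k ` A) (k x) = param_sort A x" using pelem_fst[OF assms(1)] by simp
    qed
    then have "sat N snd [] (map_fm k \<phi>) \<longleftrightarrow> sat R (snd \<circ> l) [] (map_fm k \<phi>)"
      using assms(2) unfolding pelem_def by blast
    then show ?thesis using assms(1) that by (simp add: pelem_def comp_assoc)
  qed
  then show ?thesis using assms by (auto simp: pelem_def)
qed

text \<open>Equal images force equal sorts, so that the formula \<open>x = y\<close> is well-formed;
  its preservation then separates the elements of one sort.\<close>

lemma pelem_inj:
  assumes "pelem L M N A k"
  shows "inj_on k A"
proof (rule inj_onI)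
  fix x y assume xy: "x \<in> A" "y \<in> A" "k x = k y"
  then have s: "fst x = fst y" using pelem_fst[OF assms] by metis
  then have "Eq (Fr x) (Fr y) \<in> formulas L (param_sort A)"
    using xy by (simp add: formulas_def)
  then have "sat M snd [] (Eq (Fr x) (Fr y)) \<longleftrightarrow> sat N (snd \<circ> k) [] (Eq (Fr x) (Fr y))"
    using assms unfolding pelem_def by blast
  then show "x = y" using xy s by (simp add: prod_eq_iff)
qed

lemma pelem_inv:
  assumes "pelem L M N A k"
  shows "pelem L N M (k ` A) (inv_into A k)"
proof -
  have "sat N snd [] \<phi> \<longleftrightarrow> sat M (snd \<circ> inv_into A k) [] \<phi>"
    if \<phi>: "\<phi> \<in> formulas L (param_sort (k ` A))" for \<phi>
  proof -
    have v: "set_fm \<phi> \<subseteq> k ` A" using formulas_vars[OF \<phi>] by simp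
    have "map_fm (inv_into A k) \<phi> \<in> formulas L (param_sort A)"
    proof (rule formulas_map[OF \<phi>])
      fix x assume "x \<in> set_fm \<phi>"
      then obtain a where "a \<in> A" "x = k a" using v by blast
      then show "param_sort A (inv_into A k x) = param_sort (k ` A) x"
        using pelem_inj[OF assms] pelem_fst[OF assms] by (simp add: param_sort_def)
    qed
    then have "sat M snd [] (map_fm (inv_into A k) \<phi>) \<longleftrightarrow> sat N (snd \<circ> k) [] (map_fm (inv_into A k) \<phi>)"
      using assms unfolding pelem_def by blast
    also have "\<dots> \<longleftrightarrow> sat N snd [] \<phi>"
      unfolding sat_map by (rule sat_cong) (use v in \<open>auto simp: f_inv_into_f\<close>)
    finally show ?thesis by simp
  qed
  then show ?thesis
    using assms pelem_inj[OF assms] by (auto simp: pelem_def)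
qed

text \<open>The forth half of a back-and-forth between finite maps. This is the only form in which
  saturation of \<open>N\<close> enters.\<close>

definition hom_ext ::
  "('s, 'f, 'r) lang \<Rightarrow> ('s, 'f, 'r, 'm) struct \<Rightarrow> ('s, 'f, 'r, 'n) struct \<Rightarrow> bool" where
  "hom_ext L M N \<longleftrightarrow> (\<forall>A k x. finite A \<longrightarrow> pelem L M N A k \<longrightarrow> x \<in> elems M \<longrightarrow>
     (\<exists>k'. (\<forall>y\<in>A. k' y = k y) \<and> pelem L M N (insert x A) k'))"

lemma hom_ext_finite:
  assumes "hom_ext L M N" "finite B" "B \<subseteq> elems M" "finite A" "pelem L M N A k"
  shows "\<exists>k'. (\<forall>y\<in>A. k' y = k y) \<and> pelem L M N (A \<union> B) k'"
  using assms(2,3)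
proof (induction B)
  case empty
  then show ?case using assms(5) by auto
next
  case (insert x B)
  then obtain k' where k': "\<forall>y\<in>A. k' y = k y" "pelem L M N (A \<union> B) k'" by auto
  have fin: "finite (A \<union> B)" "x \<in> elems M" using assms(4) insert by auto
  obtain k'' where "\<forall>y\<in>A \<union> B. k'' y = k' y" "pelem L M N (insert x (A \<union> B)) k''"
    using assms(1)[unfolded hom_ext_def, rule_format, OF _ k'(2), of x] fin by blast
  then show ?case using k'(1) by (intro exI[of _ k'']) auto
qed

text \<open>The values of the finitely many variables involved are treated as further parameters.\<close>

lemma fin_sat_transfer:
  fixes M :: "('s, 'f, 'r, 'm) struct" and N :: "('s, 'f, 'r, 'n) struct"
  assumes ext: "hom_ext L M N" and k: "finite A" "pelem L M N A k"
    and F: "finite F" "F \<subseteq> formulas_over L v A" and e: "e \<in> tuples M v" "\<forall>\<phi>\<in>F. sat_over M e \<phi>"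
    and N: "\<And>s. Dom N s \<noteq> {}"
  shows "\<exists>e'\<in>tuples N v. \<forall>\<phi>\<in>F. sat_over N e' (par_act k \<phi>)"
proof -
  define I where "I = (\<Union>\<phi>\<in>F. Inl -` set_fm \<phi>)"
  define B where "B = (\<lambda>i. (the (v i), e i)) ` I"
  define g where "g = case_sum (\<lambda>i. (the (v i), e i)) id"
  have I: "finite I" "I \<subseteq> dom v"
  proof -
    show "finite I" unfolding I_def using F(1) by (intro finite_UN_I finite_vimageI) auto
    show "I \<subseteq> dom v"
      unfolding I_def using formulas_over_vars(1)[OF subsetD[OF F(2)]] by blast
  qed
  have "B \<subseteq> elems M"
    using I e(1) by (auto simp: B_def elems_def tuples_def dom_def)
  then obtain k' where k': "\<forall>y\<in>A. k' y = k y" "pelem L M N (A \<union> B) k'"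
    using hom_ext_finite[OF ext _ _ k] I(1) B_def by blast
  \<comment> \<open>Variables outside \<open>I\<close> do not occur in \<open>F\<close> and only
    need some value of their sort, which exists because the sorts of \<open>N\<close> are
    nonempty.\<close>
  define e' where "e' = (\<lambda>i. if i \<in> I then snd (k' (g (Inl i)))
    else (SOME a. \<forall>s. v i = Some s \<longrightarrow> a \<in> Dom N s))"
  have "e' i \<in> Dom N s" if "v i = Some s" for i s
  proof (cases "i \<in> I")
    case True
    then have "g (Inl i) \<in> B" by (simp add: B_def g_def)
    then have "k' (g (Inl i)) \<in> elems N" "fst (k' (g (Inl i))) = s"
      using k'(2) that by (auto simp: pelem_def g_def)
    then show ?thesis using True by (auto simp: e'_def elems_def)
  next
    case False
    have "\<exists>a. \<forall>s. v i = Some s \<longrightarrow> a \<in> Dom N s" using N[of s] that by auto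
    from someI_ex[OF this] show ?thesis using False that by (simp add: e'_def)
  qed
  then have "e' \<in> tuples N v" by (simp add: tuples_def)
  moreover have "sat_over N e' (par_act k \<phi>)" if "\<phi> \<in> F" for \<phi>
  proof -
    have \<phi>: "\<phi> \<in> formulas_over L v A" using that F by auto
    have gB: "param_sort (A \<union> B) (g z) = case_sum v (param_sort A) z" if z: "z \<in> set_fm \<phi>" for z
    proof (cases z)
      case (Inl i)
      then have "g z \<in> B" using z \<open>\<phi> \<in> F\<close> by (auto simp: g_def B_def I_def)
      moreover have "i \<in> dom v" using formulas_over_vars(1)[OF \<phi>] z Inl by simp
      ultimately show ?thesis using Inl by (auto simp: g_def)
    next
      case (Inr x)
      then have "x \<in> A" using formulas_over_vars(2)[OF \<phi>] z by simp
      then show ?thesis using Inr by (simp add: g_def)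
    qed
    have "map_fm g \<phi> \<in> formulas L (param_sort (A \<union> B))"
      using formulas_map[OF \<phi>[unfolded formulas_over_def]] gB by blast
    then have "sat M snd [] (map_fm g \<phi>) \<longleftrightarrow> sat N (snd \<circ> k') [] (map_fm g \<phi>)"
      using k'(2) unfolding pelem_def by blast
    moreover have "sat M snd [] (map_fm g \<phi>) \<longleftrightarrow> sat_over M e \<phi>"
      unfolding sat_map sat_over_def by (rule sat_cong) (auto simp: g_def split: sum.splits)
    moreover have "sat N (snd \<circ> k') [] (map_fm g \<phi>) \<longleftrightarrow> sat_over N e' (par_act k \<phi>)"
      unfolding sat_map sat_over_def
    proof (rule sat_cong)
      fix z assume "z \<in> set_fm \<phi>"
      then show "(snd \<circ> k' \<circ> g) z = (case_sum e' snd \<circ> map_sum id k) z"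
        using formulas_over_vars(2)[OF \<phi>] k'(1) \<open>\<phi> \<in> F\<close>
        by - (cases z, auto simp: g_def e'_def I_def)
    qed
    ultimately show ?thesis using e(2) that by simp
  qed
  ultimately show ?thesis by blast
qed

section \<open>Limits of partial elementary maps\<close>

text \<open>Zorn's lemma for the finite intersection property. By maximality a set outside
  \<open>U\<close> misses some finite intersection from \<open>U\<close>; if a set and its
  complement were both outside, two such intersections would be disjoint.\<close>

lemma ultrafilter_extension:
  fixes B :: "'a set set"
  assumes "\<And>F. F \<subseteq> B \<Longrightarrow> finite F \<Longrightarrow> \<Inter>F \<noteq> {}"
  obtains U where "B \<subseteq> U" "{} \<notin> U" "\<And>V W. V \<in> U \<Longrightarrow> W \<in> U \<Longrightarrow> V \<inter> W \<in> U" "\<And>V. V \<in> U \<or> - V \<in> U"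
proof -
  define fip :: "'a set set \<Rightarrow> bool" where "fip = (\<lambda>U. \<forall>F. F \<subseteq> U \<longrightarrow> finite F \<longrightarrow> \<Inter>F \<noteq> {})"
  define Z where "Z = {U. B \<subseteq> U \<and> fip U}"
  have "\<exists>U\<in>Z. \<forall>W\<in>Z. U \<subseteq> W \<longrightarrow> W = U"
  proof (rule subset_Zorn_nonempty)
    show "Z \<noteq> {}" using assms by (auto simp: Z_def fip_def)
  next
    fix C assume C: "C \<noteq> {}" "subset.chain Z C"
    then have CZ: "C \<subseteq> Z" by (simp add: subset.chain_def)
    have "fip (\<Union>C)"
      unfolding fip_def
    proof (intro allI impI)
      fix F assume F: "F \<subseteq> \<Union>C" "finite F"
      obtain U where "U \<in> C" "F \<subseteq> U"
        using finite_subset_Union_chain[OF F(2,1) C(1,2)] .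
      then have "fip U" using CZ unfolding Z_def by blast
      then show "\<Inter>F \<noteq> {}" using \<open>F \<subseteq> U\<close> F(2) by (simp add: fip_def)
    qed
    moreover have "B \<subseteq> \<Union>C" using C(1) CZ by (auto simp: Z_def)
    ultimately show "\<Union>C \<in> Z" by (simp add: Z_def)
  qed
  then obtain U where UZ: "U \<in> Z" and UZmax: "\<And>W. W \<in> Z \<Longrightarrow> U \<subseteq> W \<Longrightarrow> W = U"
    by auto
  have U: "B \<subseteq> U" "fip U" using UZ by (simp_all add: Z_def)
  have max: "W = U" if "B \<subseteq> W" "fip W" "U \<subseteq> W" for W
    using UZmax[of W] that by (simp add: Z_def)
  have new: "\<exists>F\<subseteq>U. finite F \<and> \<Inter>F \<inter> V = {}" if "V \<notin> U" for V
  proof -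
    have "insert V U \<noteq> U" using that by blast
    then have "\<not> fip (insert V U)" using max[of "insert V U"] U(1) by blast
    then obtain F where F: "F \<subseteq> insert V U" "finite F" "\<Inter>F = {}" unfolding fip_def by blast
    then have "F - {V} \<subseteq> U" "finite (F - {V})" "\<Inter>(F - {V}) \<inter> V = {}" by auto
    then show ?thesis by blast
  qed
  have dich: "V \<in> U \<or> - V \<in> U" for V
  proof (rule ccontr)
    assume "\<not> ?thesis"
    then obtain F G where "F \<subseteq> U" "finite F" "\<Inter>F \<inter> V = {}" "G \<subseteq> U" "finite G" "\<Inter>G \<inter> - V = {}"
      using new[of V] new[of "- V"] by auto
    moreover from this have "\<Inter>(F \<union> G) \<noteq> {}" using U(2) unfolding fip_def by (metis Un_least finite_UnI)
    ultimately show False by blast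
  qed
  show ?thesis
  proof
    show "B \<subseteq> U" by fact
    show "{} \<notin> U" using U(2)[unfolded fip_def, rule_format, of "{{}}"] by auto
    show "V \<in> U \<or> - V \<in> U" for V by (rule dich)
    show "V \<inter> W \<in> U" if "V \<in> U" "W \<in> U" for V W
    proof (rule ccontr)
      assume "V \<inter> W \<notin> U"
      then have "{V, W, - (V \<inter> W)} \<subseteq> U" using that dich[of "V \<inter> W"] by simp
      then have "\<Inter>{V, W, - (V \<inter> W)} \<noteq> {}" using U(2) unfolding fip_def by blast
      then show False by auto
    qed
  qed
qed

text \<open>Only language, variables and partial type are fixed, so that models with elements of
  different HOL types can be related inside the locale.\<close>

locale types_over =
  fixes L :: "('s, 'f, 'r) lang" and v :: "'i \<rightharpoonup> 's" and X :: "('s, 'f, 'r, 'i) fm set"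
begin

abbreviation types :: "('s, 'f, 'r, 'm) struct \<Rightarrow> ('s, 'f, 'r, 'i + 's \<times> 'm) fm set set" where
  "types M \<equiv> type_set L M v X"

abbreviation fms :: "('s \<times> 'm) set \<Rightarrow> ('s, 'f, 'r, 'i + 's \<times> 'm) fm set" where
  "fms \<equiv> formulas_over L v"

lemma fms_Inl: "map_fm Inl \<phi> \<in> fms A \<longleftrightarrow> \<phi> \<in> formulas L v"
  by (simp add: formulas_over_def formulas_def wf_fm_map)

lemma type_subset: "p \<in> types M \<Longrightarrow> p \<subseteq> fms (elems M)"
  by (simp add: type_set_def)

lemma type_fin_sat:
  "p \<in> types M \<Longrightarrow> F \<subseteq> p \<Longrightarrow> finite F \<Longrightarrow> \<exists>e\<in>tuples M v. \<forall>\<phi>\<in>F. sat_over M e \<phi>"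
  by (simp add: type_set_def fin_satisfiable_def)

lemma type_Neg:
  assumes "p \<in> types M" "\<phi> \<in> fms (elems M)"
  shows "Neg \<phi> \<in> p \<longleftrightarrow> \<phi> \<notin> p"
proof -
  have "False" if "\<phi> \<in> p" "Neg \<phi> \<in> p"
  proof -
    have "\<exists>e\<in>tuples M v. \<forall>\<psi>\<in>{\<phi>, Neg \<phi>}. sat_over M e \<psi>"
      by (rule type_fin_sat[OF assms(1)]) (use that in auto)
    then show False by (simp add: sat_over_def)
  qed
  then show ?thesis using assms unfolding type_set_def by blast
qed

lemma type_eqI:
  assumes "p \<in> types M" "q \<in> types M" "\<And>\<phi>. \<phi> \<in> fms (elems M) \<Longrightarrow> \<phi> \<in> p \<longleftrightarrow> \<phi> \<in> q"
  shows "p = q"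
proof (rule Set.set_eqI)
  fix \<phi> show "\<phi> \<in> p \<longleftrightarrow> \<phi> \<in> q"
    using assms(3)[of \<phi>] subsetD[OF type_subset[OF assms(1)], of \<phi>]
      subsetD[OF type_subset[OF assms(2)], of \<phi>] by argo
qed

text \<open>The finite domain stays hidden: only the effect on \<open>F\<close> matters, and maps
  can be composed without tracking domains.\<close>

definition acts ::
  "('s, 'f, 'r, 'm) struct \<Rightarrow> ('s, 'f, 'r, 'n) struct \<Rightarrow> ('s, 'f, 'r, 'i + 's \<times> 'm) fm set \<Rightarrow>
   ('s \<times> 'm \<Rightarrow> 's \<times> 'n) \<Rightarrow> bool" where
  "acts M N F k \<longleftrightarrow> (\<exists>A. finite A \<and> pelem L M N A k \<and> F \<subseteq> fms A)"

text \<open>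
  Pointwise limits of finite partial elementary maps: in each finite piece, such a map \<open>k\<close> is
  taken from the target \<open>N\<close> back to \<open>M\<close>, so that a formula of the limit type is pulled back along \<open>k\<close>.
\<close>

definition lim_maps :: "('s, 'f, 'r, 'm) struct \<Rightarrow> ('s, 'f, 'r, 'n) struct \<Rightarrow>
    (('s, 'f, 'r, 'i + 's \<times> 'm) fm set \<Rightarrow> ('s, 'f, 'r, 'i + 's \<times> 'n) fm set) set" where
  "lim_maps M N = {\<eta>. \<eta> \<in> types M \<rightarrow>\<^sub>E types N \<and>
     (\<forall>Q F. finite Q \<longrightarrow> Q \<subseteq> types M \<longrightarrow> finite F \<longrightarrow> F \<subseteq> fms (elems N) \<longrightarrow>
        (\<exists>k. acts N M F k \<and> (\<forall>p\<in>Q. \<forall>\<phi>\<in>F. \<phi> \<in> \<eta> p \<longleftrightarrow> par_act k \<phi> \<in> p)))}"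

lemma lim_maps_in: "\<eta> \<in> lim_maps M N \<Longrightarrow> p \<in> types M \<Longrightarrow> \<eta> p \<in> types N"
  by (auto simp: lim_maps_def)

lemma lim_maps_Pi: "\<eta> \<in> lim_maps M N \<Longrightarrow> \<eta> \<in> types M \<rightarrow> types N"
  by (auto simp: lim_maps_def)

lemma lim_maps_ext: "\<eta> \<in> lim_maps M N \<Longrightarrow> \<eta> \<in> extensional (types M)"
  by (auto simp: lim_maps_def PiE_def)

lemma lim_mapsE:
  assumes "\<eta> \<in> lim_maps M N" "finite Q" "Q \<subseteq> types M" "finite F" "F \<subseteq> fms (elems N)"
  obtains k where "acts N M F k"
    "\<And>p \<phi>. p \<in> Q \<Longrightarrow> \<phi> \<in> F \<Longrightarrow> \<phi> \<in> \<eta> p \<longleftrightarrow> par_act k \<phi> \<in> p"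
proof -
  have "\<exists>k. acts N M F k \<and> (\<forall>p\<in>Q. \<forall>\<phi>\<in>F. \<phi> \<in> \<eta> p \<longleftrightarrow> par_act k \<phi> \<in> p)"
    using assms(1)[unfolded lim_maps_def mem_Collect_eq] assms(2-) by simp
  then show ?thesis using that by auto
qed

lemma pelem_act_set:
  assumes "pelem L M N A k" "F \<subseteq> fms A"
  shows "par_act k ` F \<subseteq> fms (k ` A)"
  using assms(2) by (auto intro!: pelem_act[OF assms(1)])

lemma acts_image: "acts M N F k \<Longrightarrow> par_act k ` F \<subseteq> fms (elems N)"
  by (auto simp: acts_def intro: pelem_act_elems)

text \<open>The hidden domain of \<open>k\<close> may be so large that its image leaves the domain
  of \<open>l\<close>. Cut down to the parameters that occur in \<open>F\<close>, its image consists
  of parameters of the moved formulas, and those \<open>l\<close> controls.\<close>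

lemma acts_comp:
  assumes "acts M N F k" "acts N R (par_act k ` F) l" "finite F"
  shows "acts M R F (l \<circ> k)"
proof -
  obtain A B where k: "pelem L M N A k" "F \<subseteq> fms A" and l: "pelem L N R B l" "par_act k ` F \<subseteq> fms B"
    using assms(1,2) by (auto simp: acts_def)
  let ?A = "\<Union>\<phi>\<in>F. Inr -` set_fm \<phi>"
  have "finite ?A" using assms(3) by (intro finite_UN_I finite_vimageI) auto
  moreover have "?A \<subseteq> A" using formulas_over_vars(2)[OF subsetD[OF k(2)]] by blast
  moreover have "F \<subseteq> fms ?A"
  proof
    fix \<phi> assume "\<phi> \<in> F"
    then show "\<phi> \<in> fms ?A" by (intro formulas_over_restrict[OF subsetD[OF k(2)]]) auto
  qed
  moreover have "k ` ?A \<subseteq> B"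
  proof (rule image_subsetI, elim UN_E)
    fix x \<phi> assume \<phi>: "\<phi> \<in> F" "x \<in> Inr -` set_fm \<phi>"
    then have "map_sum id k (Inr x) \<in> set_fm (par_act k \<phi>)" unfolding fm.set_map by blast
    then show "k x \<in> B" using formulas_over_vars(2)[OF subsetD[OF l(2) imageI[OF \<phi>(1)]]] by simp
  qed
  ultimately show ?thesis
    unfolding acts_def using pelem_comp[OF pelem_mono[OF k(1)] pelem_mono[OF l(1)]] by metis
qed

text \<open>The outer map \<open>\<theta>\<close> is approximated before \<open>\<eta>\<close>: its
  \<open>k\<close> turns \<open>F\<close> into formulas over \<open>N\<close>, and at these
  \<open>\<eta>\<close> has to be approximated. As formulas are pulled back, the finite maps compose
  to \<open>l \<circ> k\<close>.\<close>

lemma lim_maps_comp: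
  fixes M :: "('s, 'f, 'r, 'm) struct" and R :: "('s, 'f, 'r, 'k) struct"
  assumes \<eta>: "\<eta> \<in> lim_maps M N" and \<theta>: "\<theta> \<in> lim_maps N R"
  shows "compose (types M) \<theta> \<eta> \<in> lim_maps M R"
  unfolding lim_maps_def
proof (intro CollectI conjI allI impI)
  show "compose (types M) \<theta> \<eta> \<in> types M \<rightarrow>\<^sub>E types R"
    using lim_maps_in[OF \<eta>] lim_maps_in[OF \<theta>] by (auto simp: compose_def)
next
  fix Q :: "('s, 'f, 'r, 'i + 's \<times> 'm) fm set set" and F :: "('s, 'f, 'r, 'i + 's \<times> 'k) fm set"
  assume Q: "finite Q" "Q \<subseteq> types M" and F: "finite F" "F \<subseteq> fms (elems R)"
  have "finite (\<eta> ` Q)" "\<eta> ` Q \<subseteq> types N" using Q lim_maps_in[OF \<eta>] by auto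
  then obtain k where k: "acts R N F k"
    "\<And>p \<phi>. p \<in> \<eta> ` Q \<Longrightarrow> \<phi> \<in> F \<Longrightarrow> \<phi> \<in> \<theta> p \<longleftrightarrow> par_act k \<phi> \<in> p"
    using lim_mapsE[OF \<theta> _ _ F] by metis
  obtain l where l: "acts N M (par_act k ` F) l"
    "\<And>p \<phi>. p \<in> Q \<Longrightarrow> \<phi> \<in> par_act k ` F \<Longrightarrow> \<phi> \<in> \<eta> p \<longleftrightarrow> par_act l \<phi> \<in> p"
    using lim_mapsE[OF \<eta> Q _ acts_image[OF k(1)]] F(1) by (metis finite_imageI)
  have "\<phi> \<in> compose (types M) \<theta> \<eta> p \<longleftrightarrow> par_act (l \<circ> k) \<phi> \<in> p" if "p \<in> Q" "\<phi> \<in> F" for p \<phi>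
    using that k(2)[of "\<eta> p" \<phi>] l(2)[of p "par_act k \<phi>"] Q(2)
    by (auto simp: compose_def par_act_comp[symmetric])
  then show "\<exists>k. acts R M F k \<and>
      (\<forall>p\<in>Q. \<forall>\<phi>\<in>F. \<phi> \<in> compose (types M) \<theta> \<eta> p \<longleftrightarrow> par_act k \<phi> \<in> p)"
    using acts_comp[OF k(1) l(1) F(1)] by blast
qed

text \<open>\<open>\<eta>\<close> is a cluster point of the net \<open>A \<mapsto> \<rho> A\<close>
  indexed by the finite subsets of \<open>elems N\<close>, where \<open>\<rho> A\<close> acts by
  pulling formulas back. Hence agreement is demanded at arbitrarily large \<open>A\<close>.\<close>

definition cluster_map where
  "cluster_map M N \<rho> \<eta> \<longleftrightarrow> (\<forall>Q F B. finite Q \<longrightarrow> Q \<subseteq> types M \<longrightarrow> finite F \<longrightarrow> F \<subseteq> fms (elems N) \<longrightarrow>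
     finite B \<longrightarrow> B \<subseteq> elems N \<longrightarrow>
     (\<exists>A. finite A \<and> A \<subseteq> elems N \<and> B \<subseteq> A \<and> (\<forall>p\<in>Q. \<forall>\<phi>\<in>F. \<phi> \<in> \<eta> p \<longleftrightarrow> par_act (\<rho> A) \<phi> \<in> p)))"

lemma cluster_mapE:
  assumes "cluster_map M N \<rho> \<eta>" "finite Q" "Q \<subseteq> types M" "finite F" "F \<subseteq> fms (elems N)"
    "finite B" "B \<subseteq> elems N"
  obtains A where "finite A" "A \<subseteq> elems N" "B \<subseteq> A"
    "\<And>p \<phi>. p \<in> Q \<Longrightarrow> \<phi> \<in> F \<Longrightarrow> \<phi> \<in> \<eta> p \<longleftrightarrow> par_act (\<rho> A) \<phi> \<in> p"
proof -
  have "\<exists>A. finite A \<and> A \<subseteq> elems N \<and> B \<subseteq> A \<and> (\<forall>p\<in>Q. \<forall>\<phi>\<in>F. \<phi> \<in> \<eta> p \<longleftrightarrow> par_act (\<rho> A) \<phi> \<in> p)"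
    using assms(1)[unfolded cluster_map_def] assms(2-) by simp
  then show ?thesis using that by auto
qed

text \<open>Compactness, made explicit by a limit along an ultrafilter that contains the cone over
  every finite set of parameters. A formula belongs to the limit of \<open>p\<close> iff almost all
  \<open>\<rho> A\<close> pull it back into \<open>p\<close>.\<close>

lemma lim_maps_cluster:
  fixes M :: "('s, 'f, 'r, 'm) struct" and N :: "('s, 'f, 'r, 'n) struct"
  assumes ext: "hom_ext L M N" and N: "\<And>s. Dom N s \<noteq> {}"
    and \<rho>: "\<And>A. finite A \<Longrightarrow> A \<subseteq> elems N \<Longrightarrow> pelem L N M A (\<rho> A)"
  obtains \<eta> where "\<eta> \<in> lim_maps M N" "cluster_map M N \<rho> \<eta>"
proof -
  define cone where "cone = (\<lambda>B. {A. finite A \<and> A \<subseteq> elems N \<and> B \<subseteq> A})"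
  have fip: "\<Inter>\<F> \<noteq> {}" if \<F>: "\<F> \<subseteq> cone ` {B. finite B \<and> B \<subseteq> elems N}" "finite \<F>" for \<F>
  proof -
    obtain \<B> where "finite \<B>" "\<B> \<subseteq> {B. finite B \<and> B \<subseteq> elems N}" "\<F> = cone ` \<B>"
      using finite_subset_image[OF \<F>(2,1)] by blast
    then have "\<Union>\<B> \<in> \<Inter>\<F>" by (auto simp: cone_def)
    then show ?thesis by blast
  qed
  obtain U where U: "cone ` {B. finite B \<and> B \<subseteq> elems N} \<subseteq> U" "{} \<notin> U"
    "\<And>V W. V \<in> U \<Longrightarrow> W \<in> U \<Longrightarrow> V \<inter> W \<in> U" "\<And>V. V \<in> U \<or> - V \<in> U"
    using ultrafilter_extension[OF fip] by blast
  have UNIV: "UNIV \<in> U" using U(2) U(4)[of UNIV] by simp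
  have Inter: "(\<Inter>j\<in>J. V j) \<in> U" if "finite J" "\<forall>j\<in>J. V j \<in> U" for J and V :: "'j \<Rightarrow> _"
    using that by (induction J) (auto simp: UNIV intro: U(3))
  define W where "W = (\<lambda>(p :: ('s, 'f, 'r, 'i + 's \<times> 'm) fm set) \<phi>. {A. par_act (\<rho> A) \<phi> \<in> p})"
  define \<eta> where "\<eta> = (\<lambda>p\<in>types M. {\<phi> \<in> fms (elems N). W p \<phi> \<in> U})"
  have cluster: "\<exists>A. finite A \<and> A \<subseteq> elems N \<and> B \<subseteq> A \<and>
      (\<forall>p\<in>Q. \<forall>\<phi>\<in>F. \<phi> \<in> \<eta> p \<longleftrightarrow> par_act (\<rho> A) \<phi> \<in> p)"
    if h: "finite Q" "Q \<subseteq> types M" "finite F" "F \<subseteq> fms (elems N)" "finite B" "B \<subseteq> elems N" for Q F B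
  proof -
    define V where "V = (\<lambda>(p, \<phi>). if \<phi> \<in> \<eta> p then W p \<phi> else - W p \<phi>)"
    have "- Y \<in> U" if "Y \<notin> U" for Y using that U(4) by blast
    then have "\<forall>j\<in>Q \<times> F. V j \<in> U"
      using h by (auto simp: V_def \<eta>_def subset_iff)
    then have "(\<Inter>j\<in>Q \<times> F. V j) \<inter> cone B \<in> U"
      using U(1) h by (intro U(3) Inter) auto
    then have "(\<Inter>j\<in>Q \<times> F. V j) \<inter> cone B \<noteq> {}" using U(2) by metis
    then obtain A where "A \<in> (\<Inter>j\<in>Q \<times> F. V j) \<inter> cone B" by blast
    then show ?thesis
      by (intro exI[of _ A]) (auto simp: V_def W_def cone_def split: if_splits)
  qed
  have "\<eta> p \<in> types N" if p: "p \<in> types M" for p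
    unfolding type_set_def
  proof (intro CollectI conjI ballI)
    show "\<eta> p \<subseteq> fms (elems N)" using p by (auto simp: \<eta>_def)
    show "fin_satisfiable N v (\<eta> p)"
      unfolding fin_satisfiable_def
    proof (intro allI impI)
      fix F assume F: "F \<subseteq> \<eta> p" "finite F"
      then have FN: "F \<subseteq> fms (elems N)" using p by (auto simp: \<eta>_def)
      obtain B where B: "finite B" "B \<subseteq> elems N" "F \<subseteq> fms B"
        using formulas_over_finite_set_params[OF F(2) FN] .
      obtain A where A: "finite A" "A \<subseteq> elems N" "B \<subseteq> A"
        "\<forall>\<phi>\<in>F. \<phi> \<in> \<eta> p \<longleftrightarrow> par_act (\<rho> A) \<phi> \<in> p"
        using cluster[of "{p}" F B] p F(2) FN B by auto
      have pe: "pelem L N M B (\<rho> A)" using pelem_mono[OF \<rho>[OF A(1,2)] A(3)] .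
      let ?i = "inv_into B (\<rho> A)"
      have "par_act (\<rho> A) ` F \<subseteq> p" using A(4) F(1) by auto
      then obtain e where e: "e \<in> tuples M v" "\<forall>\<phi>\<in>par_act (\<rho> A) ` F. sat_over M e \<phi>"
        using type_fin_sat[OF p] F(2) by (metis finite_imageI)
      \<comment> \<open>The realization found in \<open>M\<close> returns to \<open>N\<close> along
        the inverse of \<open>\<rho> A\<close>; this is what extension from \<open>M\<close> to
        \<open>N\<close> is for.\<close>
      have "\<exists>e'\<in>tuples N v. \<forall>\<phi>\<in>par_act (\<rho> A) ` F. sat_over N e' (par_act ?i \<phi>)"
        by (rule fin_sat_transfer[OF ext _ pelem_inv[OF pe] _ pelem_act_set[OF pe B(3)] e N])
           (use B F in auto)
      moreover have "par_act ?i (par_act (\<rho> A) \<phi>) = \<phi>" if "\<phi> \<in> F" for \<phi>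
        unfolding par_act_comp
        by (rule par_act_id[of _ L v B]) (use that B(3) pelem_inj[OF pe] in auto)
      ultimately show "\<exists>e\<in>tuples N v. \<forall>\<phi>\<in>F. sat_over N e \<phi>" by auto
    qed
    show "map_fm Inl ` X \<subseteq> \<eta> p"
    proof (rule image_subsetI)
      fix \<phi> assume \<phi>: "\<phi> \<in> X"
      then have in_p: "map_fm Inl \<phi> \<in> p" using p by (auto simp: type_set_def)
      then have "\<phi> \<in> formulas L v" using type_subset[OF p] fms_Inl by blast
      then have "map_fm Inl \<phi> \<in> fms (elems N)" by (simp add: fms_Inl)
      \<comment> \<open>A formula of \<open>X\<close> has no parameters, so every
        \<open>\<rho> A\<close> fixes it.\<close>
      moreover have "W p (map_fm Inl \<phi>) = UNIV" using in_p by (auto simp: W_def)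
      ultimately show "map_fm Inl \<phi> \<in> \<eta> p" using p UNIV by (simp add: \<eta>_def)
    qed
    show "\<phi> \<in> \<eta> p \<or> Neg \<phi> \<in> \<eta> p" if \<phi>: "\<phi> \<in> fms (elems N)" for \<phi>
    proof -
      obtain B where B: "finite B" "B \<subseteq> elems N" "\<phi> \<in> fms B"
        using formulas_over_finite_params[OF \<phi>] .
      \<comment> \<open>One \<open>A\<close> serves \<open>\<phi>\<close> and its negation, so
        completeness of \<open>p\<close> at the pulled-back formula transfers.\<close>
      obtain A where A: "finite A" "A \<subseteq> elems N" "B \<subseteq> A"
        "\<forall>\<psi>\<in>{\<phi>, Neg \<phi>}. \<psi> \<in> \<eta> p \<longleftrightarrow> par_act (\<rho> A) \<psi> \<in> p"
        using cluster[of "{p}" "{\<phi>, Neg \<phi>}" B] p \<phi> B by auto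
      have "\<phi> \<in> fms A" using B(3) A(3) formulas_over_mono by blast
      from pelem_act_elems[OF \<rho>[OF A(1,2)] this] show ?thesis
        using type_Neg[OF p] A(4) by auto
    qed
  qed
  then have \<eta>1: "\<eta> \<in> types M \<rightarrow>\<^sub>E types N" by (auto simp: \<eta>_def)
  have "\<eta> \<in> lim_maps M N"
    unfolding lim_maps_def
  proof (intro CollectI conjI allI impI \<eta>1)
    fix Q F assume h: "finite Q" "Q \<subseteq> types M" "finite F" "F \<subseteq> fms (elems N)"
    obtain B where B: "finite B" "B \<subseteq> elems N" "F \<subseteq> fms B"
      using formulas_over_finite_set_params[OF h(3,4)] .
    obtain A where A: "finite A" "A \<subseteq> elems N" "B \<subseteq> A"
      "\<forall>p\<in>Q. \<forall>\<phi>\<in>F. \<phi> \<in> \<eta> p \<longleftrightarrow> par_act (\<rho> A) \<phi> \<in> p"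
      using cluster[OF h B(1,2)] by blast
    moreover have "acts N M F (\<rho> A)"
      unfolding acts_def using pelem_mono[OF \<rho>[OF A(1,2)] A(3)] B by blast
    ultimately show "\<exists>k. acts N M F k \<and> (\<forall>p\<in>Q. \<forall>\<phi>\<in>F. \<phi> \<in> \<eta> p \<longleftrightarrow> par_act k \<phi> \<in> p)"
      by blast
  qed
  moreover have "cluster_map M N \<rho> \<eta>"
    unfolding cluster_map_def using cluster by simp
  ultimately show ?thesis by (rule that)
qed

end

section \<open>Transport between two models\<close>

context types_over
begin

text \<open>Minimality is recorded by its consequence that left multiplication leads from any member
  of \<open>I\<close> to any other. This form needs no topology and speaks of limit maps
  alone.\<close>

definition min_idem ::
  "('s, 'f, 'r, 'm) struct \<Rightarrow>
   (('s, 'f, 'r, 'i + 's \<times> 'm) fm set \<Rightarrow> ('s, 'f, 'r, 'i + 's \<times> 'm) fm set) set \<Rightarrow>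
   (('s, 'f, 'r, 'i + 's \<times> 'm) fm set \<Rightarrow> ('s, 'f, 'r, 'i + 's \<times> 'm) fm set) \<Rightarrow> bool" where
  "min_idem M I u \<longleftrightarrow> I \<subseteq> lim_maps M M \<and> u \<in> I \<and> compose (types M) u u = u \<and>
     (\<forall>\<eta>\<in>lim_maps M M. \<forall>\<mu>\<in>I. compose (types M) \<eta> \<mu> \<in> I) \<and>
     (\<forall>\<mu>\<in>I. \<forall>\<nu>\<in>I. \<exists>\<theta>\<in>lim_maps M M. compose (types M) \<theta> \<mu> = \<nu>)"

text \<open>The group \<open>u I\<close>, described by \<open>u g = g = g u\<close> without mention
  of the ideal.\<close>

definition idem_group ::
  "('s, 'f, 'r, 'm) struct \<Rightarrow>
   (('s, 'f, 'r, 'i + 's \<times> 'm) fm set \<Rightarrow> ('s, 'f, 'r, 'i + 's \<times> 'm) fm set) \<Rightarrow>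
   (('s, 'f, 'r, 'i + 's \<times> 'm) fm set \<Rightarrow> ('s, 'f, 'r, 'i + 's \<times> 'm) fm set) set" where
  "idem_group M u = {g \<in> lim_maps M M. \<forall>p\<in>types M. u (g p) = g p \<and> g (u p) = g p}"

lemma min_idem_in: "min_idem M I u \<Longrightarrow> u \<in> lim_maps M M"
  by (auto simp: min_idem_def)

lemma min_idem_idem: 
  assumes "min_idem M I u" "p \<in> types M" shows "u (u p) = u p"
proof -
  have "compose (types M) u u p = u p" using assms(1) by (simp add: min_idem_def)
  then show ?thesis using assms(2) by (simp add: compose_def)
qed

text \<open>No limit map destroys information on the image of \<open>u\<close>: the composite of
  \<open>\<eta>\<close> and \<open>u\<close> stays in the ideal, from where left multiplication
  leads back to \<open>u\<close>.\<close>

lemma min_idem_return: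
  assumes "min_idem M I u" "\<eta> \<in> lim_maps M M"
  obtains \<theta> where "\<theta> \<in> lim_maps M M" "\<And>p. p \<in> types M \<Longrightarrow> \<theta> (\<eta> (u p)) = u p"
proof -
  have "u \<in> I" "compose (types M) \<eta> u \<in> I" using assms by (auto simp: min_idem_def)
  then obtain \<theta> where \<theta>: "\<theta> \<in> lim_maps M M" "compose (types M) \<theta> (compose (types M) \<eta> u) = u"
    using assms(1) unfolding min_idem_def by blast
  have "\<theta> (\<eta> (u p)) = u p" if "p \<in> types M" for p
    using fun_cong[OF \<theta>(2), of p] that by (simp add: compose_def)
  then show ?thesis using that \<theta>(1) by blast
qed

text \<open>Every \<open>g \<in> I\<close> has the form \<open>\<theta> u\<close>, hence
  \<open>g u = g\<close>; conversely \<open>g = g u\<close> lies in the left ideal because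
  \<open>u\<close> does.\<close>

lemma idem_group_eq:
  assumes "min_idem M I u"
  shows "compose (types M) u ` I = idem_group M u"
proof -
  have I: "g \<in> lim_maps M M \<and> (\<forall>p\<in>types M. g (u p) = g p)" if g: "g \<in> I" for g
  proof -
    obtain \<theta> where \<theta>: "compose (types M) \<theta> u = g"
      using assms g unfolding min_idem_def by blast
    have "g (u p) = g p" if "p \<in> types M" for p
      using that min_idem_idem[OF assms that] lim_maps_in[OF min_idem_in[OF assms] that]
      unfolding \<theta>[symmetric] by (simp add: compose_def)
    then show ?thesis using assms g by (auto simp: min_idem_def)
  qed
  have "compose (types M) u g \<in> idem_group M u" if g: "g \<in> I" for g
    using I[OF g] lim_maps_comp[OF _ min_idem_in[OF assms]] min_idem_idem[OF assms]
      lim_maps_in[of g M M] lim_maps_in[OF min_idem_in[OF assms]]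
    by (auto simp: idem_group_def compose_def)
  moreover have "g \<in> compose (types M) u ` I" if g: "g \<in> idem_group M u" for g
  proof
    have gE: "g \<in> lim_maps M M" using g by (simp add: idem_group_def)
    show "g = compose (types M) u g"
      by (rule extensionalityI[OF lim_maps_ext[OF gE]]) (use g in \<open>auto simp: idem_group_def compose_def\<close>)
    have "g = compose (types M) g u"
      by (rule extensionalityI[OF lim_maps_ext[OF gE]]) (use g in \<open>auto simp: idem_group_def compose_def\<close>)
    moreover have "compose (types M) g u \<in> I" using assms gE by (auto simp: min_idem_def)
    ultimately show "g \<in> I" by simp
  qed
  ultimately show ?thesis by blast
qed

text \<open>\<open>a\<close> and \<open>b\<close> restrict to mutually inverse bijections between
  the images of \<open>u\<close> and \<open>w\<close>; the remaining equations say that they factor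
  through these images.\<close>

definition lim_iso where
  "lim_iso M N u w a b \<longleftrightarrow> a \<in> lim_maps M N \<and> b \<in> lim_maps N M \<and>
     (\<forall>p\<in>types M. b (a p) = u p \<and> a (u p) = a p \<and> w (a p) = a p) \<and>
     (\<forall>q\<in>types N. a (b q) = w q \<and> b (w q) = b q \<and> u (b q) = b q)"

lemma lim_iso_sym: "lim_iso M N u w a b \<Longrightarrow> lim_iso N M w u b a"
  by (simp add: lim_iso_def)

text \<open>Cut \<open>a0\<close> down to \<open>a = w a0 u\<close>; minimality in \<open>M\<close>
  yields \<open>b\<close> with \<open>b a = u\<close>. Then \<open>a b\<close> is idempotent, and
  minimality in \<open>N\<close> gives \<open>\<theta>' a b = w\<close>, so that
  \<open>w = \<theta>' a b = \<theta>' a b a b = w a b = a b\<close>.\<close>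

lemma lim_iso_exists:
  assumes u: "min_idem M I u" and w: "min_idem N J w"
    and "a0 \<in> lim_maps M N" "e0 \<in> lim_maps N M"
  obtains a b where "lim_iso M N u w a b"
proof -
  note uE = min_idem_in[OF u] and wE = min_idem_in[OF w]
  define a where "a = compose (types M) w (compose (types M) a0 u)"
  have aE: "a \<in> lim_maps M N"
    unfolding a_def by (intro lim_maps_comp[OF _ wE] lim_maps_comp[OF uE] assms)
  have a: "a (u p) = a p" "w (a p) = a p" if "p \<in> types M" for p
    using that by (simp_all add: a_def compose_eq lim_maps_in[OF uE] lim_maps_in[OF assms(3)]
        min_idem_idem[OF u] min_idem_idem[OF w])
  obtain \<theta> where \<theta>: "\<theta> \<in> lim_maps M M" "\<And>p. p \<in> types M \<Longrightarrow> \<theta> (e0 (a p)) = u p"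
    using min_idem_return[OF u lim_maps_comp[OF aE assms(4)]] a(1) lim_maps_in[OF uE]
    by (metis compose_eq)
  define b where "b = compose (types N) u (compose (types N) \<theta> (compose (types N) e0 w))"
  have bE: "b \<in> lim_maps N M"
    unfolding b_def by (intro lim_maps_comp[OF _ uE] lim_maps_comp[OF _ \<theta>(1)] lim_maps_comp[OF wE] assms)
  have b: "b (w q) = b q" "u (b q) = b q" if "q \<in> types N" for q
    using that by (simp_all add: b_def compose_eq lim_maps_in[OF wE] lim_maps_in[OF assms(4)]
        lim_maps_in[OF \<theta>(1)] min_idem_idem[OF u] min_idem_idem[OF w])
  have ba: "b (a p) = u p" if "p \<in> types M" for p
    using that by (simp add: b_def compose_eq lim_maps_in[OF aE] a \<theta>(2) min_idem_idem[OF u])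
  have ab: "a (b q) = w q" if q: "q \<in> types N" for q
  proof -
    obtain \<theta>' where \<theta>': "\<theta>' \<in> lim_maps N N" "\<And>q. q \<in> types N \<Longrightarrow> \<theta>' (a (b q)) = w q"
      using min_idem_return[OF w lim_maps_comp[OF bE aE]] b(1) lim_maps_in[OF wE]
      by (metis compose_eq)
    have q': "a (b q) \<in> types N" "b q \<in> types M" using q lim_maps_in[OF aE] lim_maps_in[OF bE] by auto
    have "w q = \<theta>' (a (b q))" using \<theta>'(2)[OF q] by simp
    also have "\<dots> = \<theta>' (a (b (a (b q))))" using ba[OF q'(2)] b(2)[OF q] by simp
    also have "\<dots> = w (a (b q))" using \<theta>'(2)[OF q'(1)] .
    also have "\<dots> = a (b q)" using a(2)[OF q'(2)] .
    finally show ?thesis by simp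
  qed
  show ?thesis
    by (rule that[of a b]) (use aE bE a b ba ab in \<open>simp add: lim_iso_def\<close>)
qed

section \<open>Transport of the group and its closure operator along \<open>a\<close> and
  \<open>b\<close>\<close>

definition transp where
  "transp M N a b g = compose (types N) a (compose (types N) g b)"

lemma transp_apply [simp]: "q \<in> types N \<Longrightarrow> transp M N a b g q = a (g (b q))"
  by (simp add: transp_def compose_eq)

lemma transp_in:
  assumes ab: "lim_iso M N u w a b" and g: "g \<in> idem_group M u"
  shows "transp M N a b g \<in> idem_group N w"
proof -
  have E: "a \<in> lim_maps M N" "b \<in> lim_maps N M" "g \<in> lim_maps M M"
    using ab g by (auto simp: lim_iso_def idem_group_def)
  then have "transp M N a b g \<in> lim_maps N N"
    unfolding transp_def by (intro lim_maps_comp[OF _ E(1)] lim_maps_comp[OF E(2)])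
  moreover have "b q \<in> types M" "g (b q) \<in> types M" "w q \<in> types N" if "q \<in> types N" for q
  proof -
    show 1: "b q \<in> types M" using lim_maps_in[OF E(2) that] .
    show "g (b q) \<in> types M" using lim_maps_in[OF E(3) 1] .
    show "w q \<in> types N" using lim_maps_in[OF E(1) 1] ab that by (simp add: lim_iso_def)
  qed
  ultimately show ?thesis
    using ab g by (auto simp: idem_group_def lim_iso_def)
qed

lemma transp_inv:
  assumes ab: "lim_iso M N u w a b" and g: "g \<in> idem_group M u"
  shows "transp N M b a (transp M N a b g) = g"
proof (rule extensionalityI)
  have E: "a \<in> lim_maps M N" "b \<in> lim_maps N M" "g \<in> lim_maps M M"
    using ab g by (auto simp: lim_iso_def idem_group_def)
  show "g \<in> extensional (types M)" using lim_maps_ext[OF E(3)] .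
  show "transp N M b a (transp M N a b g) \<in> extensional (types M)"
    by (simp add: transp_def compose_extensional)
  fix p assume p: "p \<in> types M"
  then have "a p \<in> types N" "g p \<in> types M" using lim_maps_in E by blast+
  then show "transp N M b a (transp M N a b g) p = g p"
    using p ab g by (simp add: lim_iso_def idem_group_def)
qed

text \<open>On the right the factor \<open>b a = u\<close> appears between \<open>g\<close> and
  \<open>g'\<close>, where it is absorbed.\<close>

lemma transp_mult:
  assumes ab: "lim_iso M N u w a b" and g: "g \<in> idem_group M u" "g' \<in> idem_group M u"
  shows "transp M N a b (compose (types M) g g') =
    compose (types N) (transp M N a b g) (transp M N a b g')"
proof (rule extensionalityI)
  have E: "a \<in> lim_maps M N" "b \<in> lim_maps N M" "g \<in> lim_maps M M" "g' \<in> lim_maps M M"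
    using ab g by (auto simp: lim_iso_def idem_group_def)
  show "transp M N a b (compose (types M) g g') \<in> extensional (types N)"
    by (simp add: transp_def compose_extensional)
  show "compose (types N) (transp M N a b g) (transp M N a b g') \<in> extensional (types N)"
    by (simp add: compose_extensional)
  fix q assume q: "q \<in> types N"
  then have "b q \<in> types M" using lim_maps_in[OF E(2)] by blast
  moreover from this have "g' (b q) \<in> types M" using lim_maps_in[OF E(4)] by blast
  moreover from this have "a (g' (b q)) \<in> types N" using lim_maps_in[OF E(1)] by blast
  ultimately show "transp M N a b (compose (types M) g g') q =
      compose (types N) (transp M N a b g) (transp M N a b g') q"
    using q ab g by (simp add: compose_eq lim_iso_def idem_group_def)
qed

lemma transp_bij:
  assumes "lim_iso M N u w a b"
  shows "bij_betw (transp M N a b) (idem_group M u) (idem_group N w)"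
  by (rule bij_betw_byWitness[where f' = "transp N M b a"])
     (use transp_inv[OF assms] transp_inv[OF lim_iso_sym[OF assms]] transp_in[OF assms]
        transp_in[OF lim_iso_sym[OF assms]] in auto)

text \<open>A single \<open>k\<close> approximates both \<open>\<sigma> \<rightarrow> u\<close> and \<open>\<sigma> \<alpha> \<rightarrow> \<zeta>\<close>.\<close>

definition tau_cl where
  "tau_cl M u A = {\<zeta> \<in> idem_group M u.
     \<forall>Q F. finite Q \<longrightarrow> Q \<subseteq> types M \<longrightarrow> finite F \<longrightarrow> F \<subseteq> fms (elems M) \<longrightarrow>
       (\<exists>k. \<exists>\<alpha>\<in>A. acts M M F k \<and> (\<forall>p\<in>Q. \<forall>\<phi>\<in>F.
          (\<phi> \<in> u p \<longleftrightarrow> par_act k \<phi> \<in> p) \<and> (\<phi> \<in> \<zeta> p \<longleftrightarrow> par_act k \<phi> \<in> \<alpha> p)))}"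

lemma tau_clD:
  assumes "\<zeta> \<in> tau_cl M u A" "finite Q" "Q \<subseteq> types M" "finite F" "F \<subseteq> fms (elems M)"
  shows "\<exists>k. \<exists>\<alpha>\<in>A. acts M M F k \<and> (\<forall>p\<in>Q. \<forall>\<phi>\<in>F.
    (\<phi> \<in> u p \<longleftrightarrow> par_act k \<phi> \<in> p) \<and> (\<phi> \<in> \<zeta> p \<longleftrightarrow> par_act k \<phi> \<in> \<alpha> p))"
  using assms(1)[unfolded tau_cl_def mem_Collect_eq] assms(2-) by blast

text \<open>The approximations \<open>k\<close> of \<open>a\<close>, \<open>l\<close> of the net and
  \<open>m\<close> of \<open>b\<close> are chosen in this order, since each is taken at the formulas
  already pulled back by its predecessors. Their composite approximates \<open>a u b = w\<close>,
  and it relates \<open>a \<zeta> b\<close> to \<open>a \<alpha> b\<close>.\<close>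

lemma transp_tau:
  fixes M :: "('s, 'f, 'r, 'm) struct" and N :: "('s, 'f, 'r, 'n) struct"
  assumes ab: "lim_iso M N u w a b" and A: "A \<subseteq> idem_group M u" and \<zeta>: "\<zeta> \<in> tau_cl M u A"
  shows "transp M N a b \<zeta> \<in> tau_cl N w (transp M N a b ` A)"
proof -
  have \<zeta>G: "\<zeta> \<in> idem_group M u" using \<zeta> by (simp add: tau_cl_def)
  have E: "a \<in> lim_maps M N" "b \<in> lim_maps N M" "\<zeta> \<in> lim_maps M M"
    using ab \<zeta>G by (auto simp: lim_iso_def idem_group_def)
  show ?thesis
    unfolding tau_cl_def
  proof (intro CollectI conjI allI impI transp_in[OF ab \<zeta>G])
    fix Q :: "('s, 'f, 'r, 'i + 's \<times> 'n) fm set set" and F :: "('s, 'f, 'r, 'i + 's \<times> 'n) fm set"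
    assume Q: "finite Q" "Q \<subseteq> types N" and F: "finite F" "F \<subseteq> fms (elems N)"
    let ?Q1 = "b ` Q"
    have Q1: "finite ?Q1" "?Q1 \<subseteq> types M" using Q lim_maps_in[OF E(2)] by auto
    \<comment> \<open>\<open>a\<close> is approximated at \<open>b q\<close> for the sake of
      \<open>w = a b\<close>, and at \<open>\<zeta> (b q)\<close> for the sake of the transported
      \<open>\<zeta>\<close>.\<close>
    then have Q1': "finite (?Q1 \<union> \<zeta> ` ?Q1)" "?Q1 \<union> \<zeta> ` ?Q1 \<subseteq> types M"
      using lim_maps_in[OF E(3)] by auto
    obtain k where k: "acts N M F k"
      "\<And>p \<phi>. p \<in> ?Q1 \<union> \<zeta> ` ?Q1 \<Longrightarrow> \<phi> \<in> F \<Longrightarrow> \<phi> \<in> a p \<longleftrightarrow> par_act k \<phi> \<in> p"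
      using lim_mapsE[OF E(1) Q1' F] by metis
    have kF: "finite (par_act k ` F)" "par_act k ` F \<subseteq> fms (elems M)"
      using F(1) acts_image[OF k(1)] by auto
    have "\<exists>l. \<exists>\<alpha>\<in>A. acts M M (par_act k ` F) l \<and> (\<forall>p\<in>?Q1. \<forall>\<phi>\<in>par_act k ` F.
          (\<phi> \<in> u p \<longleftrightarrow> par_act l \<phi> \<in> p) \<and> (\<phi> \<in> \<zeta> p \<longleftrightarrow> par_act l \<phi> \<in> \<alpha> p))"
      using tau_clD[OF \<zeta> Q1 kF] .
    then obtain l \<alpha> where l: "\<alpha> \<in> A" "acts M M (par_act k ` F) l"
      "\<forall>p\<in>?Q1. \<forall>\<phi>\<in>par_act k ` F.
         (\<phi> \<in> u p \<longleftrightarrow> par_act l \<phi> \<in> p) \<and> (\<phi> \<in> \<zeta> p \<longleftrightarrow> par_act l \<phi> \<in> \<alpha> p)"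
      by (elim exE bexE conjE)
    have \<alpha>G: "\<alpha> \<in> idem_group M u" and \<alpha>E: "\<alpha> \<in> lim_maps M M"
      using l(1) A by (auto simp: idem_group_def)
    have lkF: "finite (par_act l ` par_act k ` F)" "par_act l ` par_act k ` F \<subseteq> fms (elems M)"
      using F(1) acts_image[OF l(2)] by auto
    \<comment> \<open>The points \<open>a (\<alpha> (b q))\<close> are known only once
      \<open>\<alpha>\<close> is; there \<open>b\<close> returns \<open>\<alpha> (b q)\<close>,
      because \<open>b a = u\<close> fixes it.\<close>
    let ?Q3 = "Q \<union> (a \<circ> \<alpha> \<circ> b) ` Q"
    have Q3: "finite ?Q3" "?Q3 \<subseteq> types N"
      using Q lim_maps_in[OF E(1)] lim_maps_in[OF E(2)] lim_maps_in[OF \<alpha>E] by auto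
    obtain m where m: "acts M N (par_act l ` par_act k ` F) m"
      "\<And>p \<phi>. p \<in> ?Q3 \<Longrightarrow> \<phi> \<in> par_act l ` par_act k ` F \<Longrightarrow> \<phi> \<in> b p \<longleftrightarrow> par_act m \<phi> \<in> p"
      using lim_mapsE[OF E(2) Q3 lkF] by metis
    have "acts N N F (m \<circ> (l \<circ> k))"
      using m(1) by (intro acts_comp[OF acts_comp[OF k(1) l(2) F(1)] _ F(1)])
        (simp add: image_image par_act_comp)
    moreover have "(\<phi> \<in> w q \<longleftrightarrow> par_act (m \<circ> (l \<circ> k)) \<phi> \<in> q) \<and>
      (\<phi> \<in> transp M N a b \<zeta> q \<longleftrightarrow> par_act (m \<circ> (l \<circ> k)) \<phi> \<in> transp M N a b \<alpha> q)"
      if q: "q \<in> Q" and \<phi>: "\<phi> \<in> F" for q \<phi>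
    proof -
      have qt: "q \<in> types N" "b q \<in> types M" "\<alpha> (b q) \<in> types M"
        using q Q(2) lim_maps_in[OF E(2)] lim_maps_in[OF \<alpha>E] by auto
      have "\<phi> \<in> w q \<longleftrightarrow> \<phi> \<in> a (b q)" using ab qt by (simp add: lim_iso_def)
      also have "\<dots> \<longleftrightarrow> par_act k \<phi> \<in> b q" using k(2) q \<phi> by blast
      also have "\<dots> \<longleftrightarrow> par_act k \<phi> \<in> u (b q)" using ab qt by (simp add: lim_iso_def)
      also have "\<dots> \<longleftrightarrow> par_act l (par_act k \<phi>) \<in> b q" using l(3) q \<phi> by auto
      also have "\<dots> \<longleftrightarrow> par_act m (par_act l (par_act k \<phi>)) \<in> q" using m(2) q \<phi> by blast
      finally have 1: "\<phi> \<in> w q \<longleftrightarrow> par_act (m \<circ> (l \<circ> k)) \<phi> \<in> q" by (simp only: par_act_comp)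
      have "\<phi> \<in> a (\<zeta> (b q)) \<longleftrightarrow> par_act k \<phi> \<in> \<zeta> (b q)" using k(2) q \<phi> by blast
      also have "\<dots> \<longleftrightarrow> par_act l (par_act k \<phi>) \<in> \<alpha> (b q)" using l(3) q \<phi> by auto
      also have "\<alpha> (b q) = b (a (\<alpha> (b q)))"
        using ab \<alpha>G qt by (simp add: lim_iso_def idem_group_def)
      also have "par_act l (par_act k \<phi>) \<in> b (a (\<alpha> (b q))) \<longleftrightarrow>
          par_act m (par_act l (par_act k \<phi>)) \<in> a (\<alpha> (b q))"
        by (rule m(2)) (use q \<phi> in auto)
      finally show ?thesis using 1 qt(1) by (simp only: par_act_comp transp_apply)
    qed
    ultimately show "\<exists>k. \<exists>\<alpha>\<in>transp M N a b ` A. acts N N F k \<and> (\<forall>p\<in>Q. \<forall>\<phi>\<in>F.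
          (\<phi> \<in> w p \<longleftrightarrow> par_act k \<phi> \<in> p) \<and> (\<phi> \<in> transp M N a b \<zeta> p \<longleftrightarrow> par_act k \<phi> \<in> \<alpha> p))"
      using l(1) by blast
  qed
qed

lemma transp_tau_eq:
  assumes ab: "lim_iso M N u w a b" and A: "A \<subseteq> idem_group M u"
  shows "transp M N a b ` tau_cl M u A = tau_cl N w (transp M N a b ` A)"
proof
  show "transp M N a b ` tau_cl M u A \<subseteq> tau_cl N w (transp M N a b ` A)"
    using transp_tau[OF ab A] by blast
  show "tau_cl N w (transp M N a b ` A) \<subseteq> transp M N a b ` tau_cl M u A"
  proof
    fix \<zeta> assume \<zeta>: "\<zeta> \<in> tau_cl N w (transp M N a b ` A)"
    have "transp M N a b ` A \<subseteq> idem_group N w" using transp_in[OF ab] A by blast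
    from transp_tau[OF lim_iso_sym[OF ab] this \<zeta>]
    have "transp N M b a \<zeta> \<in> tau_cl M u ((\<lambda>g. transp N M b a (transp M N a b g)) ` A)"
      by (simp add: image_image)
    moreover have "(\<lambda>g. transp N M b a (transp M N a b g)) ` A = A"
      using transp_inv[OF ab] A by force
    moreover have "\<zeta> = transp M N a b (transp N M b a \<zeta>)"
      using transp_inv[OF lim_iso_sym[OF ab]] \<zeta> by (simp add: tau_cl_def)
    ultimately show "\<zeta> \<in> transp M N a b ` tau_cl M u A" by (metis imageI)
  qed
qed

end

section \<open>The Ellis semigroup of the type space\<close>

abbreviation elem_act :: "('s \<Rightarrow> 'm \<Rightarrow> 'm) \<Rightarrow> 's \<times> 'm \<Rightarrow> 's \<times> 'm" where
  "elem_act \<sigma> \<equiv> \<lambda>(s, a). (s, \<sigma> s a)"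

lemma elem_act_inj:
  assumes "\<sigma> \<in> automorphisms L C"
  shows "inj_on (elem_act \<sigma>) (elems C)"
  using assms by (auto simp: automorphisms_def inj_on_def elems_def bij_betw_def)

text \<open>What the flow needs of a monster model: finite elementary maps are exactly the finite
  pieces of inverses of automorphisms. Inverses appear because a formula lies in the translate of
  \<open>p\<close> by \<open>\<sigma>\<close> iff its pullback along the inverse of
  \<open>\<sigma>\<close> lies in \<open>p\<close>.\<close>

locale homogeneous_types = types_over L v X
  for L :: "('s, 'f, 'r) lang" and v :: "'i \<rightharpoonup> 's" and X :: "('s, 'f, 'r, 'i) fm set" +
  fixes C :: "('s, 'f, 'r, 'm) struct"
  assumes self_ext: "hom_ext L C C" and dom_ne: "\<And>s. Dom C s \<noteq> {}"
    and aut_inv: "\<And>\<sigma> A. \<sigma> \<in> automorphisms L C \<Longrightarrow> finite A \<Longrightarrow> A \<subseteq> elems C \<Longrightarrow>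
      \<exists>k. pelem L C C A k \<and> (\<forall>x\<in>A. elem_act \<sigma> (k x) = x)"
    and aut_ext: "\<And>A k. finite A \<Longrightarrow> pelem L C C A k \<Longrightarrow>
      \<exists>\<sigma>\<in>automorphisms L C. \<forall>x\<in>A. elem_act \<sigma> (k x) = x"
begin

abbreviation "flow \<equiv> type_space L C v X"
abbreviation "moves \<equiv> aut_maps L C v X"

section \<open>Automorphisms and finite elementary maps act alike\<close>

lemma aut_act_iff:
  assumes \<sigma>: "\<sigma> \<in> automorphisms L C" and p: "p \<in> types C"
    and k: "pelem L C C A k" "\<And>x. x \<in> A \<Longrightarrow> elem_act \<sigma> (k x) = x" and \<phi>: "\<phi> \<in> fms A"
  shows "\<phi> \<in> aut_act \<sigma> p \<longleftrightarrow> par_act k \<phi> \<in> p"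
proof
  assume "par_act k \<phi> \<in> p"
  then have "par_act (elem_act \<sigma>) (par_act k \<phi>) \<in> aut_act \<sigma> p" unfolding aut_act_def by blast
  moreover have "par_act (elem_act \<sigma>) (par_act k \<phi>) = \<phi>"
    unfolding par_act_comp by (rule par_act_id[OF \<phi>]) (simp add: k(2))
  ultimately show "\<phi> \<in> aut_act \<sigma> p" by simp
next
  assume "\<phi> \<in> aut_act \<sigma> p"
  then obtain \<psi> where \<psi>: "\<psi> \<in> p" "\<phi> = par_act (elem_act \<sigma>) \<psi>" unfolding aut_act_def by blast
  have \<psi>C: "\<psi> \<in> fms (elems C)" using type_subset[OF p] \<psi>(1) by blast
  let ?B = "Inr -` set_fm \<psi>"
  \<comment> \<open>Since \<open>elem_act \<sigma>\<close> is injective on \<open>elems C\<close>,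
    its right inverse \<open>k\<close> is a left inverse on the parameters of
    \<open>\<psi>\<close>.\<close>
  have "k (elem_act \<sigma> x) = x" if x: "x \<in> ?B" for x
  proof -
    have "map_sum id (elem_act \<sigma>) (Inr x) \<in> set_fm \<phi>" unfolding \<psi>(2) fm.set_map using x by blast
    then have xA: "elem_act \<sigma> x \<in> A" using formulas_over_vars(2)[OF \<phi>] by simp
    have xC: "x \<in> elems C" using formulas_over_vars(2)[OF \<psi>C] x by simp
    have "k (elem_act \<sigma> x) \<in> elems C" using pelem_ran[OF k(1)] xA by blast
    then show ?thesis
      using inj_onD[OF elem_act_inj[OF \<sigma>] k(2)[OF xA]] xC by blast
  qed
  then have "par_act k \<phi> = \<psi>"
    unfolding \<psi>(2) par_act_comp
    by (intro par_act_id[OF formulas_over_restrict[OF \<psi>C order_refl]]) simp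
  then show "par_act k \<phi> \<in> p" using \<psi>(1) by simp
qed

text \<open>A cluster point of finite pieces of the inverse of \<open>\<sigma>\<close> can only be
  the action of \<open>\<sigma>\<close>. Thereby the limit construction also shows that this action
  maps types to types.\<close>

lemma moves_lim:
  assumes "\<gamma> \<in> moves"
  shows "\<gamma> \<in> lim_maps C C"
proof -
  obtain \<sigma> where \<sigma>: "\<sigma> \<in> automorphisms L C" "\<gamma> = restrict (aut_act \<sigma>) (types C)"
    using assms unfolding aut_maps_def by blast
  obtain \<rho> where \<rho>: "\<And>A. finite A \<Longrightarrow> A \<subseteq> elems C \<Longrightarrow> pelem L C C A (\<rho> A) \<and> (\<forall>x\<in>A. elem_act \<sigma> (\<rho> A x) = x)"
    using aut_inv[OF \<sigma>(1)] by metis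
  have \<rho>1: "pelem L C C A (\<rho> A)" if "finite A" "A \<subseteq> elems C" for A using \<rho> that by blast
  obtain \<eta> where \<eta>: "\<eta> \<in> lim_maps C C" "cluster_map C C \<rho> \<eta>"
    by (rule lim_maps_cluster[OF self_ext dom_ne \<rho>1])
  have "\<eta> p = aut_act \<sigma> p" if p: "p \<in> types C" for p
  proof (rule Set.set_eqI)
    fix \<phi>
    show "\<phi> \<in> \<eta> p \<longleftrightarrow> \<phi> \<in> aut_act \<sigma> p"
    proof (cases "\<phi> \<in> fms (elems C)")
      case True
      obtain B where B: "finite B" "B \<subseteq> elems C" "\<phi> \<in> fms B"
        using formulas_over_finite_params[OF True] .
      obtain A where A: "finite A" "A \<subseteq> elems C" "B \<subseteq> A"
        "\<And>q \<psi>. q \<in> {p} \<Longrightarrow> \<psi> \<in> {\<phi>} \<Longrightarrow> \<psi> \<in> \<eta> q \<longleftrightarrow> par_act (\<rho> A) \<psi> \<in> q"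
        by (rule cluster_mapE[OF \<eta>(2), of "{p}" "{\<phi>}" B]) (use p True B in auto)
      have "\<phi> \<in> fms A" using B(3) A(3) formulas_over_mono by blast
      then have "\<phi> \<in> aut_act \<sigma> p \<longleftrightarrow> par_act (\<rho> A) \<phi> \<in> p"
        using \<rho>[OF A(1,2)] by (intro aut_act_iff[OF \<sigma>(1) p, of A]) auto
      then show ?thesis using A(4) by simp
    next
      case False
      have "aut_act \<sigma> p \<subseteq> fms (elems C)"
      proof
        fix \<psi> assume "\<psi> \<in> aut_act \<sigma> p"
        then obtain \<theta> where \<theta>: "\<theta> \<in> p" "\<psi> = par_act (elem_act \<sigma>) \<theta>" unfolding aut_act_def by blast
        have "elem_act \<sigma> ` elems C \<subseteq> elems C"
          using \<sigma>(1) by (auto simp: automorphisms_def elems_def bij_betw_def)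
        moreover have "\<psi> \<in> fms (elem_act \<sigma> ` elems C)"
          unfolding \<theta>(2) using type_subset[OF p] \<theta>(1) by (intro par_act_in) auto
        ultimately show "\<psi> \<in> fms (elems C)" using formulas_over_mono by blast
      qed
      then show ?thesis using False type_subset[OF lim_maps_in[OF \<eta>(1) p]] by blast
    qed
  qed
  then have "\<eta> = \<gamma>"
    using lim_maps_ext[OF \<eta>(1)] unfolding \<sigma>(2) by (intro extensionalityI) auto
  then show ?thesis using \<eta>(1) by simp
qed

lemma acts_moves:
  assumes "acts C C F k"
  obtains \<gamma> where "\<gamma> \<in> moves" "\<And>p \<phi>. p \<in> types C \<Longrightarrow> \<phi> \<in> F \<Longrightarrow> \<phi> \<in> \<gamma> p \<longleftrightarrow> par_act k \<phi> \<in> p"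
proof -
  obtain A where A: "finite A" "pelem L C C A k" "F \<subseteq> fms A" using assms by (auto simp: acts_def)
  obtain \<sigma> where \<sigma>: "\<sigma> \<in> automorphisms L C" "\<And>x. x \<in> A \<Longrightarrow> elem_act \<sigma> (k x) = x"
    using aut_ext[OF A(1,2)] by blast
  show ?thesis
  proof
    show "restrict (aut_act \<sigma>) (types C) \<in> moves" unfolding aut_maps_def using \<sigma>(1) by blast
    show "\<phi> \<in> restrict (aut_act \<sigma>) (types C) p \<longleftrightarrow> par_act k \<phi> \<in> p" if "p \<in> types C" "\<phi> \<in> F" for p \<phi>
      using aut_act_iff[OF \<sigma>(1) that(1) A(2) \<sigma>(2) subsetD[OF A(3) that(2)]] that(1) by simp
  qed
qed

lemma moves_acts:
  assumes "\<gamma> \<in> moves" "finite F" "F \<subseteq> fms (elems C)"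
  obtains k where "acts C C F k" "\<And>p \<phi>. p \<in> types C \<Longrightarrow> \<phi> \<in> F \<Longrightarrow> \<phi> \<in> \<gamma> p \<longleftrightarrow> par_act k \<phi> \<in> p"
proof -
  obtain \<sigma> where \<sigma>: "\<sigma> \<in> automorphisms L C" "\<gamma> = restrict (aut_act \<sigma>) (types C)"
    using assms unfolding aut_maps_def by blast
  obtain B where B: "finite B" "B \<subseteq> elems C" "F \<subseteq> fms B"
    using formulas_over_finite_set_params[OF assms(2,3)] .
  obtain k where k: "pelem L C C B k" "\<And>x. x \<in> B \<Longrightarrow> elem_act \<sigma> (k x) = x"
    using aut_inv[OF \<sigma>(1) B(1,2)] by blast
  show ?thesis
  proof
    show "acts C C F k" unfolding acts_def using B k(1) by blast
    show "\<phi> \<in> \<gamma> p \<longleftrightarrow> par_act k \<phi> \<in> p" if "p \<in> types C" "\<phi> \<in> F" for p \<phi>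
      using aut_act_iff[OF \<sigma>(1) that(1) k subsetD[OF B(3) that(2)]] that(1) \<sigma>(2) by simp
  qed
qed

text \<open>The space of a generated topology is the union of its generators, so each type has to
  contain some formula; \<open>\<phi>0\<close> or its negation serves.\<close>

lemma topspace_flow [simp]: "topspace flow = types C"
proof -
  define \<phi>0 :: "('s, 'f, 'r, 'i + 's \<times> 'm) fm" where "\<phi>0 = Ex undefined (Eq (Bd 0) (Bd 0))"
  have "\<phi>0 \<in> fms (elems C)" by (simp add: \<phi>0_def formulas_over_def formulas_def)
  then have "\<exists>\<phi>\<in>fms (elems C). \<phi> \<in> p" if "p \<in> types C" for p
    using type_Neg[OF that, of \<phi>0] formulas_over_Neg by blast
  then show ?thesis unfolding type_space_def topology_generated_by_topspace by blast
qed

section \<open>Basic neighbourhoods of types and of maps between them\<close>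

definition agree where
  "agree F p = {q \<in> types C. \<forall>\<phi>\<in>F. \<phi> \<in> q \<longleftrightarrow> \<phi> \<in> p}"

lemma openin_agree:
  assumes p: "p \<in> types C" and F: "finite F" "F \<subseteq> fms (elems C)"
  shows "openin flow (agree F p)"
proof -
  have basic: "openin flow {q \<in> types C. \<phi> \<in> q}" if "\<phi> \<in> fms (elems C)" for \<phi>
    unfolding type_space_def by (rule topology_generated_by_Basis) (use that in blast)
  have "openin flow {q \<in> types C. \<phi> \<in> q \<longleftrightarrow> \<phi> \<in> p}" if \<phi>: "\<phi> \<in> fms (elems C)" for \<phi>
  proof (cases "\<phi> \<in> p")
    case False
    \<comment> \<open>Omitting \<open>\<phi>\<close> is an open condition, as it means containing
      \<open>Neg \<phi>\<close>.\<close>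
    have "{q \<in> types C. \<phi> \<in> q \<longleftrightarrow> \<phi> \<in> p} = {q \<in> types C. Neg \<phi> \<in> q}"
      using type_Neg[OF _ \<phi>] False by blast
    then show ?thesis using basic[of "Neg \<phi>"] \<phi> by simp
  qed (use basic[OF \<phi>] in simp)
  then have "openin flow (topspace flow \<inter> (\<Inter>\<phi>\<in>F. {q \<in> types C. \<phi> \<in> q \<longleftrightarrow> \<phi> \<in> p}))"
    using F openin_topspace[of flow] by (intro openin_Int_Inter) auto
  moreover have "topspace flow \<inter> (\<Inter>\<phi>\<in>F. {q \<in> types C. \<phi> \<in> q \<longleftrightarrow> \<phi> \<in> p}) = agree F p"
    by (auto simp: agree_def)
  ultimately show ?thesis by simp
qed

lemma openin_flow_contains_agree:
  assumes "openin flow U" "p \<in> U"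
  obtains F where "finite F" "F \<subseteq> fms (elems C)" "agree F p \<subseteq> U"
proof -
  have "generate_topology_on ((\<lambda>\<phi>. {p \<in> types C. \<phi> \<in> p}) ` fms (elems C)) U"
    using assms(1) unfolding type_space_def by (rule openin_topology_generated_by)
  then have "\<exists>F. finite F \<and> F \<subseteq> fms (elems C) \<and> agree F p \<subseteq> U" using assms(2)
  proof (induction U rule: generate_topology_on.induct)
    case (Int a b)
    then obtain F G where "finite F" "F \<subseteq> fms (elems C)" "agree F p \<subseteq> a"
      "finite G" "G \<subseteq> fms (elems C)" "agree G p \<subseteq> b" by auto
    then show ?case by (intro exI[of _ "F \<union> G"]) (auto simp: agree_def)
  next
    case (UN K)
    then obtain U where "U \<in> K" "p \<in> U" by blast
    from UN.IH[OF this] obtain F where "finite F" "F \<subseteq> fms (elems C)" "agree F p \<subseteq> U"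
      by (elim exE conjE)
    then show ?case using \<open>U \<in> K\<close> by (intro exI[of _ F]) auto
  next
    case (Basis U)
    then obtain \<phi> where "\<phi> \<in> fms (elems C)" "U = {p \<in> types C. \<phi> \<in> p}" by blast
    then show ?case using Basis by (intro exI[of _ "{\<phi>}"]) (auto simp: agree_def)
  qed simp
  then show ?thesis using that by blast
qed

abbreviation "maps \<equiv> product_topology (\<lambda>_. flow) (types C)"

definition agree_on where
  "agree_on Q F \<eta> = {\<zeta> \<in> types C \<rightarrow>\<^sub>E types C. \<forall>p\<in>Q. \<forall>\<phi>\<in>F. \<phi> \<in> \<zeta> p \<longleftrightarrow> \<phi> \<in> \<eta> p}"

lemma openin_agree_on:
  assumes \<eta>: "\<eta> \<in> types C \<rightarrow>\<^sub>E types C"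
    and "finite Q" "Q \<subseteq> types C" "finite F" "F \<subseteq> fms (elems C)"
  shows "openin maps (agree_on Q F \<eta>)"
proof -
  have "openin maps (PiE (types C) (\<lambda>p. if p \<in> Q then agree F (\<eta> p) else types C))"
  proof (rule openin_PiE_gen[THEN iffD2], intro disjI2 conjI ballI)
    show "finite {p \<in> types C. (if p \<in> Q then agree F (\<eta> p) else types C) \<noteq> topspace flow}"
      by (rule finite_subset[OF _ assms(2)]) (auto split: if_splits)
    fix p assume p: "p \<in> types C"
    then have "\<eta> p \<in> types C" using \<eta> by auto
    then show "openin flow (if p \<in> Q then agree F (\<eta> p) else types C)"
      using openin_agree[of "\<eta> p" F] assms openin_topspace[of flow] by simp
  qed
  moreover have "PiE (types C) (\<lambda>p. if p \<in> Q then agree F (\<eta> p) else types C) = agree_on Q F \<eta>"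
    using assms(3) by (auto simp: agree_on_def agree_def PiE_iff extensional_def split: if_splits)
  ultimately show ?thesis by simp
qed

lemma openin_maps_contains_agree_on:
  assumes U: "openin maps U" "\<eta> \<in> U"
  obtains Q F where "finite Q" "Q \<subseteq> types C" "finite F" "F \<subseteq> fms (elems C)" "agree_on Q F \<eta> \<subseteq> U"
proof -
  obtain W where W: "finite {p \<in> types C. W p \<noteq> topspace flow}" "\<forall>p\<in>types C. openin flow (W p)"
    "\<eta> \<in> PiE (types C) W" "PiE (types C) W \<subseteq> U"
    using bspec[OF openin_product_topology_alt[THEN iffD1, OF U(1)] U(2)] by (elim exE conjE)
  define Q where "Q = {p \<in> types C. W p \<noteq> topspace flow}"
  have "\<exists>F. finite F \<and> F \<subseteq> fms (elems C) \<and> agree F (\<eta> p) \<subseteq> W p" if "p \<in> types C" for p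
  proof -
    have "openin flow (W p)" using W(2) that by (rule bspec)
    moreover have "\<eta> p \<in> W p" using W(3) that by (rule PiE_mem)
    ultimately show ?thesis by (rule openin_flow_contains_agree) (intro exI conjI)
  qed
  then obtain F where F: "\<And>p. p \<in> types C \<Longrightarrow> finite (F p) \<and> F p \<subseteq> fms (elems C) \<and> agree (F p) (\<eta> p) \<subseteq> W p"
    by metis
  show ?thesis
  proof
    show Q: "finite Q" "Q \<subseteq> types C" using W(1) by (auto simp: Q_def)
    show "finite (\<Union>p\<in>Q. F p)" using F Q by blast
    show "(\<Union>p\<in>Q. F p) \<subseteq> fms (elems C)" using F Q by blast
    show "agree_on Q (\<Union>p\<in>Q. F p) \<eta> \<subseteq> U"
    proof
      fix \<zeta> assume \<zeta>: "\<zeta> \<in> agree_on Q (\<Union>p\<in>Q. F p) \<eta>"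
      have "\<zeta> p \<in> W p" if p: "p \<in> types C" for p
      proof (cases "p \<in> Q")
        case True
        then have "\<zeta> p \<in> agree (F p) (\<eta> p)" using \<zeta> p by (auto simp: agree_on_def agree_def)
        then show ?thesis using F[OF p] by blast
      next
        case False
        then show ?thesis using \<zeta> p by (auto simp: Q_def agree_on_def)
      qed
      then have "\<zeta> \<in> PiE (types C) W" using \<zeta> by (auto simp: agree_on_def PiE_iff)
      then show "\<zeta> \<in> U" using W(4) by blast
    qed
  qed
qed

section \<open>The Ellis semigroup as the set of limit maps\<close>

lemma Ellis_semigroup_eq: "maps closure_of moves = lim_maps C C"
proof (intro subset_antisym subsetI)
  fix \<eta> assume \<eta>: "\<eta> \<in> maps closure_of moves"
  then have \<eta>P: "\<eta> \<in> types C \<rightarrow>\<^sub>E types C" by (simp add: in_closure_of)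
  show "\<eta> \<in> lim_maps C C"
    unfolding lim_maps_def
  proof (intro CollectI conjI allI impI \<eta>P)
    fix Q F assume h: "finite Q" "Q \<subseteq> types C" "finite F" "F \<subseteq> fms (elems C)"
    have "\<eta> \<in> agree_on Q F \<eta>" using \<eta>P by (simp add: agree_on_def)
    then obtain \<gamma> where \<gamma>: "\<gamma> \<in> moves" "\<gamma> \<in> agree_on Q F \<eta>"
      using \<eta> openin_agree_on[OF \<eta>P h] unfolding in_closure_of by blast
    obtain k where "acts C C F k" "\<And>p \<phi>. p \<in> types C \<Longrightarrow> \<phi> \<in> F \<Longrightarrow> \<phi> \<in> \<gamma> p \<longleftrightarrow> par_act k \<phi> \<in> p"
      using moves_acts[OF \<gamma>(1) h(3,4)] by metis
    then show "\<exists>k. acts C C F k \<and> (\<forall>p\<in>Q. \<forall>\<phi>\<in>F. \<phi> \<in> \<eta> p \<longleftrightarrow> par_act k \<phi> \<in> p)"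
      using \<gamma>(2) h(2) by (intro exI[of _ k]) (simp add: agree_on_def subset_iff)
  qed
next
  fix \<eta> assume \<eta>: "\<eta> \<in> lim_maps C C"
  then have \<eta>P: "\<eta> \<in> types C \<rightarrow>\<^sub>E types C" by (simp add: lim_maps_def)
  have "\<exists>\<gamma>. \<gamma> \<in> moves \<and> \<gamma> \<in> U" if U: "openin maps U" "\<eta> \<in> U" for U
  proof -
    obtain Q F where h: "finite Q" "Q \<subseteq> types C" "finite F" "F \<subseteq> fms (elems C)" "agree_on Q F \<eta> \<subseteq> U"
      using openin_maps_contains_agree_on[OF U] .
    obtain k where k: "acts C C F k" "\<And>p \<phi>. p \<in> Q \<Longrightarrow> \<phi> \<in> F \<Longrightarrow> \<phi> \<in> \<eta> p \<longleftrightarrow> par_act k \<phi> \<in> p"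
      using lim_mapsE[OF \<eta> h(1-4)] by metis
    obtain \<gamma> where \<gamma>: "\<gamma> \<in> moves" "\<And>p \<phi>. p \<in> types C \<Longrightarrow> \<phi> \<in> F \<Longrightarrow> \<phi> \<in> \<gamma> p \<longleftrightarrow> par_act k \<phi> \<in> p"
      using acts_moves[OF k(1)] by metis
    have "\<gamma> \<in> types C \<rightarrow>\<^sub>E types C" using moves_lim[OF \<gamma>(1)] by (simp add: lim_maps_def)
    then have "\<gamma> \<in> agree_on Q F \<eta>" using \<gamma>(2) k(2) h(2) by (auto simp: agree_on_def)
    then show ?thesis using \<gamma>(1) h(5) by blast
  qed
  then show "\<eta> \<in> maps closure_of moves" using \<eta>P by (auto simp: in_closure_of)
qed

lemma Ellis_space_eq: "Ellis_space flow moves = subtopology maps (lim_maps C C)"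
  by (simp add: Ellis_space_def Ellis_semigroup_eq)

lemma lim_maps_PiE: "\<eta> \<in> lim_maps C C \<Longrightarrow> \<eta> \<in> types C \<rightarrow>\<^sub>E types C"
  by (simp add: lim_maps_def)

lemma Ellis_semigroup_lim: "Ellis_semigroup flow moves = lim_maps C C"
  using lim_maps_PiE by (auto simp: Ellis_semigroup_def Ellis_space_eq)

text \<open>Eventual membership in the semigroup turns convergence in the subspace into convergence
  in the product, where the sets \<open>agree_on Q F \<eta>\<close> form a neighbourhood
  base.\<close>

lemma limitin_Ellis_iff:
  assumes "\<eta> \<in> lim_maps C C" "eventually (\<lambda>x. f x \<in> lim_maps C C) \<F>"
  shows "limitin (Ellis_space flow moves) f \<eta> \<F> \<longleftrightarrow>
    (\<forall>Q F. finite Q \<longrightarrow> Q \<subseteq> types C \<longrightarrow> finite F \<longrightarrow> F \<subseteq> fms (elems C) \<longrightarrow>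
       eventually (\<lambda>x. f x \<in> agree_on Q F \<eta>) \<F>)" (is "?l \<longleftrightarrow> ?r")
proof -
  have \<eta>P: "\<eta> \<in> types C \<rightarrow>\<^sub>E types C" by (rule lim_maps_PiE[OF assms(1)])
  have "?l \<longleftrightarrow> (\<forall>U. openin maps U \<longrightarrow> \<eta> \<in> U \<longrightarrow> eventually (\<lambda>x. f x \<in> U) \<F>)"
    unfolding Ellis_space_eq limitin_subtopology using assms \<eta>P by (auto simp: limitin_def)
  also have "\<dots> \<longleftrightarrow> ?r"
  proof (intro iffI allI impI)
    fix Q F
    assume U: "\<forall>U. openin maps U \<longrightarrow> \<eta> \<in> U \<longrightarrow> eventually (\<lambda>x. f x \<in> U) \<F>"
      and h: "finite Q" "Q \<subseteq> types C" "finite F" "F \<subseteq> fms (elems C)"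
    have "\<eta> \<in> agree_on Q F \<eta>" using \<eta>P by (simp add: agree_on_def)
    then show "eventually (\<lambda>x. f x \<in> agree_on Q F \<eta>) \<F>"
      using U openin_agree_on[OF \<eta>P h] by blast
  next
    fix U assume r: ?r and U: "openin maps U" "\<eta> \<in> U"
    obtain Q F where h: "finite Q" "Q \<subseteq> types C" "finite F" "F \<subseteq> fms (elems C)" "agree_on Q F \<eta> \<subseteq> U"
      using openin_maps_contains_agree_on[OF U] .
    have "eventually (\<lambda>x. f x \<in> agree_on Q F \<eta>) \<F>" using r h by simp
    then show "eventually (\<lambda>x. f x \<in> U) \<F>"
      by (rule eventually_mono) (use h(5) in blast)
  qed
  finally show ?thesis .
qed

end

lemma homeomorphic_map_iff_openin_image:
  assumes "bij_betw h (topspace X) (topspace Y)"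
    and "\<And>U. U \<subseteq> topspace X \<Longrightarrow> openin Y (h ` U) \<longleftrightarrow> openin X U"
  shows "homeomorphic_map X Y h"
proof (rule bijective_open_imp_homeomorphic_map)
  show im: "h ` topspace X = topspace Y" and inj: "inj_on h (topspace X)"
    using assms(1) by (auto simp: bij_betw_def)
  show "open_map X Y h"
    unfolding open_map_def using assms(2)[OF openin_subset] by simp
  show "continuous_map X Y h"
    unfolding continuous_map_alt
  proof (intro conjI allI impI)
    show "h \<in> topspace X \<rightarrow> topspace Y" using im by auto
    fix V assume V: "openin Y V"
    have "V \<subseteq> h ` topspace X" using im openin_subset[OF V] by simp
    then have "h ` (h -` V \<inter> topspace X) = V" by blast
    then show "openin X (h -` V \<inter> topspace X)"
      using assms(2)[of "h -` V \<inter> topspace X"] V by simp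
  qed
qed

context types_over
begin

text \<open>\<open>acts\<close> gives no control over the domain of \<open>k\<close>; the extension
  property supplies a map on a prescribed finite \<open>D\<close> with the same effect on
  \<open>F\<close>.\<close>

lemma acts_extend:
  assumes "acts M N F k" "hom_ext L M N" "finite D" "D \<subseteq> elems M"
  obtains k' where "pelem L M N D k'" "\<And>\<phi>. \<phi> \<in> F \<Longrightarrow> par_act k' \<phi> = par_act k \<phi>"
proof -
  obtain A where A: "finite A" "pelem L M N A k" "F \<subseteq> fms A" using assms(1) by (auto simp: acts_def)
  obtain k' where k': "\<forall>y\<in>A. k' y = k y" "pelem L M N (A \<union> D) k'"
    using hom_ext_finite[OF assms(2-4) A(1,2)] by (elim exE conjE)
  show ?thesis
  proof
    show "pelem L M N D k'" using pelem_mono[OF k'(2)] by simp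
    show "par_act k' \<phi> = par_act k \<phi>" if "\<phi> \<in> F" for \<phi>
      by (rule par_act_cong[OF subsetD[OF A(3) that]]) (use k'(1) in auto)
  qed
qed

end

context homogeneous_types
begin

text \<open>For \<open>\<mu> \<in> I\<close> the products \<open>\<theta> \<mu>\<close> form a left
  ideal inside \<open>I\<close>, which by minimality is all of \<open>I\<close>.\<close>

lemma min_idem_of_ideal_idempotent:
  assumes "ideal_idempotent flow moves I u"
  shows "min_idem C I u"
proof -
  have I: "minimal_left_ideal flow moves I" "u \<in> I" "compose (types C) u u = u"
    using assms by (auto simp: ideal_idempotent_def)
  then have sub: "I \<subseteq> lim_maps C C"
    and left: "\<And>\<eta> \<mu>. \<eta> \<in> lim_maps C C \<Longrightarrow> \<mu> \<in> I \<Longrightarrow> compose (types C) \<eta> \<mu> \<in> I"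
    by (auto simp: minimal_left_ideal_def left_ideal_def Ellis_semigroup_lim)
  have "\<exists>\<theta>\<in>lim_maps C C. compose (types C) \<theta> \<mu> = \<nu>" if \<mu>: "\<mu> \<in> I" and \<nu>: "\<nu> \<in> I" for \<mu> \<nu>
  proof -
    let ?J = "(\<lambda>\<theta>. compose (types C) \<theta> \<mu>) ` lim_maps C C"
    have \<mu>E: "\<mu> \<in> lim_maps C C" using sub \<mu> by blast
    have "left_ideal flow moves ?J"
      unfolding left_ideal_def Ellis_semigroup_lim topspace_flow
    proof (intro conjI ballI)
      show "?J \<noteq> {}" using \<mu>E by blast
      show "?J \<subseteq> lim_maps C C" using lim_maps_comp[OF \<mu>E] by blast
      fix \<eta> \<nu> assume \<eta>: "\<eta> \<in> lim_maps C C" and "\<nu> \<in> ?J"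
      then obtain \<theta> where \<theta>: "\<theta> \<in> lim_maps C C" "\<nu> = compose (types C) \<theta> \<mu>" by blast
      have "compose (types C) \<eta> \<nu> = compose (types C) (compose (types C) \<eta> \<theta>) \<mu>"
        unfolding \<theta>(2) by (rule compose_assoc) (rule lim_maps_Pi[OF \<mu>E])
      then show "compose (types C) \<eta> \<nu> \<in> ?J" using lim_maps_comp[OF \<theta>(1) \<eta>] by blast
    qed
    moreover have "?J \<subseteq> I" using left \<mu> by blast
    ultimately have "?J = I" using I(1) by (auto simp: minimal_left_ideal_def)
    then show ?thesis using \<nu> by blast
  qed
  then show ?thesis unfolding min_idem_def using I sub left by blast
qed

lemma carrier_Ellis_group: "min_idem C I u \<Longrightarrow> carrier (Ellis_group flow I u) = idem_group C u"
  by (simp add: Ellis_group_def idem_group_eq)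

text \<open>Finite approximations suffice for a limit of pairs: the sets \<open>Z (Q, F)\<close> of
  pairs that are correct for the types in \<open>Q\<close> and the formulas in \<open>F\<close> are
  directed downwards, and the filter they generate has the two required limits.\<close>

lemma circ_op_iff:
  assumes \<eta>: "\<eta> \<in> lim_maps C C" and \<zeta>: "\<zeta> \<in> lim_maps C C" and A: "A \<subseteq> lim_maps C C"
  shows "\<zeta> \<in> circ_op flow moves \<eta> A \<longleftrightarrow>
    (\<forall>Q F. finite Q \<longrightarrow> Q \<subseteq> types C \<longrightarrow> finite F \<longrightarrow> F \<subseteq> fms (elems C) \<longrightarrow>
       (\<exists>\<gamma>\<in>moves. \<exists>\<alpha>\<in>A. \<gamma> \<in> agree_on Q F \<eta> \<and> compose (types C) \<gamma> \<alpha> \<in> agree_on Q F \<zeta>))"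
    (is "?l \<longleftrightarrow> ?r")
proof -
  have in_lim: "\<gamma> \<in> lim_maps C C \<and> compose (types C) \<gamma> \<alpha> \<in> lim_maps C C"
    if "\<gamma> \<in> moves" "\<alpha> \<in> A" for \<gamma> \<alpha>
    using moves_lim[OF that(1)] lim_maps_comp[of \<alpha> C C \<gamma> C] A that(2) by blast
  have ev: "eventually (\<lambda>x. (\<lambda>(\<gamma>, \<alpha>). \<gamma>) x \<in> lim_maps C C) \<F>"
    "eventually (\<lambda>x. (\<lambda>(\<gamma>, \<alpha>). compose (types C) \<gamma> \<alpha>) x \<in> lim_maps C C) \<F>"
    if "\<forall>\<^sub>F (\<gamma>, \<alpha>) in \<F>. \<gamma> \<in> moves \<and> \<alpha> \<in> A" for \<F>
    by (rule eventually_mono[OF that]; use in_lim in auto)+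
  show ?thesis
  proof
    assume ?l
    then obtain \<F> where \<F>: "\<F> \<noteq> bot" "\<forall>\<^sub>F (\<gamma>, \<alpha>) in \<F>. \<gamma> \<in> moves \<and> \<alpha> \<in> A"
      "limitin (Ellis_space flow moves) (\<lambda>(\<gamma>, \<alpha>). \<gamma>) \<eta> \<F>"
      "limitin (Ellis_space flow moves) (\<lambda>(\<gamma>, \<alpha>). compose (types C) \<gamma> \<alpha>) \<zeta> \<F>"
      unfolding circ_op_def topspace_flow by blast
    note lim = \<F>(3)[unfolded limitin_Ellis_iff[OF \<eta> ev(1)[OF \<F>(2)]]]
      \<F>(4)[unfolded limitin_Ellis_iff[OF \<zeta> ev(2)[OF \<F>(2)]]]
    show ?r
    proof (intro allI impI)
      fix Q F assume h: "finite Q" "Q \<subseteq> types C" "finite F" "F \<subseteq> fms (elems C)"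
      have "\<forall>\<^sub>F (\<gamma>, \<alpha>) in \<F>. \<gamma> \<in> moves \<and> \<alpha> \<in> A \<and>
          \<gamma> \<in> agree_on Q F \<eta> \<and> compose (types C) \<gamma> \<alpha> \<in> agree_on Q F \<zeta>"
        using \<F>(2) lim(1)[rule_format, OF h] lim(2)[rule_format, OF h]
        by eventually_elim auto
      from eventually_happens'[OF \<F>(1) this]
      show "\<exists>\<gamma>\<in>moves. \<exists>\<alpha>\<in>A. \<gamma> \<in> agree_on Q F \<eta> \<and> compose (types C) \<gamma> \<alpha> \<in> agree_on Q F \<zeta>"
        by auto
    qed
  next
    assume r: ?r
    define D where "D = {(Q, F). finite Q \<and> Q \<subseteq> types C \<and> finite F \<and> F \<subseteq> fms (elems C)}"
    define Z where "Z = (\<lambda>(Q, F). {(\<gamma>, \<alpha>). \<gamma> \<in> moves \<and> \<alpha> \<in> A \<and>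
        \<gamma> \<in> agree_on Q F \<eta> \<and> compose (types C) \<gamma> \<alpha> \<in> agree_on Q F \<zeta>})"
    define \<F> where "\<F> = (INF d\<in>D. principal (Z d))"
    have "({}, {}) \<in> D" by (simp add: D_def)
    have ev\<F>: "eventually P \<F> \<longleftrightarrow> (\<exists>d\<in>D. \<forall>x\<in>Z d. P x)" for P
      unfolding \<F>_def eventually_principal[symmetric]
    proof (rule eventually_INF_base)
      show "D \<noteq> {}" using \<open>({}, {}) \<in> D\<close> by blast
      fix d e assume "d \<in> D" "e \<in> D"
      then have "(fst d \<union> fst e, snd d \<union> snd e) \<in> D" by (auto simp: D_def)
      moreover have "Z (fst d \<union> fst e, snd d \<union> snd e) \<subseteq> Z d \<inter> Z e"
        by (cases d; cases e) (auto simp: Z_def agree_on_def)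
      ultimately show "\<exists>x\<in>D. principal (Z x) \<le> inf (principal (Z d)) (principal (Z e))"
        by (intro bexI[of _ "(fst d \<union> fst e, snd d \<union> snd e)"]) simp_all
    qed
    have "\<F> \<noteq> bot"
    proof
      assume "\<F> = bot"
      then have "eventually (\<lambda>_. False) \<F>" by simp
      then obtain d where "d \<in> D" "Z d = {}" unfolding ev\<F> by blast
      then obtain Q F where "(Q, F) \<in> D" "Z (Q, F) = {}" by (cases d) simp
      then have h: "finite Q" "Q \<subseteq> types C" "finite F" "F \<subseteq> fms (elems C)" by (simp_all add: D_def)
      from r[rule_format, OF h] obtain \<gamma> \<alpha> where "\<gamma> \<in> moves" "\<alpha> \<in> A" "\<gamma> \<in> agree_on Q F \<eta>"
        "compose (types C) \<gamma> \<alpha> \<in> agree_on Q F \<zeta>"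
        by (elim bexE conjE)
      then have "(\<gamma>, \<alpha>) \<in> Z (Q, F)" by (simp add: Z_def)
      then show False using \<open>Z (Q, F) = {}\<close> by blast
    qed
    moreover have evA: "\<forall>\<^sub>F (\<gamma>, \<alpha>) in \<F>. \<gamma> \<in> moves \<and> \<alpha> \<in> A"
      unfolding ev\<F> by (rule bexI[OF _ \<open>({}, {}) \<in> D\<close>]) (auto simp: Z_def)
    moreover have "limitin (Ellis_space flow moves) (\<lambda>(\<gamma>, \<alpha>). \<gamma>) \<eta> \<F>"
      unfolding limitin_Ellis_iff[OF \<eta> ev(1)[OF evA]]
    proof (intro allI impI)
      fix Q F assume "finite Q" "Q \<subseteq> types C" "finite F" "F \<subseteq> fms (elems C)"
      then have "(Q, F) \<in> D" by (simp add: D_def)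
      then show "\<forall>\<^sub>F x in \<F>. (\<lambda>(\<gamma>, \<alpha>). \<gamma>) x \<in> agree_on Q F \<eta>"
        unfolding ev\<F> by (rule bexI[rotated]) (auto simp: Z_def)
    qed
    moreover have "limitin (Ellis_space flow moves) (\<lambda>(\<gamma>, \<alpha>). compose (types C) \<gamma> \<alpha>) \<zeta> \<F>"
      unfolding limitin_Ellis_iff[OF \<zeta> ev(2)[OF evA]]
    proof (intro allI impI)
      fix Q F assume "finite Q" "Q \<subseteq> types C" "finite F" "F \<subseteq> fms (elems C)"
      then have "(Q, F) \<in> D" by (simp add: D_def)
      then show "\<forall>\<^sub>F x in \<F>. (\<lambda>(\<gamma>, \<alpha>). compose (types C) \<gamma> \<alpha>) x \<in> agree_on Q F \<zeta>"
        unfolding ev\<F> by (rule bexI[rotated]) (auto simp: Z_def)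
    qed
    ultimately show ?l unfolding circ_op_def topspace_flow by blast
  qed
qed

text \<open>An automorphism and a finite map with the same pullback on \<open>F\<close> are
  interchangeable at every type, thus at \<open>p\<close> and at \<open>\<alpha> p\<close>
  simultaneously.\<close>

lemma tau_closure_eq:
  assumes u: "min_idem C I u" and A: "A \<subseteq> idem_group C u"
  shows "tau_closure flow moves I u A = tau_cl C u A"
proof -
  have AE: "A \<subseteq> lim_maps C C" using A by (auto simp: idem_group_def)
  have uE: "u \<in> lim_maps C C" by (rule min_idem_in[OF u])
  have step: "(\<exists>\<gamma>\<in>moves. \<exists>\<alpha>\<in>A. \<gamma> \<in> agree_on Q F u \<and> compose (types C) \<gamma> \<alpha> \<in> agree_on Q F \<zeta>) \<longleftrightarrow>
      (\<exists>k. \<exists>\<alpha>\<in>A. acts C C F k \<and> (\<forall>p\<in>Q. \<forall>\<phi>\<in>F.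
          (\<phi> \<in> u p \<longleftrightarrow> par_act k \<phi> \<in> p) \<and> (\<phi> \<in> \<zeta> p \<longleftrightarrow> par_act k \<phi> \<in> \<alpha> p)))"
    (is "?l \<longleftrightarrow> ?r")
    if h: "finite Q" "Q \<subseteq> types C" "finite F" "F \<subseteq> fms (elems C)" for Q F \<zeta>
  proof
    assume ?l
    then obtain \<gamma> \<alpha> where \<gamma>: "\<gamma> \<in> moves" "\<alpha> \<in> A" "\<gamma> \<in> agree_on Q F u"
      "compose (types C) \<gamma> \<alpha> \<in> agree_on Q F \<zeta>" by blast
    obtain k where k: "acts C C F k" "\<And>p \<phi>. p \<in> types C \<Longrightarrow> \<phi> \<in> F \<Longrightarrow> \<phi> \<in> \<gamma> p \<longleftrightarrow> par_act k \<phi> \<in> p"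
      using moves_acts[OF \<gamma>(1) h(3,4)] by metis
    have "(\<phi> \<in> u p \<longleftrightarrow> par_act k \<phi> \<in> p) \<and> (\<phi> \<in> \<zeta> p \<longleftrightarrow> par_act k \<phi> \<in> \<alpha> p)" if "p \<in> Q" "\<phi> \<in> F" for p \<phi>
    proof -
      have p: "p \<in> types C" using h(2) that(1) by blast
      then have \<alpha>p: "\<alpha> p \<in> types C" using lim_maps_in subsetD[OF AE \<gamma>(2)] by blast
      have "\<phi> \<in> \<gamma> p \<longleftrightarrow> \<phi> \<in> u p" "\<phi> \<in> compose (types C) \<gamma> \<alpha> p \<longleftrightarrow> \<phi> \<in> \<zeta> p"
        using \<gamma>(3,4) that by (simp_all add: agree_on_def)
      then show ?thesis
        using k(2)[OF p that(2)] k(2)[OF \<alpha>p that(2)] p by (simp add: compose_eq)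
    qed
    then show ?r using k(1) \<gamma>(2) by blast
  next
    assume ?r
    then obtain k \<alpha> where k: "\<alpha> \<in> A" "acts C C F k" "\<forall>p\<in>Q. \<forall>\<phi>\<in>F.
          (\<phi> \<in> u p \<longleftrightarrow> par_act k \<phi> \<in> p) \<and> (\<phi> \<in> \<zeta> p \<longleftrightarrow> par_act k \<phi> \<in> \<alpha> p)"
      by (elim exE bexE conjE)
    obtain \<gamma> where \<gamma>: "\<gamma> \<in> moves" "\<And>p \<phi>. p \<in> types C \<Longrightarrow> \<phi> \<in> F \<Longrightarrow> \<phi> \<in> \<gamma> p \<longleftrightarrow> par_act k \<phi> \<in> p"
      using acts_moves[OF k(2)] by metis
    have \<alpha>E: "\<alpha> \<in> lim_maps C C" using AE k(1) by blast
    have "\<gamma> \<in> agree_on Q F u"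
      using lim_maps_PiE[OF moves_lim[OF \<gamma>(1)]] k(3) \<gamma>(2) h(2) by (simp add: agree_on_def subset_iff)
    moreover have "compose (types C) \<gamma> \<alpha> \<in> agree_on Q F \<zeta>"
      using lim_maps_PiE[OF lim_maps_comp[OF \<alpha>E moves_lim[OF \<gamma>(1)]]] k(3) \<gamma>(2) h(2)
        lim_maps_in[OF \<alpha>E] by (simp add: agree_on_def subset_iff compose_eq)
    ultimately show ?l using \<gamma>(1) k(1) by blast
  qed
  show ?thesis
  proof (rule Set.set_eqI)
    fix \<zeta>
    show "\<zeta> \<in> tau_closure flow moves I u A \<longleftrightarrow> \<zeta> \<in> tau_cl C u A"
    proof (cases "\<zeta> \<in> idem_group C u")
      case True
      then have \<zeta>E: "\<zeta> \<in> lim_maps C C" by (simp add: idem_group_def)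
      show ?thesis
        unfolding tau_closure_def carrier_Ellis_group[OF u] Int_iff circ_op_iff[OF uE \<zeta>E AE]
          tau_cl_def mem_Collect_eq
        by (simp only: True simp_thms step cong: imp_cong)
    qed (simp add: tau_closure_def carrier_Ellis_group[OF u] tau_cl_def)
  qed
qed

section \<open>The closure operator and its topology\<close>

lemma tau_cl_subset: "tau_cl C u A \<subseteq> idem_group C u"
  by (auto simp: tau_cl_def)

lemma tau_cl_mono:
  assumes "A \<subseteq> A'" shows "tau_cl C u A \<subseteq> tau_cl C u A'"
proof
  fix \<zeta> assume \<zeta>: "\<zeta> \<in> tau_cl C u A"
  then have "\<zeta> \<in> idem_group C u" by (simp add: tau_cl_def)
  then show "\<zeta> \<in> tau_cl C u A'"
    unfolding tau_cl_def mem_Collect_eq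
  proof (intro conjI allI impI)
    fix Q F assume "finite Q" "Q \<subseteq> types C" "finite F" "F \<subseteq> fms (elems C)"
    from tau_clD[OF \<zeta> this]
    show "\<exists>k. \<exists>\<alpha>\<in>A'. acts C C F k \<and> (\<forall>p\<in>Q. \<forall>\<phi>\<in>F.
        (\<phi> \<in> u p \<longleftrightarrow> par_act k \<phi> \<in> p) \<and> (\<phi> \<in> \<zeta> p \<longleftrightarrow> par_act k \<phi> \<in> \<alpha> p))"
      using assms by (elim exE bexE) blast
  qed
qed

text \<open>Even the approximation for empty \<open>Q\<close> and \<open>F\<close> demands a member
  \<open>\<alpha>\<close>.\<close>

lemma tau_cl_empty: "tau_cl C u {} = {}"
  using tau_clD[of _ C u "{}" "{}" "{}"] by blast

lemma tau_cl_extensive: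
  assumes u: "min_idem C I u" and "A \<subseteq> idem_group C u"
  shows "A \<subseteq> tau_cl C u A"
proof
  fix \<zeta> assume \<zeta>: "\<zeta> \<in> A"
  then have G: "\<zeta> \<in> idem_group C u" using assms by blast
  then have E: "\<zeta> \<in> lim_maps C C" by (simp add: idem_group_def)
  show "\<zeta> \<in> tau_cl C u A"
    unfolding tau_cl_def
  proof (intro CollectI conjI allI impI G)
    fix Q F assume h: "finite Q" "Q \<subseteq> types C" "finite F" "F \<subseteq> fms (elems C)"
    \<comment> \<open>Approximating \<open>u\<close> also at \<open>\<zeta> p\<close>, which
      \<open>u\<close> fixes, makes \<open>\<alpha> = \<zeta>\<close> a witness.\<close>
    have h': "finite (Q \<union> \<zeta> ` Q)" "Q \<union> \<zeta> ` Q \<subseteq> types C" using h lim_maps_in[OF E] by auto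
    obtain k where k: "acts C C F k"
      "\<And>p \<phi>. p \<in> Q \<union> \<zeta> ` Q \<Longrightarrow> \<phi> \<in> F \<Longrightarrow> \<phi> \<in> u p \<longleftrightarrow> par_act k \<phi> \<in> p"
      using lim_mapsE[OF min_idem_in[OF u] h' h(3,4)] by metis
    have "(\<phi> \<in> u p \<longleftrightarrow> par_act k \<phi> \<in> p) \<and> (\<phi> \<in> \<zeta> p \<longleftrightarrow> par_act k \<phi> \<in> \<zeta> p)" if "p \<in> Q" "\<phi> \<in> F" for p \<phi>
    proof -
      have "u (\<zeta> p) = \<zeta> p" using G that(1) h(2) by (auto simp: idem_group_def)
      then show ?thesis using k(2)[of p \<phi>] k(2)[of "\<zeta> p" \<phi>] that by simp
    qed
    then show "\<exists>k. \<exists>\<alpha>\<in>A. acts C C F k \<and> (\<forall>p\<in>Q. \<forall>\<phi>\<in>F.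
          (\<phi> \<in> u p \<longleftrightarrow> par_act k \<phi> \<in> p) \<and> (\<phi> \<in> \<zeta> p \<longleftrightarrow> par_act k \<phi> \<in> \<alpha> p))"
      using k(1) \<zeta> by blast
  qed
qed

text \<open>Failures for \<open>A\<close> at \<open>(Q, F)\<close> and for \<open>A'\<close> at
  \<open>(Q', F')\<close> combine: a witness at the unions would lie in one of the two sets and
  contradict the failure there.\<close>

lemma tau_cl_Un: "tau_cl C u (A \<union> A') = tau_cl C u A \<union> tau_cl C u A'"
proof
  show "tau_cl C u A \<union> tau_cl C u A' \<subseteq> tau_cl C u (A \<union> A')"
    by (intro Un_least tau_cl_mono) auto
  show "tau_cl C u (A \<union> A') \<subseteq> tau_cl C u A \<union> tau_cl C u A'"
  proof
    fix \<zeta> assume \<zeta>: "\<zeta> \<in> tau_cl C u (A \<union> A')"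
    show "\<zeta> \<in> tau_cl C u A \<union> tau_cl C u A'"
    proof (rule ccontr)
      define good where "good = (\<lambda>Q F k \<alpha>. acts C C F k \<and> (\<forall>p\<in>Q. \<forall>\<phi>\<in>F.
        (\<phi> \<in> u p \<longleftrightarrow> par_act k \<phi> \<in> p) \<and> (\<phi> \<in> \<zeta> p \<longleftrightarrow> par_act k \<phi> \<in> \<alpha> p)))"
      have good_mono: "good Q F k \<alpha>" if "good (Q \<union> Q') (F \<union> F') k \<alpha>" for Q Q' F F' k \<alpha>
        using that unfolding good_def acts_def by blast
      have tau: "\<zeta> \<in> tau_cl C u D \<longleftrightarrow> (\<forall>Q F. finite Q \<longrightarrow> Q \<subseteq> types C \<longrightarrow> finite F \<longrightarrow>
          F \<subseteq> fms (elems C) \<longrightarrow> (\<exists>k. \<exists>\<alpha>\<in>D. good Q F k \<alpha>))" for D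
        using subsetD[OF tau_cl_subset \<zeta>] by (simp add: tau_cl_def good_def)
      assume "\<not> ?thesis"
      then have "\<zeta> \<notin> tau_cl C u A" "\<zeta> \<notin> tau_cl C u A'" by auto
      then obtain Q F Q' F' where
        h: "finite Q" "Q \<subseteq> types C" "finite F" "F \<subseteq> fms (elems C)" "\<not> (\<exists>k. \<exists>\<alpha>\<in>A. good Q F k \<alpha>)" and
        h': "finite Q'" "Q' \<subseteq> types C" "finite F'" "F' \<subseteq> fms (elems C)" "\<not> (\<exists>k. \<exists>\<alpha>\<in>A'. good Q' F' k \<alpha>)"
        unfolding tau by meson
      have "\<exists>k. \<exists>\<alpha>\<in>A \<union> A'. good (Q \<union> Q') (F \<union> F') k \<alpha>"
        using \<zeta>[unfolded tau, rule_format, of "Q \<union> Q'" "F \<union> F'"] h h' by simp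
      then obtain k \<alpha> where "\<alpha> \<in> A \<union> A'" "good (Q \<union> Q') (F \<union> F') k \<alpha>" by blast
      then show False
        using h(5) h'(5) good_mono[of Q Q' F F' k \<alpha>] good_mono[of Q' Q F' F k \<alpha>]
        by (auto simp: Un_commute)
    qed
  qed
qed

text \<open>The fixed sets of a monotone extensive operator are closed under intersections, and
  additivity adds finite unions. So \<open>istopology\<close> holds, and the definition by
  \<open>topology\<close> can be unfolded.\<close>

lemma openin_tau:
  assumes u: "min_idem C I u"
  shows "openin (tau_topology flow moves I u) U \<longleftrightarrow>
    U \<subseteq> idem_group C u \<and> tau_cl C u (idem_group C u - U) = idem_group C u - U"
proof -
  let ?G = "idem_group C u"
  define P where "P = (\<lambda>U. U \<subseteq> ?G \<and> tau_cl C u (?G - U) = ?G - U)"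
  have "istopology P"
    unfolding istopology_def
  proof (intro conjI allI impI)
    fix U V assume UV: "P U" "P V"
    have "?G - U \<inter> V = (?G - U) \<union> (?G - V)" by blast
    then show "P (U \<inter> V)" using UV by (auto simp: P_def tau_cl_Un)
  next
    fix K assume K: "\<forall>U\<in>K. P U"
    have "tau_cl C u (?G - \<Union>K) \<subseteq> ?G - \<Union>K"
    proof
      fix \<zeta> assume \<zeta>: "\<zeta> \<in> tau_cl C u (?G - \<Union>K)"
      have "\<zeta> \<notin> U" if "U \<in> K" for U
      proof -
        have "\<zeta> \<in> tau_cl C u (?G - U)" using tau_cl_mono[of "?G - \<Union>K" "?G - U"] that \<zeta> by blast
        then show ?thesis using K that by (auto simp: P_def)
      qed
      then show "\<zeta> \<in> ?G - \<Union>K" using subsetD[OF tau_cl_subset \<zeta>] by blast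
    qed
    then show "P (\<Union>K)"
      using K tau_cl_extensive[OF u, of "?G - \<Union>K"] unfolding P_def by blast
  qed
  moreover have "tau_topology flow moves I u = topology P"
    unfolding tau_topology_def P_def Let_def carrier_Ellis_group[OF u]
    by (simp add: tau_closure_eq[OF u] Diff_subset)
  ultimately show ?thesis by (simp add: topology_inverse' P_def)
qed

lemma topspace_tau:
  assumes u: "min_idem C I u"
  shows "topspace (tau_topology flow moves I u) = idem_group C u"
proof -
  have "openin (tau_topology flow moves I u) (idem_group C u)"
    unfolding openin_tau[OF u] by (simp add: tau_cl_empty)
  moreover have "topspace (tau_topology flow moves I u) \<subseteq> idem_group C u"
    using openin_topspace[of "tau_topology flow moves I u"] unfolding openin_tau[OF u] by blast
  ultimately show ?thesis using openin_subset by blast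
qed

end

section \<open>Bounding the Ellis group\<close>

context homogeneous_types
begin

text \<open>
  A limit of maps into \<open>B\<close> makes \<open>\<phi>\<close> behave on \<open>p\<close> as \<open>\<phi>'\<close> does on \<open>p'\<close>, and by minimality
  that limit can be undone on \<open>p\<close> and \<open>p'\<close>.
\<close>

lemma small_set_decides:
  assumes u: "min_idem C I u"
    and \<rho>: "\<And>A. finite A \<Longrightarrow> A \<subseteq> elems C \<Longrightarrow> \<exists>k. pelem L C C A k \<and> k ` A \<subseteq> B"
    and p: "p \<in> types C" "u p = p" and p': "p' \<in> types C" "u p' = p'"
    and c: "finite c" "\<phi> \<in> fms c" "\<phi>' \<in> fms c"
    and dec: "\<And>k. pelem L C C c k \<Longrightarrow> k ` c \<subseteq> B \<Longrightarrow> par_act k \<phi> \<in> p \<longleftrightarrow> par_act k \<phi>' \<in> p'"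
    and k: "pelem L C C c k"
  shows "par_act k \<phi> \<in> p \<longleftrightarrow> par_act k \<phi>' \<in> p'"
proof -
  obtain \<rho> where \<rho>: "\<And>A. finite A \<Longrightarrow> A \<subseteq> elems C \<Longrightarrow> pelem L C C A (\<rho> A) \<and> \<rho> A ` A \<subseteq> B"
    using \<rho> by metis
  have \<rho>1: "pelem L C C A (\<rho> A)" if "finite A" "A \<subseteq> elems C" for A using \<rho> that by blast
  obtain \<eta> where \<eta>: "\<eta> \<in> lim_maps C C" "cluster_map C C \<rho> \<eta>"
    by (rule lim_maps_cluster[OF self_ext dom_ne \<rho>1])
  obtain \<theta> where \<theta>: "\<theta> \<in> lim_maps C C" "\<And>p. p \<in> types C \<Longrightarrow> \<theta> (\<eta> (u p)) = u p"
    using min_idem_return[OF u \<eta>(1)] by blast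
  have \<theta>p: "\<theta> (\<eta> p) = p" "\<theta> (\<eta> p') = p'" using \<theta>(2)[OF p(1)] \<theta>(2)[OF p'(1)] p p' by simp_all
  let ?F = "{par_act k \<phi>, par_act k \<phi>'}"
  have kc: "k ` c \<subseteq> elems C" "finite (k ` c)" using pelem_ran[OF k] c(1) by auto
  have F: "?F \<subseteq> fms (k ` c)" "?F \<subseteq> fms (elems C)"
    using pelem_act[OF k] pelem_act_elems[OF k] c by auto
  have Q: "finite {\<eta> p, \<eta> p'}" "{\<eta> p, \<eta> p'} \<subseteq> types C" using lim_maps_in[OF \<eta>(1)] p p' by auto
  \<comment> \<open>A single map approximates \<open>\<theta>\<close> at both types, so the two
    formulas stay over the same parameters.\<close>
  obtain l0 where l0: "acts C C ?F l0"
    "\<And>q \<psi>. q \<in> {\<eta> p, \<eta> p'} \<Longrightarrow> \<psi> \<in> ?F \<Longrightarrow> \<psi> \<in> \<theta> q \<longleftrightarrow> par_act l0 \<psi> \<in> q"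
    using lim_mapsE[OF \<theta>(1) Q _ F(2)] by (metis finite.emptyI finite.insertI)
  \<comment> \<open>The domain is adjusted so that the final composite is elementary on all of
    \<open>c\<close>, as \<open>dec\<close> demands.\<close>
  obtain l where l: "pelem L C C (k ` c) l" "\<And>\<psi>. \<psi> \<in> ?F \<Longrightarrow> par_act l \<psi> = par_act l0 \<psi>"
    using acts_extend[OF l0(1) self_ext kc(2,1)] by metis
  have lkc: "l ` k ` c \<subseteq> elems C" "finite (l ` k ` c)" using pelem_ran[OF l(1)] c(1) by auto
  have lF: "par_act l ` ?F \<subseteq> fms (elems C)"
    using F(1) by (auto intro!: pelem_act_elems[OF l(1)])
  obtain A where A: "finite A" "A \<subseteq> elems C" "l ` k ` c \<subseteq> A"
    "\<And>q \<psi>. q \<in> {p, p'} \<Longrightarrow> \<psi> \<in> par_act l ` ?F \<Longrightarrow> \<psi> \<in> \<eta> q \<longleftrightarrow> par_act (\<rho> A) \<psi> \<in> q"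
    by (rule cluster_mapE[OF \<eta>(2), of "{p, p'}" "par_act l ` ?F" "l ` k ` c"])
       (use p p' lF lkc in auto)
  \<comment> \<open>\<open>l\<close> stands for \<open>\<theta>\<close> and \<open>\<rho> A\<close>
    for \<open>\<eta>\<close>; the latter lands in \<open>B\<close>, where the hypothesis
    \<open>dec\<close> applies.\<close>
  let ?m = "\<rho> A \<circ> (l \<circ> k)"
  have "pelem L C C c ?m"
    using pelem_comp[OF pelem_comp[OF k l(1)]] pelem_mono[OF \<rho>1[OF A(1,2)] A(3)]
    by (simp add: image_comp)
  moreover have "?m ` c \<subseteq> B" using A(3) \<rho>[OF A(1,2)] by (auto simp: image_subset_iff)
  ultimately have m: "par_act ?m \<phi> \<in> p \<longleftrightarrow> par_act ?m \<phi>' \<in> p'" by (rule dec)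
  have "par_act k \<phi> \<in> p \<longleftrightarrow> par_act k \<phi> \<in> \<theta> (\<eta> p)" by (simp add: \<theta>p)
  also have "\<dots> \<longleftrightarrow> par_act l (par_act k \<phi>) \<in> \<eta> p" using l0(2) l(2) by simp
  also have "\<dots> \<longleftrightarrow> par_act ?m \<phi> \<in> p" using A(4) by (simp add: par_act_comp comp_assoc)
  also note m
  also have "par_act ?m \<phi>' \<in> p' \<longleftrightarrow> par_act l (par_act k \<phi>') \<in> \<eta> p'"
    using A(4) by (simp add: par_act_comp comp_assoc)
  also have "\<dots> \<longleftrightarrow> par_act k \<phi>' \<in> \<theta> (\<eta> p')" using l0(2) l(2) by simp
  also have "\<dots> \<longleftrightarrow> par_act k \<phi>' \<in> p'" by (simp add: \<theta>p)
  finally show ?thesis .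
qed

text \<open>All placements of \<open>c\<close> in \<open>B\<close> that put \<open>\<phi>\<close>
  into \<open>p\<close>, each kept as its graph over \<open>c\<close>. Nothing about the variables
  survives, which makes the later count independent of them.\<close>

definition traces :: "('s \<times> 'm) set \<Rightarrow> ('s, 'f, 'r, 'i + 's \<times> 'm) fm set \<Rightarrow> ('s \<times> 'm) set \<Rightarrow>
    ('s, 'f, 'r, 'i + 's \<times> 'm) fm \<Rightarrow> (('s \<times> 'm) \<times> ('s \<times> 'm)) set set" where
  "traces B p c \<phi> = {(\<lambda>x. (x, k x)) ` c | k. pelem L C C c k \<and> k ` c \<subseteq> B \<and> par_act k \<phi> \<in> p}"

lemma traces_iff:
  assumes "pelem L C C c k" "k ` c \<subseteq> B" "\<phi> \<in> fms c"
  shows "par_act k \<phi> \<in> p \<longleftrightarrow> (\<lambda>x. (x, k x)) ` c \<in> traces B p c \<phi>"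
proof
  assume "(\<lambda>x. (x, k x)) ` c \<in> traces B p c \<phi>"
  then obtain l where l: "(\<lambda>x. (x, k x)) ` c = (\<lambda>x. (x, l x)) ` c" "par_act l \<phi> \<in> p"
    by (auto simp: traces_def)
  have "k x = l x" if "x \<in> c" for x
  proof -
    have "(x, k x) \<in> (\<lambda>x. (x, l x)) ` c" using that l(1) by blast
    then show ?thesis by auto
  qed
  then show "par_act k \<phi> \<in> p" using par_act_cong[OF assms(3), of k l] l(2) by simp
qed (use assms in \<open>auto simp: traces_def\<close>)

text \<open>If \<open>g\<close> and \<open>g'\<close> have equal records, a formula of
  \<open>g p\<close> shares its traces with some formula of some \<open>g' p'\<close>.
  \<open>small_set_decides\<close> extends this agreement from \<open>B\<close> to all placements,
  and \<open>g'\<close>, being a limit of placements, transfers it.\<close>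

lemma idem_group_injection:
  assumes u: "min_idem C I u" and B: "B \<subseteq> elems C"
    and \<rho>: "\<And>A. finite A \<Longrightarrow> A \<subseteq> elems C \<Longrightarrow> \<exists>k. pelem L C C A k \<and> k ` A \<subseteq> B"
  shows "\<exists>\<Phi>. inj_on \<Phi> (idem_group C u) \<and> \<Phi> ` idem_group C u \<subseteq> Pow (Pow B \<times> Pow (Pow (B \<times> B)))"
proof -
  define \<Phi> where "\<Phi> = (\<lambda>g. {(c, traces B p c \<phi>) | p c \<phi>. p \<in> types C \<and> u p = p \<and> finite c \<and>
    c \<subseteq> B \<and> \<phi> \<in> fms c \<and> \<phi> \<in> g p})"
  have half: "\<phi> \<in> g' p"
    if g': "g' \<in> idem_group C u" and eq: "\<Phi> g = \<Phi> g'" and p: "p \<in> types C" "u p = p"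
      and \<phi>: "\<phi> \<in> fms B" "\<phi> \<in> g p" for g g' p \<phi>
  proof -
    obtain c where c: "finite c" "c \<subseteq> B" "\<phi> \<in> fms c" using formulas_over_finite_params[OF \<phi>(1)] .
    have "(c, traces B p c \<phi>) \<in> \<Phi> g"
      unfolding \<Phi>_def mem_Collect_eq
      by (rule exI[of _ p], rule exI[of _ c], rule exI[of _ \<phi>]) (use p c \<phi>(2) in simp)
    then have "(c, traces B p c \<phi>) \<in> \<Phi> g'" using eq by simp
    \<comment> \<open>The matching record of \<open>g'\<close> may come from another type and
      another formula; only the parameters \<open>c\<close> and the traces agree.\<close>
    then obtain p' c' \<phi>' where "(c, traces B p c \<phi>) = (c', traces B p' c' \<phi>')"
      and p': "p' \<in> types C" "u p' = p'" and "\<phi>' \<in> fms c'" and "\<phi>' \<in> g' p'"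
      unfolding \<Phi>_def mem_Collect_eq by (elim exE conjE)
    then have \<phi>': "\<phi>' \<in> fms c" "\<phi>' \<in> g' p'" and tr: "traces B p c \<phi> = traces B p' c \<phi>'"
      unfolding prod.inject by metis+
    have same: "par_act k \<phi> \<in> p \<longleftrightarrow> par_act k \<phi>' \<in> p'" if "pelem L C C c k" for k
      by (rule small_set_decides[OF u \<rho> p p' c(1,3) \<phi>'(1) _ that])
         (simp_all add: traces_iff c(3) \<phi>'(1) tr)
    have g'E: "g' \<in> lim_maps C C" using g' by (simp add: idem_group_def)
    have F: "finite {\<phi>, \<phi>'}" "{\<phi>, \<phi>'} \<subseteq> fms (elems C)"
      using c(3) \<phi>'(1) subsetD[OF formulas_over_mono[OF subset_trans[OF c(2) B]]] by auto
    \<comment> \<open>One placement approximates \<open>g'\<close> at \<open>p\<close> and at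
      \<open>p'\<close>, so \<open>same\<close> carries \<open>\<phi>' \<in> g' p'\<close> over to
      \<open>\<phi> \<in> g' p\<close>.\<close>
    obtain k0 where k0: "acts C C {\<phi>, \<phi>'} k0"
      "\<And>q \<psi>. q \<in> {p, p'} \<Longrightarrow> \<psi> \<in> {\<phi>, \<phi>'} \<Longrightarrow> \<psi> \<in> g' q \<longleftrightarrow> par_act k0 \<psi> \<in> q"
      using lim_mapsE[OF g'E _ _ F, of "{p, p'}"] p(1) p'(1) by auto
    obtain k where k: "pelem L C C c k" "\<And>\<psi>. \<psi> \<in> {\<phi>, \<phi>'} \<Longrightarrow> par_act k \<psi> = par_act k0 \<psi>"
      using acts_extend[OF k0(1) self_ext c(1)] c(2) B by (metis subset_trans)
    show ?thesis using k0(2) k(2) same[OF k(1)] \<phi>'(2) by simp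
  qed
  have "inj_on \<Phi> (idem_group C u)"
  proof (rule inj_onI)
    fix g g' assume g: "g \<in> idem_group C u" "g' \<in> idem_group C u" and eq: "\<Phi> g = \<Phi> g'"
    have gE: "g \<in> lim_maps C C" "g' \<in> lim_maps C C" using g by (auto simp: idem_group_def)
    have fixed: "g p = g' p" if p: "p \<in> types C" "u p = p" for p
    proof -
      have r: "g p \<in> types C" "u (g p) = g p" "g' p \<in> types C" "u (g' p) = g' p"
        using g p lim_maps_in[OF gE(1)] lim_maps_in[OF gE(2)] by (auto simp: idem_group_def)
      have small: "\<phi> \<in> g p \<longleftrightarrow> \<phi> \<in> g' p" if "\<phi> \<in> fms B" for \<phi>
        using half[OF g(2) eq p that] half[OF g(1) eq[symmetric] p that] by blast
      show ?thesis
      proof (rule type_eqI[OF r(1,3)])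
        fix \<phi> assume "\<phi> \<in> fms (elems C)"
        from formulas_over_finite_params[OF this]
        obtain A where A: "finite A" "A \<subseteq> elems C" "\<phi> \<in> fms A" .
        \<comment> \<open>The parameters are moved into \<open>B\<close>. The way back is a
          placement of the moved formula, to which \<open>small_set_decides\<close> applies with the
          types \<open>g p\<close> and \<open>g' p\<close>.\<close>
        obtain k where k: "pelem L C C A k" "k ` A \<subseteq> B" using \<rho>[OF A(1,2)] by blast
        let ?\<psi> = "par_act k \<phi>"
        have \<psi>: "?\<psi> \<in> fms (k ` A)" using pelem_act[OF k(1) A(3)] .
        have "par_act (inv_into A k) ?\<psi> \<in> g p \<longleftrightarrow> par_act (inv_into A k) ?\<psi> \<in> g' p"
        proof (rule small_set_decides[OF u \<rho> r(1,2) r(3,4) _ \<psi> \<psi> _ pelem_inv[OF k(1)]])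
          fix l assume l: "pelem L C C (k ` A) l" "l ` k ` A \<subseteq> B"
          have "par_act l ?\<psi> \<in> fms B"
            using pelem_act[OF l(1) \<psi>] formulas_over_mono[OF l(2)] by blast
          then show "par_act l ?\<psi> \<in> g p \<longleftrightarrow> par_act l ?\<psi> \<in> g' p" by (rule small)
        qed (use A(1) in auto)
        moreover have "par_act (inv_into A k) ?\<psi> = \<phi>"
          unfolding par_act_comp by (rule par_act_id[OF A(3)]) (simp add: pelem_inj[OF k(1)])
        ultimately show "\<phi> \<in> g p \<longleftrightarrow> \<phi> \<in> g' p" by simp
      qed
    qed
    show "g = g'"
    proof (rule extensionalityI[OF lim_maps_ext[OF gE(1)] lim_maps_ext[OF gE(2)]])
      fix p assume p: "p \<in> types C"
      \<comment> \<open>Types fixed by \<open>u\<close> suffice because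
        \<open>g u = g\<close>.\<close>
      have "g (u p) = g' (u p)"
        using fixed[of "u p"] lim_maps_in[OF min_idem_in[OF u] p] min_idem_idem[OF u p] by simp
      then show "g p = g' p" using g p by (simp add: idem_group_def)
    qed
  qed
  moreover have "\<Phi> g \<in> Pow (Pow B \<times> Pow (Pow (B \<times> B)))" for g
  proof -
    have traces: "traces B p c \<phi> \<subseteq> Pow (B \<times> B)" if "c \<subseteq> B" for p c \<phi>
      using that by (fastforce simp: traces_def)
    show ?thesis
    proof (rule PowI, rule subsetI)
      fix z assume "z \<in> \<Phi> g"
      then obtain p c \<phi> where "z = (c, traces B p c \<phi>)" "c \<subseteq> B"
        unfolding \<Phi>_def mem_Collect_eq by (elim exE conjE) (rule that)
      then show "z \<in> Pow B \<times> Pow (Pow (B \<times> B))" using traces[of c p \<phi>] by simp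
    qed
  qed
  ultimately show ?thesis by blast
qed

end

section \<open>Monster models\<close>

text \<open>An automorphism is a family indexed by sorts, so the sort of each value has to be read
  off the declarations \<open>v\<close> and \<open>c\<close>.\<close>

lemma automorphisms_tm_val:
  assumes \<sigma>: "\<sigma> \<in> automorphisms L C" and C: "is_struct L C"
    and e: "\<And>x s. v x = Some s \<Longrightarrow> e x \<in> Dom C s"
    and b: "list_all2 (\<lambda>a s. a \<in> Dom C s) b c"
  shows "has_sort L v c t s \<Longrightarrow> tm_val C e b t \<in> Dom C s \<and>
    tm_val C (\<lambda>x. \<sigma> (the (v x)) (e x)) (map2 \<sigma> c b) t = \<sigma> s (tm_val C e b t)"
proof (induction t arbitrary: s)
  case (Bd n)
  then show ?case using b by (auto simp: list_all2_conv_all_nth)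
next
  case (Fr x)
  then show ?case using e by auto
next
  case (Fn f ts)
  then obtain ss where f: "fun_sort L f = Some (ss, s)" and ts: "list_all2 (has_sort L v c) ts ss"
    by auto
  have len: "length ts = length ss" using ts by (rule list_all2_lengthD)
  have IH: "tm_val C e b (ts ! i) \<in> Dom C (ss ! i) \<and>
      tm_val C (\<lambda>x. \<sigma> (the (v x)) (e x)) (map2 \<sigma> c b) (ts ! i) = \<sigma> (ss ! i) (tm_val C e b (ts ! i))"
    if "i < length ts" for i
    by (rule Fn.IH) (use that ts in \<open>auto simp: list_all2_conv_all_nth\<close>)
  let ?as = "map (tm_val C e b) ts"
  have as: "in_sorts C ?as ss" using IH len by (auto simp: in_sorts_def list_all2_conv_all_nth)
  have "map (tm_val C (\<lambda>x. \<sigma> (the (v x)) (e x)) (map2 \<sigma> c b)) ts = map2 \<sigma> ss ?as"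
    by (rule nth_equalityI) (use IH len in auto)
  moreover have "\<sigma> s (FunI C f ?as) = FunI C f (map2 \<sigma> ss ?as)"
    using \<sigma> f as by (auto simp: automorphisms_def)
  moreover have "FunI C f ?as \<in> Dom C s" using C f as by (auto simp: is_struct_def)
  ultimately show ?case by simp
qed

lemma automorphisms_sat:
  assumes \<sigma>: "\<sigma> \<in> automorphisms L C" and C: "is_struct L C"
    and e: "\<And>x s. v x = Some s \<Longrightarrow> e x \<in> Dom C s"
  shows "wf_fm L v c \<phi> \<Longrightarrow> list_all2 (\<lambda>a s. a \<in> Dom C s) b c \<Longrightarrow>
    sat C (\<lambda>x. \<sigma> (the (v x)) (e x)) (map2 \<sigma> c b) \<phi> \<longleftrightarrow> sat C e b \<phi>"
proof (induction \<phi> arbitrary: b c)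
  case (Eq t u)
  then obtain s where t: "has_sort L v c t s" and u: "has_sort L v c u s" by auto
  have "inj_on (\<sigma> s) (Dom C s)" using \<sigma> by (auto simp: automorphisms_def bij_betw_def)
  then show ?case
    using automorphisms_tm_val[OF \<sigma> C e Eq.prems(2) t] automorphisms_tm_val[OF \<sigma> C e Eq.prems(2) u]
    by (simp add: inj_on_eq_iff)
next
  case (Rel r ts)
  then obtain ss where r: "rel_sort L r = Some ss" and ts: "list_all2 (has_sort L v c) ts ss"
    by auto
  have len: "length ts = length ss" using ts by (rule list_all2_lengthD)
  have IH: "tm_val C e b (ts ! i) \<in> Dom C (ss ! i) \<and>
      tm_val C (\<lambda>x. \<sigma> (the (v x)) (e x)) (map2 \<sigma> c b) (ts ! i) = \<sigma> (ss ! i) (tm_val C e b (ts ! i))"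
    if "i < length ts" for i
    by (rule automorphisms_tm_val[OF \<sigma> C e Rel.prems(2)])
       (use that ts in \<open>auto simp: list_all2_conv_all_nth\<close>)
  let ?as = "map (tm_val C e b) ts"
  have as: "in_sorts C ?as ss" using IH len by (auto simp: in_sorts_def list_all2_conv_all_nth)
  have "map (tm_val C (\<lambda>x. \<sigma> (the (v x)) (e x)) (map2 \<sigma> c b)) ts = map2 \<sigma> ss ?as"
    by (rule nth_equalityI) (use IH len in auto)
  moreover have "map2 \<sigma> ss ?as \<in> RelI C r \<longleftrightarrow> ?as \<in> RelI C r"
    using \<sigma> r as by (auto simp: automorphisms_def)
  ultimately show ?case by (simp only: sat.simps)
next
  case (Ex s \<phi>)
  have bij: "\<sigma> s ` Dom C s = Dom C s" using \<sigma> by (auto simp: automorphisms_def bij_betw_def)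
  have "sat C (\<lambda>x. \<sigma> (the (v x)) (e x)) (map2 \<sigma> (s # c) (a # b)) \<phi> \<longleftrightarrow> sat C e (a # b) \<phi>"
    if "a \<in> Dom C s" for a
    by (rule Ex.IH) (use Ex.prems that in auto)
  then have "(\<exists>a\<in>\<sigma> s ` Dom C s. sat C (\<lambda>x. \<sigma> (the (v x)) (e x)) (a # map2 \<sigma> c b) \<phi>) \<longleftrightarrow>
      (\<exists>a\<in>Dom C s. sat C e (a # b) \<phi>)"
    by auto
  then show ?case unfolding bij by simp
next
  case (Neg \<phi>)
  then show ?case by simp
next
  case (Conj \<phi> \<psi>)
  then show ?case by simp
qed

lemma pelem_automorphism:
  assumes \<sigma>: "\<sigma> \<in> automorphisms L C" and C: "is_struct L C" and A: "A \<subseteq> elems C"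
  shows "pelem L C C A (elem_act \<sigma>)"
proof -
  have "sat C snd [] \<phi> \<longleftrightarrow> sat C (snd \<circ> elem_act \<sigma>) [] \<phi>" if \<phi>: "\<phi> \<in> formulas L (param_sort A)" for \<phi>
  proof -
    have "sat C (snd \<circ> elem_act \<sigma>) [] \<phi> \<longleftrightarrow> sat C (\<lambda>x. \<sigma> (the (param_sort A x)) (snd x)) [] \<phi>"
      by (rule sat_cong) (use formulas_vars[OF \<phi>] in auto)
    also have "\<dots> \<longleftrightarrow> sat C (\<lambda>x. \<sigma> (the (param_sort A x)) (snd x)) (map2 \<sigma> [] []) \<phi>" by simp
    also have "\<dots> \<longleftrightarrow> sat C snd [] \<phi>"
      by (rule automorphisms_sat[OF \<sigma> C]) (use \<phi> A in \<open>auto simp: formulas_def elems_def\<close>)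
    finally show ?thesis by simp
  qed
  moreover have "\<sigma> s a \<in> Dom C s" if "a \<in> Dom C s" for s a
    using \<sigma> that by (auto simp: automorphisms_def bij_betw_def)
  ultimately show ?thesis using A by (auto simp: pelem_def elems_def)
qed

text \<open>The language may have no symbols, so the empty conjunction is a quantified equation over
  an arbitrary sort, true as soon as that sort is nonempty.\<close>

primrec conjs :: "('s, 'f, 'r, 'v) fm list \<Rightarrow> ('s, 'f, 'r, 'v) fm" where
  "conjs [] = Ex undefined (Eq (Bd 0) (Bd 0))"
| "conjs (\<phi> # \<phi>s) = Conj \<phi> (conjs \<phi>s)"

lemma formulas_conjs: "set \<phi>s \<subseteq> formulas L v \<Longrightarrow> conjs \<phi>s \<in> formulas L v"
  by (induction \<phi>s) (auto simp: formulas_def)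

lemma sat_conjs: "Dom M undefined \<noteq> {} \<Longrightarrow> sat M e b (conjs \<phi>s) \<longleftrightarrow> (\<forall>\<phi>\<in>set \<phi>s. sat M e b \<phi>)"
  by (induction \<phi>s) auto

lemma sat_over_par_act_Neg: "sat_over N e (par_act k (Neg \<phi>)) \<longleftrightarrow> \<not> sat_over N e (par_act k \<phi>)"
  by (simp add: sat_over_def)

definition bind_fm :: "('s, 'f, 'r, unit + 'w) fm \<Rightarrow> ('s, 'f, 'r, 'w) fm" where
  "bind_fm = close_fm (map_sum (\<lambda>_. 0) id) 0"

lemma formulas_Ex_bind_fm:
  assumes "\<psi> \<in> formulas L (case_sum [() \<mapsto> s] w)"
  shows "Ex s (bind_fm \<psi>) \<in> formulas L w"
proof -
  have "close_sorts (map_sum (\<lambda>_. 0) id) (case_sum [() \<mapsto> s] w) w [s]"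
    by (auto simp: close_sorts_def split: sum.splits)
  then show ?thesis
    using wf_fm_close[of _ _ w "[s]" L "[]" \<psi>] assms by (simp add: formulas_def bind_fm_def)
qed

lemma sat_bind_fm:
  assumes "\<psi> \<in> formulas L (case_sum [() \<mapsto> s] w)"
  shows "sat M e [a] (bind_fm \<psi>) \<longleftrightarrow> sat M (case_sum (\<lambda>_. a) e) [] \<psi>"
proof -
  have "(\<lambda>x. case map_sum (\<lambda>_. 0) id x of Inl n \<Rightarrow> [a] ! n | Inr y \<Rightarrow> e y) = case_sum (\<lambda>_::unit. a) e"
    by (auto simp: fun_eq_iff split: sum.splits)
  then show ?thesis
    using sat_close[of L "case_sum [() \<mapsto> s] w" "[]" \<psi> "[]" M e "[a]" "map_sum (\<lambda>_. 0) id"] assms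
    by (simp add: formulas_def bind_fm_def)
qed

text \<open>The type of the new element over \<open>A\<close>, moved by \<open>k\<close>, is
  finitely satisfiable because \<open>k\<close> preserves the existential closure of each finite
  conjunction. A realization in \<open>N\<close> is the new value.\<close>

lemma hom_ext_saturated:
  fixes M :: "('s, 'f, 'r, 'm) struct" and N :: "('s, 'f, 'r, 'n) struct"
  assumes N: "saturated L \<kappa> N" and fin: "\<And>A :: ('s \<times> 'n) set. finite A \<Longrightarrow> |A| <o \<kappa>"
    and dom_ne: "\<And>s. Dom M s \<noteq> {}" "\<And>s. Dom N s \<noteq> {}"
  shows "hom_ext L M N"
  unfolding hom_ext_def
proof (intro allI impI)
  fix A k x assume A: "finite A" and k: "pelem L M N A k" and x: "x \<in> elems M"
  show "\<exists>k'. (\<forall>y\<in>A. k' y = k y) \<and> pelem L M N (insert x A) k'"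
  \<comment> \<open>A point already in the domain must keep its value, whereas a new point can be
    added by updating \<open>k\<close>.\<close>
  proof (cases "x \<in> A")
    case True
    then show ?thesis using k by (auto simp: insert_absorb)
  next
    case False
    obtain s a where sa: "x = (s, a)" "a \<in> Dom M s" using x by (auto simp: elems_def)
    define q where "q = {\<phi> \<in> formulas_over L [() \<mapsto> s] A. sat_over M (\<lambda>_. a) \<phi>}"
    let ?p = "par_act k ` q"
    have "?p \<subseteq> formulas_over L [() \<mapsto> s] (k ` A)"
      using pelem_act[OF k] by (auto simp: q_def)
    moreover have "fin_satisfiable N [() \<mapsto> s] ?p"
      unfolding fin_satisfiable_def
    proof (intro allI impI)
      fix F assume F: "F \<subseteq> ?p" "finite F"
      obtain G where G: "finite G" "G \<subseteq> q" "F = par_act k ` G"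
        using finite_subset_image[OF F(2,1)] by blast
      obtain \<phi>s where \<phi>s: "set \<phi>s = G" using finite_list[OF G(1)] by blast
      let ?v = "case_sum [() \<mapsto> s] (param_sort A)"
      have \<psi>: "conjs \<phi>s \<in> formulas L ?v"
        by (rule formulas_conjs) (use \<phi>s G(2) in \<open>auto simp: q_def formulas_over_def\<close>)
      have Ex: "Ex s (bind_fm (conjs \<phi>s)) \<in> formulas L (param_sort A)" by (rule formulas_Ex_bind_fm[OF \<psi>])
      have "sat M (case_sum (\<lambda>_. a) snd) [] (conjs \<phi>s)"
        unfolding sat_conjs[OF dom_ne(1)] using \<phi>s G(2) by (auto simp: q_def sat_over_def)
      then have "sat M snd [] (Ex s (bind_fm (conjs \<phi>s)))"
        using sa(2) by (auto simp: sat_bind_fm[OF \<psi>])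
      then have "sat N (snd \<circ> k) [] (Ex s (bind_fm (conjs \<phi>s)))"
        using k Ex unfolding pelem_def by metis
      then obtain a' where a': "a' \<in> Dom N s" "sat N (case_sum (\<lambda>_. a') (snd \<circ> k)) [] (conjs \<phi>s)"
        by (auto simp: sat_bind_fm[OF \<psi>])
      have "sat_over N (\<lambda>_. a') (par_act k \<phi>)" if "\<phi> \<in> G" for \<phi>
      proof -
        have "sat N (case_sum (\<lambda>_. a') (snd \<circ> k)) [] \<phi>"
          using a'(2) that \<phi>s unfolding sat_conjs[OF dom_ne(2)] by blast
        then show ?thesis
          unfolding sat_over_def sat_map by (simp add: case_sum_o_map_sum)
      qed
      then show "\<exists>e\<in>tuples N [() \<mapsto> s]. \<forall>\<phi>\<in>F. sat_over N e \<phi>"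
        using a'(1) by (intro bexI[of _ "\<lambda>_. a'"]) (auto simp: G(3) tuples_def)
    qed
    ultimately have "\<exists>e\<in>tuples N [() \<mapsto> s]. \<forall>\<phi>\<in>?p. sat_over N e \<phi>"
      by (intro N[unfolded saturated_def, rule_format, OF pelem_ran[OF k] fin] finite_imageI A)
    then obtain e where e: "e \<in> tuples N [() \<mapsto> s]" "\<forall>\<phi>\<in>?p. sat_over N e \<phi>" ..
    let ?k = "k(x := (s, e ()))"
    have "sat M snd [] \<phi> \<longleftrightarrow> sat N (snd \<circ> ?k) [] \<phi>"
      if \<phi>: "\<phi> \<in> formulas L (param_sort (insert x A))" for \<phi>
    proof -
      \<comment> \<open>Renaming \<open>x\<close> to the single variable makes a formula over
        \<open>insert x A\<close> into a one-variable formula over \<open>A\<close>, which or whose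
        negation lies in \<open>q\<close>.\<close>
      define g where "g = (\<lambda>y. if y = x then Inl () else Inr y)"
      have \<phi>': "map_fm g \<phi> \<in> formulas_over L [() \<mapsto> s] A"
        unfolding formulas_over_def
      proof (rule formulas_map[OF \<phi>])
        fix y assume "y \<in> set_fm \<phi>"
        then have "y \<in> insert x A" using formulas_vars[OF \<phi>] by auto
        then show "case_sum [() \<mapsto> s] (param_sort A) (g y) = param_sort (insert x A) y"
          using sa(1) by (auto simp: g_def)
      qed
      have "case_sum (\<lambda>_. a) snd \<circ> g = snd" using sa(1) by (auto simp: g_def fun_eq_iff)
      then have 1: "sat M snd [] \<phi> \<longleftrightarrow> sat_over M (\<lambda>_. a) (map_fm g \<phi>)"
        by (simp add: sat_over_def)
      have "case_sum e snd \<circ> map_sum id k \<circ> g = snd \<circ> ?k" by (auto simp: g_def fun_eq_iff)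
      then have 2: "sat N (snd \<circ> ?k) [] \<phi> \<longleftrightarrow> sat_over N e (par_act k (map_fm g \<phi>))"
        unfolding sat_over_def sat_map by simp
      show ?thesis
      proof (cases "sat_over M (\<lambda>_. a) (map_fm g \<phi>)")
        case True
        then have "map_fm g \<phi> \<in> q" using \<phi>' by (simp add: q_def)
        then have "sat_over N e (par_act k (map_fm g \<phi>))" using e(2) by blast
        then show ?thesis using 1 2 True by simp
      next
        case False
        then have "Neg (map_fm g \<phi>) \<in> q" using \<phi>' by (simp add: q_def sat_over_def)
        then have "sat_over N e (par_act k (Neg (map_fm g \<phi>)))" using e(2) by blast
        then show ?thesis using 1 2 False sat_over_par_act_Neg by blast
      qed
    qed
    moreover have "(s, e ()) \<in> elems N" using e(1) by (simp add: tuples_def elems_def)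
    ultimately have "pelem L M N (insert x A) ?k"
      using k x sa(1) by (auto simp: pelem_def)
    then show ?thesis using False by (intro exI[of _ ?k]) auto
  qed
qed

section \<open>Truth of sentences in models of a complete theory\<close>

lemma model_of_sat_iff:
  assumes "complete_theory L T" "model_of L T M" "\<phi> \<in> sentences L"
  shows "sat M e [] \<phi> \<longleftrightarrow> \<phi> \<in> T"
proof (cases "\<phi> \<in> T")
  case True
  then show ?thesis using assms(2) by (simp add: model_of_def)
next
  case False
  then have "Neg \<phi> \<in> T" using assms(1)[unfolded complete_theory_def] assms(3) by metis
  then have "sat M e [] (Neg \<phi>)" using assms(2) unfolding model_of_def by blast
  then show ?thesis using False by simp
qed

lemma model_of_sat_no_vars:
  assumes "complete_theory L T" "model_of L T M" "\<phi> \<in> formulas L (param_sort {})"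
  shows "sat M e [] \<phi> \<longleftrightarrow> map_fm (\<lambda>_. ()) \<phi> \<in> T"
proof -
  have no_vars: "set_fm \<phi> = {}" using formulas_vars[OF assms(3)] by simp
  have "map_fm (\<lambda>_. ()) \<phi> \<in> sentences L" by (rule formulas_map[OF assms(3)]) (simp add: no_vars)
  from model_of_sat_iff[OF assms(1,2) this, of "\<lambda>_. undefined"]
  have "sat M ((\<lambda>_. undefined) \<circ> (\<lambda>_. ())) [] \<phi> \<longleftrightarrow> map_fm (\<lambda>_. ()) \<phi> \<in> T"
    by (simp only: sat_map)
  moreover have "sat M e [] \<phi> \<longleftrightarrow> sat M ((\<lambda>_. undefined) \<circ> (\<lambda>_. ())) [] \<phi>"
    by (rule sat_cong) (simp add: no_vars)
  ultimately show ?thesis by simp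
qed

text \<open>The start of the back-and-forth between two models, and the place where completeness of
  \<open>T\<close> enters.\<close>

lemma pelem_empty:
  assumes "complete_theory L T" "model_of L T M" "model_of L T N"
  shows "pelem L M N {} k"
  by (simp add: pelem_def model_of_sat_no_vars[OF assms(1,2)] model_of_sat_no_vars[OF assms(1,3)])

section \<open>Boundedness and absoluteness\<close>

lemma strong_limit_Pow:
  assumes "strong_limit \<kappa>" "|A| <o \<kappa>"
  shows "|Pow A| <o \<kappa>"
proof -
  \<comment> \<open>\<open>strong_limit\<close> speaks only of subsets of
    \<open>Field \<kappa>\<close>, so \<open>A\<close> is first copied into the field.\<close>
  obtain B where B: "B \<subseteq> Field \<kappa>" "|A| =o |B|" "|B| <o \<kappa>"
    using assms(2) internalize_card_of_ordLess[of A \<kappa>] by blast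
  then obtain f where "bij_betw f A B" using card_of_ordIso by blast
  then have "|Pow A| =o |Pow B|" using bij_betw_Pow card_of_ordIsoI by blast
  moreover have "|Pow B| <o \<kappa>" using assms(1) B by (simp add: strong_limit_def)
  ultimately show ?thesis by (rule ordIso_ordLess_trans)
qed

lemma strong_limit_finite:
  assumes "strong_limit \<kappa>" "finite A"
  shows "|A| <o \<kappa>"
proof (rule finite_ordLess_infinite)
  show "Well_order |A|" "finite (Field |A| )" using assms(2) by (simp_all add: Field_card_of card_of_well_order_on)
  show "Well_order \<kappa>" "infinite (Field \<kappa>)"
    using assms(1) by (auto simp: strong_limit_def card_order_on_def)
qed

lemma strong_limit_Times:
  assumes "strong_limit \<kappa>" "|A| <o \<kappa>" "|B| <o \<kappa>"
  shows "|A \<times> B| <o \<kappa>"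
proof (cases "finite A \<and> finite B")
  case True
  then show ?thesis by (intro strong_limit_finite[OF assms(1)]) simp
next
  case False
  consider "|A| \<le>o |B|" | "|B| \<le>o |A|"
    using ordLeq_total[OF card_of_Well_order[of A] card_of_Well_order[of B]] by blast
  then show ?thesis
  proof cases
    case 1
    then have "infinite B" using False card_of_ordLeq_finite[of A B] by blast
    then show ?thesis using card_of_Times_infinite[of B A] 1 assms(3)
      by (cases "A = {}") (auto simp: strong_limit_finite[OF assms(1)] intro: ordIso_ordLess_trans)
  next
    case 2
    then have "infinite A" using False card_of_ordLeq_finite[of B A] by blast
    then show ?thesis using card_of_Times_infinite[of A B] 2 assms(2)
      by (cases "B = {}") (auto simp: strong_limit_finite[OF assms(1)] intro: ordIso_ordLess_trans)
  qed
qed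

section \<open>Counting the types of finite tuples over the empty set\<close>

lemma infinite_sentences: "infinite (sentences L)"
proof -
  \<comment> \<open>Even a language without symbols has the iterated negations of one
    sentence.\<close>
  let ?f = "\<lambda>n. (Neg ^^ n) (Ex undefined (Eq (Bd 0) (Bd 0)))"
  have "?f m = ?f n \<Longrightarrow> m = n" for m n
  proof (induction m arbitrary: n)
    case 0
    then show ?case by (cases n) auto
  next
    case (Suc m)
    then show ?case by (cases n) auto
  qed
  then have "inj ?f" by (rule injI)
  moreover have "?f n \<in> sentences L" for n
    by (induction n) (auto simp: formulas_def)
  ultimately show ?thesis using infinite_iff_countable_subset by blast
qed

text \<open>Free variables are represented by dangling indices, so that these formulas can be
  compared with sentences, whose number \<open>monster_model\<close> bounds.\<close>

definition open_formulas :: "('s, 'f, 'r) lang \<Rightarrow> ('s, 'f, 'r, unit) fm set" where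
  "open_formulas L = {\<phi>. \<exists>ss. wf_fm L Map.empty ss \<phi>}"

primrec exs :: "'s list \<Rightarrow> ('s, 'f, 'r, 'v) fm \<Rightarrow> ('s, 'f, 'r, 'v) fm" where
  "exs [] \<phi> = \<phi>"
| "exs (s # ss) \<phi> = exs ss (Ex s \<phi>)"

lemma wf_fm_exs: "wf_fm L v ss \<phi> \<Longrightarrow> wf_fm L v [] (exs ss \<phi>)"
  by (induction ss arbitrary: \<phi>) auto

lemma exs_inject: "length ss = length ss' \<Longrightarrow> exs ss \<phi> = exs ss' \<phi>' \<Longrightarrow> \<phi> = \<phi>'"
proof (induction ss ss' arbitrary: \<phi> \<phi>' rule: list_induct2)
  case (Cons s ss s' ss')
  then have "Ex s \<phi> = Ex s' \<phi>'" by (metis exs.simps(2))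
  then show ?case by simp
qed simp

text \<open>Existential closure loses only how many quantifiers were added, so the length of the
  context is kept alongside.\<close>

lemma card_open_formulas:
  fixes L :: "('s, 'f, 'r) lang"
  shows "|open_formulas L| \<le>o |(UNIV :: nat set) \<times> sentences L|"
proof -
  define ss where "ss = (\<lambda>\<phi> :: ('s, 'f, 'r, unit) fm. SOME ss. wf_fm L Map.empty ss \<phi>)"
  have ss: "wf_fm L Map.empty (ss \<phi>) \<phi>" if "\<phi> \<in> open_formulas L" for \<phi>
    unfolding ss_def by (rule someI_ex) (use that in \<open>simp add: open_formulas_def\<close>)
  show ?thesis
  proof (rule card_of_ordLeqI)
    show "inj_on (\<lambda>\<phi>. (length (ss \<phi>), exs (ss \<phi>) \<phi>)) (open_formulas L)"
      by (rule inj_onI) (auto dest: exs_inject)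
    show "(length (ss \<phi>), exs (ss \<phi>) \<phi>) \<in> UNIV \<times> sentences L" if "\<phi> \<in> open_formulas L" for \<phi>
      using wf_fm_exs[OF ss[OF that]] by (simp add: formulas_def)
  qed
qed

text \<open>The complete type of a finite tuple over the empty set, with the entries as values of
  dangling indices. As no free variable is declared, the valuation is a dummy.\<close>

definition list_type :: "('s, 'f, 'r) lang \<Rightarrow> ('s, 'f, 'r, 'm) struct \<Rightarrow> ('s \<times> 'm) list \<Rightarrow>
    ('s, 'f, 'r, unit) fm set" where
  "list_type L C cs = {\<phi>. wf_fm L Map.empty (map fst cs) \<phi> \<and> sat C (\<lambda>_. undefined) (map snd cs) \<phi>}"

text \<open>\<open>Eq (Bd i) (Bd i)\<close> is well-formed exactly for \<open>i\<close> below the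
  length, and an equation only between terms of one sort; so the type determines length and
  sorts.\<close>

lemma list_type_sorts:
  fixes C :: "('s, 'f, 'r, 'm) struct"
  assumes "\<And>s. Dom C s \<noteq> {}" "set cs \<subseteq> elems C" "list_type L C cs = list_type L C ds"
  shows "map fst cs = map fst ds"
proof -
  have len: "i < length cs \<longleftrightarrow> Eq (Bd i) (Bd i) \<in> list_type L C cs" for i and cs :: "('s \<times> 'm) list"
    by (auto simp: list_type_def)
  have "i < length cs \<longleftrightarrow> i < length ds" for i using len[of i cs] len[of i ds] assms(3) by simp
  then have l: "length cs = length ds" by (metis linorder_neqE_nat less_irrefl)
  show ?thesis
  proof (rule nth_equalityI)
    fix i assume "i < length (map fst cs)"
    then have i: "i < length cs" "i < length ds" using l by simp_all
    let ?s = "fst (cs ! i)"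
    have "snd (cs ! i) \<in> Dom C ?s"
      using assms(2) nth_mem[OF i(1)] by (auto simp: elems_def)
    \<comment> \<open>The quantifier takes index 0, which shifts entry \<open>i\<close> to
      \<open>Suc i\<close>.\<close>
    then have "Ex ?s (Eq (Bd 0) (Bd (Suc i))) \<in> list_type L C cs"
      using i by (auto simp: list_type_def)
    then have "Ex ?s (Eq (Bd 0) (Bd (Suc i))) \<in> list_type L C ds" using assms(3) by simp
    then show "map fst cs ! i = map fst ds ! i" using i by (auto simp: list_type_def)
  qed (simp add: l)
qed

lemma list_type_pelem:
  fixes C :: "('s, 'f, 'r, 'm) struct"
  assumes ne: "\<And>s. Dom C s \<noteq> {}" and cs: "set cs \<subseteq> elems C" and ds: "set ds \<subseteq> elems C"
    and eq: "list_type L C cs = list_type L C ds"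
  shows "\<exists>k. pelem L C C (set cs) k \<and> k ` set cs \<subseteq> set ds"
proof -
  have sorts: "map fst cs = map fst ds" by (rule list_type_sorts[OF ne cs eq])
  have len: "length cs = length ds" using sorts by (metis length_map)
  have "\<forall>x\<in>set cs. \<exists>i. i < length cs \<and> cs ! i = x" by (auto simp: in_set_conv_nth)
  \<comment> \<open>If \<open>x\<close> occurs repeatedly in \<open>cs\<close>, any of its positions
    will do, since both tuples have the same type.\<close>
  from bchoice[OF this] obtain idx
    where idx: "\<And>x. x \<in> set cs \<Longrightarrow> idx x < length cs \<and> cs ! idx x = x" by blast
  define k where "k = (\<lambda>x. ds ! idx x)"
  have fst_nth: "fst (ds ! i) = fst (cs ! i)" if "i < length cs" for i
    using that sorts len by (metis nth_map)
  have kds: "k x \<in> set ds" "fst (k x) = fst x" if "x \<in> set cs" for x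
    using idx[OF that] len fst_nth[of "idx x"] by (auto simp: k_def)
  \<comment> \<open>Each parameter becomes a dangling index, its position, so that truth at
    \<open>cs\<close> and at \<open>ds\<close> is membership in the common type.\<close>
  define h :: "'s \<times> 'm \<Rightarrow> nat + unit" where "h = Inl \<circ> idx"
  have h: "close_sorts h (param_sort (set cs)) Map.empty (map fst cs)"
    using idx by (auto simp: close_sorts_def h_def)
  have "sat C snd [] \<phi> \<longleftrightarrow> sat C (snd \<circ> k) [] \<phi>" if \<phi>: "\<phi> \<in> formulas L (param_sort (set cs))" for \<phi>
  proof -
    let ?\<psi> = "close_fm h 0 \<phi>"
    have \<phi>0: "wf_fm L (param_sort (set cs)) [] \<phi>" using \<phi> by (simp add: formulas_def)
    have \<psi>: "wf_fm L Map.empty (map fst cs) ?\<psi>" using wf_fm_close[OF h \<phi>0] by simp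
    have vars: "set_fm \<phi> \<subseteq> set cs" using formulas_vars[OF \<phi>] by simp
    have val: "sat C (\<lambda>_. undefined) (map snd es) ?\<psi> \<longleftrightarrow> sat C (\<lambda>x. map snd es ! idx x) [] \<phi>" for es :: "('s \<times> 'm) list"
      using sat_close[OF \<phi>0, of "[]" C "\<lambda>_. undefined" "map snd es" h] by (simp add: h_def)
    have "sat C snd [] \<phi> \<longleftrightarrow> sat C (\<lambda>x. map snd cs ! idx x) [] \<phi>"
      by (rule sat_cong) (use vars idx in auto)
    also have "\<dots> \<longleftrightarrow> ?\<psi> \<in> list_type L C cs" using \<psi> val by (simp add: list_type_def)
    also have "\<dots> \<longleftrightarrow> ?\<psi> \<in> list_type L C ds" using eq by simp
    also have "\<dots> \<longleftrightarrow> sat C (\<lambda>x. map snd ds ! idx x) [] \<phi>"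
      using \<psi> val sorts by (simp add: list_type_def)
    also have "\<dots> \<longleftrightarrow> sat C (snd \<circ> k) [] \<phi>"
      by (rule sat_cong) (use vars idx len in \<open>auto simp: k_def\<close>)
    finally show ?thesis .
  qed
  then have "pelem L C C (set cs) k" using cs ds kds by (auto simp: pelem_def)
  then show ?thesis using kds(1) by blast
qed

text \<open>One tuple is picked for each type over the empty set. There are at most as many types as
  sets of open formulas, fewer than \<open>\<kappa>\<close> by the strong limit property, and each
  contributes finitely many elements.\<close>

lemma monster_small_set:
  assumes C: "monster_model L T \<kappa> C"
  shows "\<exists>B. B \<subseteq> elems C \<and> |B| <o \<kappa> \<and>
    (\<forall>A. finite A \<longrightarrow> A \<subseteq> elems C \<longrightarrow> (\<exists>k. pelem L C C A k \<and> k ` A \<subseteq> B))"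
proof -
  have \<kappa>: "strong_limit \<kappa>" "|sentences L| <o \<kappa>" and ne: "\<And>s. Dom C s \<noteq> {}"
    using C by (auto simp: monster_model_def model_of_def is_struct_def)
  have nat: "|UNIV :: nat set| <o \<kappa>"
    using infinite_iff_card_of_nat[of "sentences L"] infinite_sentences \<kappa>(2)
    by (blast intro: ordLeq_ordLess_trans)
  have types: "|Pow (open_formulas L)| <o \<kappa>"
    using card_open_formulas strong_limit_Times[OF \<kappa>(1) nat \<kappa>(2)]
    by (intro strong_limit_Pow[OF \<kappa>(1)]) (rule ordLeq_ordLess_trans)
  \<comment> \<open>For a set that is not a type the choice only has to stay inside
    \<open>elems C\<close>; the empty list is available.\<close>
  define pick where "pick = (\<lambda>t. SOME ds. set ds \<subseteq> elems C \<and>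
    ((\<exists>cs. set cs \<subseteq> elems C \<and> list_type L C cs = t) \<longrightarrow> list_type L C ds = t))"
  have pick: "set (pick t) \<subseteq> elems C \<and>
    ((\<exists>cs. set cs \<subseteq> elems C \<and> list_type L C cs = t) \<longrightarrow> list_type L C (pick t) = t)" for t
    unfolding pick_def
  proof (rule someI_ex, cases "\<exists>cs. set cs \<subseteq> elems C \<and> list_type L C cs = t")
    case True
    then show "\<exists>ds. set ds \<subseteq> elems C \<and>
      ((\<exists>cs. set cs \<subseteq> elems C \<and> list_type L C cs = t) \<longrightarrow> list_type L C ds = t)" by blast
  next
    case False
    then show "\<exists>ds. set ds \<subseteq> elems C \<and>
      ((\<exists>cs. set cs \<subseteq> elems C \<and> list_type L C cs = t) \<longrightarrow> list_type L C ds = t)"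
      by (intro exI[of _ "[]"]) simp
  qed
  define B where "B = (\<Union>t\<in>Pow (open_formulas L). set (pick t))"
  have "B \<subseteq> (\<lambda>(t, n). pick t ! n) ` (Pow (open_formulas L) \<times> UNIV)"
  proof
    fix x assume "x \<in> B"
    then obtain t where t: "t \<in> Pow (open_formulas L)" "x \<in> set (pick t)" unfolding B_def by blast
    then obtain n where "x = pick t ! n" by (auto simp: in_set_conv_nth)
    then show "x \<in> (\<lambda>(t, n). pick t ! n) ` (Pow (open_formulas L) \<times> UNIV)"
      using t(1) by (intro image_eqI[of _ _ "(t, n)"]) auto
  qed
  from ordLeq_ordLess_trans[OF ordLeq_transitive[OF card_of_mono1[OF this] card_of_image]
      strong_limit_Times[OF \<kappa>(1) types nat]]
  have "|B| <o \<kappa>" .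
  moreover have "B \<subseteq> elems C" using pick by (auto simp: B_def)
  moreover have "\<exists>k. pelem L C C A k \<and> k ` A \<subseteq> B" if A: "finite A" "A \<subseteq> elems C" for A
  proof -
    obtain cs where cs: "set cs = A" using finite_list[OF A(1)] by blast
    let ?t = "list_type L C cs"
    have "list_type L C (pick ?t) = ?t" using pick[of ?t] cs A(2) by blast
    then obtain k where "pelem L C C (set cs) k" "k ` set cs \<subseteq> set (pick ?t)"
      using list_type_pelem[OF ne, of cs "pick ?t" L] cs A(2) pick[of ?t] by auto
    moreover have "set (pick ?t) \<subseteq> B"
      unfolding B_def by (rule UN_upper) (auto simp: list_type_def open_formulas_def)
    ultimately show ?thesis using cs by blast
  qed
  ultimately show ?thesis by blast
qed

section \<open>Extension and homogeneity in monster models\<close>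

lemma monster_hom_ext:
  fixes N :: "('s, 'f, 'r, 'n) struct"
  assumes "model_of L T M" "monster_model L T \<kappa> N"
  shows "hom_ext L M N"
proof (rule hom_ext_saturated)
  show "saturated L \<kappa> N" using assms(2) by (simp add: monster_model_def)
  show "|A| <o \<kappa>" if "finite A" for A :: "('s \<times> 'n) set"
    using assms(2) that strong_limit_finite by (auto simp: monster_model_def)
  show "Dom M s \<noteq> {}" "Dom N s \<noteq> {}" for s
    using assms by (auto simp: monster_model_def model_of_def is_struct_def)
qed

lemma monster_homogeneous_types:
  assumes C: "monster_model L T \<kappa> C"
  shows "homogeneous_types L C"
proof
  have Cs: "is_struct L C" and mod: "model_of L T C" using C by (auto simp: monster_model_def model_of_def)
  show "hom_ext L C C" by (rule monster_hom_ext[OF mod C])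
  show "Dom C s \<noteq> {}" for s using Cs by (simp add: is_struct_def)
  show "\<exists>k. pelem L C C A k \<and> (\<forall>x\<in>A. elem_act \<sigma> (k x) = x)"
    if \<sigma>: "\<sigma> \<in> automorphisms L C" and A: "finite A" "A \<subseteq> elems C" for \<sigma> A
  proof -
    \<comment> \<open>Automorphisms are elementary on every set, so inverting
      \<open>\<sigma>\<close> on the preimage of \<open>A\<close> yields an elementary map with
      domain exactly \<open>A\<close>.\<close>
    let ?A = "elem_act \<sigma> -` A \<inter> elems C"
    have "A \<subseteq> elem_act \<sigma> ` ?A"
    proof
      fix x assume x: "x \<in> A"
      then obtain s a where sa: "x = (s, a)" "a \<in> Dom C s" using A(2) by (auto simp: elems_def)
      have "\<sigma> s ` Dom C s = Dom C s" using \<sigma> by (auto simp: automorphisms_def bij_betw_def)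
      then obtain b where "b \<in> Dom C s" "a = \<sigma> s b" using sa(2) by blast
      then show "x \<in> elem_act \<sigma> ` ?A"
        using sa x by (intro image_eqI[of _ _ "(s, b)"]) (auto simp: elems_def)
    qed
    then have im: "elem_act \<sigma> ` ?A = A" by blast
    have "pelem L C C ?A (elem_act \<sigma>)" by (rule pelem_automorphism[OF \<sigma> Cs]) simp
    from pelem_inv[OF this] have "pelem L C C A (inv_into ?A (elem_act \<sigma>))" unfolding im .
    moreover have "elem_act \<sigma> (inv_into ?A (elem_act \<sigma>) x) = x" if "x \<in> A" for x
      by (rule f_inv_into_f) (use that im in blast)
    ultimately show ?thesis by blast
  qed
  show "\<exists>\<sigma>\<in>automorphisms L C. \<forall>x\<in>A. elem_act \<sigma> (k x) = x"
    if A: "finite A" and k: "pelem L C C A k" for A k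
  proof -
    \<comment> \<open>The automorphism has to send \<open>k x\<close> back to \<open>x\<close>, so
      homogeneity is applied to the inverse of \<open>k\<close> on the image of
      \<open>A\<close>.\<close>
    define i where "i = inv_into A k"
    have i: "pelem L C C (k ` A) i" using pelem_inv[OF k] by (simp add: i_def)
    let ?f = "\<lambda>s a. snd (i (s, a))"
    have "elementary_map L C (k ` A) ?f"
      unfolding elementary_map_def
    proof (intro conjI ballI)
      fix y assume y: "y \<in> k ` A"
      then have "i y \<in> elems C" "fst (i y) = fst y" using i by (auto simp: pelem_def)
      then show "case y of (s, a) \<Rightarrow> ?f s a \<in> Dom C s" by (cases y) (auto simp: elems_def)
    next
      fix \<phi> assume "\<phi> \<in> formulas L (param_sort (k ` A))"
      then have "sat C snd [] \<phi> \<longleftrightarrow> sat C (snd \<circ> i) [] \<phi>" using i unfolding pelem_def by blast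
      moreover have "snd \<circ> i = case_prod ?f" by (auto simp: fun_eq_iff)
      ultimately show "sat C snd [] \<phi> \<longleftrightarrow> sat C (case_prod ?f) [] \<phi>" by simp
    qed
    moreover have "k ` A \<subseteq> elems C" using pelem_ran[OF k] .
    moreover have "|k ` A| <o \<kappa>"
      using C A by (intro strong_limit_finite) (auto simp: monster_model_def)
    ultimately obtain \<sigma> where \<sigma>: "\<sigma> \<in> automorphisms L C" "\<forall>(s, a)\<in>k ` A. \<sigma> s a = ?f s a"
      using C unfolding monster_model_def strongly_homogeneous_def by blast
    have "elem_act \<sigma> (k x) = x" if x: "x \<in> A" for x
    proof -
      obtain s a where kx: "k x = (s, a)" by (cases "k x")
      then have "\<sigma> s a = snd (i (k x))" using \<sigma>(2) x by force
      moreover have "i (k x) = x" using x pelem_inj[OF k] by (simp add: i_def)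
      moreover have "fst x = s" using pelem_fst[OF k x] kx by simp
      ultimately show ?thesis unfolding kx by (cases x) simp
    qed
    then show ?thesis using \<sigma>(1) by blast
  qed
qed

text \<open>Saturation of \<open>M\<close> builds the finite maps from \<open>N\<close> to
  \<open>M\<close> out of the empty one; saturation of \<open>N\<close> makes their limit take
  values in types over \<open>N\<close>.\<close>

lemma monster_lim_map:
  assumes T: "complete_theory L T"
    and M: "monster_model L T \<kappa> M" and N: "monster_model L T \<kappa>' N"
  shows "\<exists>\<eta>. \<eta> \<in> types_over.lim_maps L v X M N"
proof -
  have mod: "model_of L T M" "model_of L T N" using M N by (auto simp: monster_model_def)
  have "\<exists>k. pelem L N M A k" if "finite A" "A \<subseteq> elems N" for A
    using hom_ext_finite[OF monster_hom_ext[OF mod(2) M] that finite.emptyI pelem_empty[OF T mod(2,1)]]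
    by auto
  then obtain \<rho> where \<rho>: "\<And>A. finite A \<Longrightarrow> A \<subseteq> elems N \<Longrightarrow> pelem L N M A (\<rho> A)" by metis
  show ?thesis
    by (rule types_over.lim_maps_cluster[OF monster_hom_ext[OF mod(1) N] _ \<rho>])
       (use mod(2) in \<open>auto simp: model_of_def is_struct_def\<close>)
qed

lemma monster_Ellis_group_bounded:
  assumes C: "monster_model L T \<kappa> C"
    and u: "ideal_idempotent (type_space L C v X) (aut_maps L C v X) I u"
  shows "|carrier (Ellis_group (type_space L C v X) I u)| <o \<kappa>"
proof -
  interpret homogeneous_types L v X C by (rule monster_homogeneous_types[OF C])
  have sl: "strong_limit \<kappa>" using C by (simp add: monster_model_def)
  have mu: "min_idem C I u" by (rule min_idem_of_ideal_idempotent[OF u])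
  obtain B where B: "B \<subseteq> elems C" "|B| <o \<kappa>"
    "\<And>A. finite A \<Longrightarrow> A \<subseteq> elems C \<Longrightarrow> \<exists>k. pelem L C C A k \<and> k ` A \<subseteq> B"
    using monster_small_set[OF C] by blast
  have "|idem_group C u| \<le>o |Pow (Pow B \<times> Pow (Pow (B \<times> B)))|"
    using idem_group_injection[OF mu B(1,3)] by (simp only: card_of_ordLeq)
  moreover have "|Pow (Pow B \<times> Pow (Pow (B \<times> B)))| <o \<kappa>"
    by (intro strong_limit_Pow[OF sl] strong_limit_Times[OF sl] B(2))
  ultimately show ?thesis
    unfolding carrier_Ellis_group[OF mu] by (rule ordLeq_ordLess_trans)
qed

theorem theorem1p2:
  fixes L :: "('s, 'f, 'r) lang"
    and T :: "('s, 'f, 'r, unit) fm set"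
    and v :: "'i \<rightharpoonup> 's"
    and X :: "('s, 'f, 'r, 'i) fm set"
    and C\<^sub>1 :: "('s, 'f, 'r, 'm1) struct" and \<kappa>\<^sub>1 :: "'k1 rel"
    and C\<^sub>2 :: "('s, 'f, 'r, 'm2) struct" and \<kappa>\<^sub>2 :: "'k2 rel"
  defines "S\<^sub>1 \<equiv> type_space L C\<^sub>1 v X" and "\<Gamma>\<^sub>1 \<equiv> aut_maps L C\<^sub>1 v X"
    and "S\<^sub>2 \<equiv> type_space L C\<^sub>2 v X" and "\<Gamma>\<^sub>2 \<equiv> aut_maps L C\<^sub>2 v X"
  assumes "complete_theory L T"
    and "X \<subseteq> formulas L v"
    and "monster_model L T \<kappa>\<^sub>1 C\<^sub>1" and "monster_model L T \<kappa>\<^sub>2 C\<^sub>2"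
    and "ideal_idempotent S\<^sub>1 \<Gamma>\<^sub>1 M\<^sub>1 u\<^sub>1" and "ideal_idempotent S\<^sub>2 \<Gamma>\<^sub>2 M\<^sub>2 u\<^sub>2"
  shows "|carrier (Ellis_group S\<^sub>1 M\<^sub>1 u\<^sub>1)| <o \<kappa>\<^sub>1 \<and>
         |carrier (Ellis_group S\<^sub>2 M\<^sub>2 u\<^sub>2)| <o \<kappa>\<^sub>2 \<and>
         (\<exists>h \<in> iso (Ellis_group S\<^sub>1 M\<^sub>1 u\<^sub>1) (Ellis_group S\<^sub>2 M\<^sub>2 u\<^sub>2).
            homeomorphic_map (tau_topology S\<^sub>1 \<Gamma>\<^sub>1 M\<^sub>1 u\<^sub>1) (tau_topology S\<^sub>2 \<Gamma>\<^sub>2 M\<^sub>2 u\<^sub>2) h)"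
proof (intro conjI)
  show "|carrier (Ellis_group S\<^sub>1 M\<^sub>1 u\<^sub>1)| <o \<kappa>\<^sub>1" "|carrier (Ellis_group S\<^sub>2 M\<^sub>2 u\<^sub>2)| <o \<kappa>\<^sub>2"
    using monster_Ellis_group_bounded assms unfolding S\<^sub>1_def \<Gamma>\<^sub>1_def S\<^sub>2_def \<Gamma>\<^sub>2_def by blast+
  interpret H1: homogeneous_types L v X C\<^sub>1 by (rule monster_homogeneous_types) fact
  interpret H2: homogeneous_types L v X C\<^sub>2 by (rule monster_homogeneous_types) fact
  have u1: "H1.min_idem C\<^sub>1 M\<^sub>1 u\<^sub>1" and u2: "H1.min_idem C\<^sub>2 M\<^sub>2 u\<^sub>2"
    using assms(9,10) H1.min_idem_of_ideal_idempotent H2.min_idem_of_ideal_idempotent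
    unfolding S\<^sub>1_def \<Gamma>\<^sub>1_def S\<^sub>2_def \<Gamma>\<^sub>2_def by blast+
  obtain a0 e0 where "a0 \<in> H1.lim_maps C\<^sub>1 C\<^sub>2" "e0 \<in> H1.lim_maps C\<^sub>2 C\<^sub>1"
    using monster_lim_map[OF assms(5,7,8), of v X] monster_lim_map[OF assms(5,8,7), of v X] by blast
  then obtain a b where ab: "H1.lim_iso C\<^sub>1 C\<^sub>2 u\<^sub>1 u\<^sub>2 a b"
    by (rule H1.lim_iso_exists[OF u1 u2])
  let ?h = "H1.transp C\<^sub>1 C\<^sub>2 a b" and ?G = "H1.idem_group C\<^sub>1 u\<^sub>1" and ?H = "H1.idem_group C\<^sub>2 u\<^sub>2"
  have carrier: "carrier (Ellis_group S\<^sub>1 M\<^sub>1 u\<^sub>1) = ?G" "carrier (Ellis_group S\<^sub>2 M\<^sub>2 u\<^sub>2) = ?H"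
    unfolding S\<^sub>1_def S\<^sub>2_def by (rule H1.carrier_Ellis_group[OF u1] H2.carrier_Ellis_group[OF u2])+
  have mult: "mult (Ellis_group S\<^sub>1 M\<^sub>1 u\<^sub>1) = compose (H1.types C\<^sub>1)"
    "mult (Ellis_group S\<^sub>2 M\<^sub>2 u\<^sub>2) = compose (H1.types C\<^sub>2)"
    by (simp_all add: Ellis_group_def S\<^sub>1_def S\<^sub>2_def)
  have bij: "bij_betw ?h ?G ?H" by (rule H1.transp_bij[OF ab])
  have "?h \<in> iso (Ellis_group S\<^sub>1 M\<^sub>1 u\<^sub>1) (Ellis_group S\<^sub>2 M\<^sub>2 u\<^sub>2)"
    unfolding iso_def hom_def mem_Collect_eq carrier mult
    using bij H1.transp_mult[OF ab] by (auto simp: bij_betw_def)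
  moreover have "homeomorphic_map (tau_topology S\<^sub>1 \<Gamma>\<^sub>1 M\<^sub>1 u\<^sub>1) (tau_topology S\<^sub>2 \<Gamma>\<^sub>2 M\<^sub>2 u\<^sub>2) ?h"
    unfolding S\<^sub>1_def \<Gamma>\<^sub>1_def S\<^sub>2_def \<Gamma>\<^sub>2_def
  proof (rule homeomorphic_map_iff_openin_image; unfold H1.topspace_tau[OF u1] H2.topspace_tau[OF u2])
    show "bij_betw ?h ?G ?H" by (rule bij)
    fix U assume U: "U \<subseteq> ?G"
    have inj: "inj_on ?h ?G" and im: "?h ` ?G = ?H" using bij by (auto simp: bij_betw_def)
    \<comment> \<open>Openness is a condition on complements, which the bijection \<open>?h\<close>
      respects.\<close>
    have diff: "?H - ?h ` U = ?h ` (?G - U)"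
      using inj_on_image_set_diff[OF inj _ U, of ?G] im by simp
    have "H1.tau_cl C\<^sub>2 u\<^sub>2 (?H - ?h ` U) = ?h ` H1.tau_cl C\<^sub>1 u\<^sub>1 (?G - U)"
      unfolding diff by (rule H1.transp_tau_eq[OF ab, symmetric]) blast
    then have "H1.tau_cl C\<^sub>2 u\<^sub>2 (?H - ?h ` U) = ?H - ?h ` U \<longleftrightarrow>
        H1.tau_cl C\<^sub>1 u\<^sub>1 (?G - U) = ?G - U"
      unfolding diff using inj_on_image_eq_iff[OF inj H1.tau_cl_subset, of "?G - U"] by auto
    then show "openin (tau_topology (type_space L C\<^sub>2 v X) (aut_maps L C\<^sub>2 v X) M\<^sub>2 u\<^sub>2) (?h ` U) \<longleftrightarrow>
        openin (tau_topology (type_space L C\<^sub>1 v X) (aut_maps L C\<^sub>1 v X) M\<^sub>1 u\<^sub>1) U"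
      unfolding H1.openin_tau[OF u1] H2.openin_tau[OF u2] using U im by auto
  qed
  ultimately show "\<exists>h \<in> iso (Ellis_group S\<^sub>1 M\<^sub>1 u\<^sub>1) (Ellis_group S\<^sub>2 M\<^sub>2 u\<^sub>2).
      homeomorphic_map (tau_topology S\<^sub>1 \<Gamma>\<^sub>1 M\<^sub>1 u\<^sub>1) (tau_topology S\<^sub>2 \<Gamma>\<^sub>2 M\<^sub>2 u\<^sub>2) h"
    by blast
qed

end
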